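(* For a convex integral polytope $P\subset p\Sigma$ in $\mathbb{R}^2$ ($p$ a positive integer), $$\frac1N\,\mathbf{E}_{|NP}\Big(\nu_{\mathrm{AT}}\big(\mathrm{Log}(Z_f)\big)\Big)\to\mathrm{Length}(\partial^eP)\quad\text{as } N\to\infty.$$
   Context: $\Sigma=\{x\in\mathbb{R}^2: x_1,x_2\ge 0,\ x_1+x_2\le 1\}$; $\mathbb{C}^*=\mathbb{C}\setminus\{0\}$. A convex integral polytope is the convex hull of a finite set of points of $\mathbb{Z}^2$. Random polynomials: $\mathbf{E}_{|NP}$ is expectation for $f=\sum_{\alpha\in NP\cap\mathbb{Z}^2}c_\alpha z^\alpha/\|z^\alpha\|$, with $c_\alpha$ independent standard complex Gaussians (density $\frac1\pi e^{-|c|^2}$) and $\|z^\alpha\|=\left[\frac{(Np-|\alpha|)!\,\alpha_1!\,\alpha_2!}{(Np+2)!}\right]^{1/2}$. $Z_f$ is the zero set of $f$ in $(\mathbb{C}^* )^2$. Amoebas: $\mathrm{Log}(z_1,z_2)=(\log|z_1|,\log|z_2|)$ and $\mu(z)=\left(\frac{|z_1|^2}{1+\|z\|^2},\frac{|z_2|^2}{1+\|z\|^2}\right)$ on $(\mathbb{C}^* )^2$. The amoeba $\mathrm{Log}(Z_f)$ corresponds to the compact amoeba $A\subset\Sigma$ (the closure in $\Sigma$ of $\mu(Z_f)$) under the diffeomorphism $\mathbb{R}^2\approx\Sigma^\circ$ that takes $\mathrm{Log}(z)$ to $\mu(z)$. A tentacle is a connected component of a small neighborhood in $A$ of $A\cap\partial\Sigma$.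 For a generic polynomial with Newton polytope $NP$, tentacles correspond to the segments joining adjacent lattice points of $\partial(NP)$. Let $\partial^eP=P\cap\partial(p\Sigma)$. Tentacles corresponding to segments of $\partial^e(NP)=NP\cap\partial(Np\Sigma)$ are called free tentacles; they end at points of the closed side of $\Sigma$ containing ($\frac1{Np}$ times) the segment, almost surely in the relatively open side. A free tentacle is classically allowed if its end lies in the classically allowed portion of $\partial\Sigma$, i.e. in the relative interior of one of the segments $\frac1p(P\cap\bar F_j)$, where $\bar F_1,\bar F_2,\bar F_3$ are the closed sides of $p\Sigma$. $\nu_{\mathrm{AT}}$ is the number of classically allowed tentacles. $\mathrm{Length}(\partial^eP)$ is the lattice length, i.e. the number of segments joining adjacent lattice points that make up $\partial^eP$ (so each side of $p\Sigma$, including the diagonal one, has length $p$). *)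

theory Defs
  imports "HOL-Probability.Probability"
begin

section \<open>Polytopes and lattice segments\<close>

text \<open>The plane is \<open>real \<times> real\<close> with its Euclidean structure; \<open>\<complex>\<^sup>2\<close> is \<open>complex \<times> complex\<close>.\<close>

definition std_triangle :: "(real \<times> real) set" where
  "std_triangle = {x. 0 \<le> fst x \<and> 0 \<le> snd x \<and> fst x + snd x \<le> 1}"

abbreviation dilate :: "real \<Rightarrow> (real \<times> real) set \<Rightarrow> (real \<times> real) set" where
  "dilate t X \<equiv> (\<lambda>x. t *\<^sub>R x) ` X"

definition lattice :: "(real \<times> real) set" where
  "lattice = \<int> \<times> \<int>"

definition convex_integral_polytope :: "(real \<times> real) set \<Rightarrow> bool" where
  "convex_integral_polytope P \<longleftrightarrow> (\<exists>S. finite S \<and> S \<subseteq> lattice \<and> P = convex hull S)"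

definition lattice_segments :: "(real \<times> real) set \<Rightarrow> (real \<times> real) set set" where
  "lattice_segments X = {closed_segment a b | a b.
     a \<in> lattice \<and> b \<in> lattice \<and> a \<noteq> b \<and>
     closed_segment a b \<inter> lattice = {a, b} \<and> closed_segment a b \<subseteq> X}"

definition lattice_length :: "(real \<times> real) set \<Rightarrow> nat" where
  "lattice_length X = card (lattice_segments X)"

text \<open>The part \<open>\<partial>\<^sup>eQ\<close> of \<open>Q\<close> on the boundary of the triangle of size \<open>d\<close>.\<close>

definition ext_boundary :: "nat \<Rightarrow> (real \<times> real) set \<Rightarrow> (real \<times> real) set" where
  "ext_boundary d Q = Q \<inter> frontier (dilate (real d) std_triangle)"

definition closed_sides :: "nat \<Rightarrow> (real \<times> real) set set" where
  "closed_sides d =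
    {{x \<in> dilate (real d) std_triangle. fst x = 0},
     {x \<in> dilate (real d) std_triangle. snd x = 0},
     {x \<in> dilate (real d) std_triangle. fst x + snd x = real d}}"

text \<open>The classically allowed portion of the boundary of the triangle. Sides that \<open>P\<close> meets in
  at most one point contribute no segment; they have to be left out explicitly because
  \<^term>\<open>rel_interior {a}\<close> is \<^term>\<open>{a}\<close>.\<close>

definition allowed_boundary :: "nat \<Rightarrow> (real \<times> real) set \<Rightarrow> (real \<times> real) set" where
  "allowed_boundary p P =
    (\<Union>F \<in> {F \<in> closed_sides p. aff_dim (P \<inter> F) = 1}. rel_interior (dilate (1 / real p) (P \<inter> F)))"

section \<open>Gaussian random polynomials with prescribed Newton polytope\<close>

text \<open>Exponents are pairs of natural numbers: all sets \<open>Q\<close> in question lie in the triangle of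
  size \<open>d\<close>, so their lattice points have nonnegative coordinates of sum at most \<open>d\<close>.\<close>

definition exponents :: "(real \<times> real) set \<Rightarrow> (nat \<times> nat) set" where
  "exponents Q = {\<alpha>. (real (fst \<alpha>), real (snd \<alpha>)) \<in> Q}"

definition monom_norm :: "nat \<Rightarrow> nat \<times> nat \<Rightarrow> real" where
  "monom_norm d \<alpha> =
    sqrt (fact (d - (fst \<alpha> + snd \<alpha>)) * fact (fst \<alpha>) * fact (snd \<alpha>) / fact (d + 2))"

definition random_poly ::
  "nat \<Rightarrow> (real \<times> real) set \<Rightarrow> (nat \<times> nat \<Rightarrow> complex) \<Rightarrow> complex \<times> complex \<Rightarrow> complex" where
  "random_poly d Q c z =
    (\<Sum>\<alpha>\<in>exponents Q. c \<alpha> * (fst z ^ fst \<alpha> * snd z ^ snd \<alpha>) / of_real (monom_norm d \<alpha>))"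

definition std_complex_gaussian :: "complex measure" where
  "std_complex_gaussian = density lborel (\<lambda>c. ennreal (exp (- (cmod c)\<^sup>2) / pi))"

text \<open>The product measure is completed since the random variables of interest are only
  determined almost surely; this does not change the integral of a measurable function.\<close>

definition poly_expectation ::
  "nat \<Rightarrow> (real \<times> real) set \<Rightarrow> ((complex \<times> complex \<Rightarrow> complex) \<Rightarrow> real) \<Rightarrow> real" where
  "poly_expectation d Q X =
    integral\<^sup>L (completion (Pi\<^sub>M (exponents Q) (\<lambda>_. std_complex_gaussian)))
      (\<lambda>c. X (random_poly d Q c))"

section \<open>Amoebas\<close>

definition torus :: "(complex \<times> complex) set" where
  "torus = (- {0}) \<times> (- {0})"

definition torus_zeros :: "(complex \<times> complex \<Rightarrow> complex) \<Rightarrow> (complex \<times> complex) set" where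
  "torus_zeros f = {z \<in> torus. f z = 0}"

definition Log_map :: "complex \<times> complex \<Rightarrow> real \<times> real" where
  "Log_map z = (ln (cmod (fst z)), ln (cmod (snd z)))"

definition moment_map :: "complex \<times> complex \<Rightarrow> real \<times> real" where
  "moment_map z =
    ((cmod (fst z))\<^sup>2 / (1 + (norm z)\<^sup>2), (cmod (snd z))\<^sup>2 / (1 + (norm z)\<^sup>2))"

text \<open>The diffeomorphism from the plane onto the open triangle taking \<open>Log_map z\<close> to
  \<open>moment_map z\<close>.\<close>

definition triangle_of_log :: "real \<times> real \<Rightarrow> real \<times> real" where
  "triangle_of_log u =
    (exp (2 * fst u) / (1 + exp (2 * fst u) + exp (2 * snd u)),
     exp (2 * snd u) / (1 + exp (2 * fst u) + exp (2 * snd u)))"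

lemma triangle_of_log_Log_map:
  assumes "z \<in> torus"
  shows "triangle_of_log (Log_map z) = moment_map z"
proof -
  have *: "exp (2 * ln (cmod w)) = (cmod w)\<^sup>2" if "w \<noteq> 0" for w
    using that by (simp add: exp_double)
  have "(norm z)\<^sup>2 = (cmod (fst z))\<^sup>2 + (cmod (snd z))\<^sup>2"
    by (simp add: norm_prod_def)
  then show ?thesis
    using assms by (auto simp: torus_def triangle_of_log_def Log_map_def moment_map_def * add.assoc)
qed

text \<open>The compact amoeba of an amoeba \<open>B\<close> in logarithmic coordinates. The closure in the
  closed triangle is the closure in the plane.\<close>

definition compact_amoeba :: "(real \<times> real) set \<Rightarrow> (real \<times> real) set" where
  "compact_amoeba B = closure (triangle_of_log ` B)"

lemma compact_amoeba_torus_zeros: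
  "compact_amoeba (Log_map ` torus_zeros f) = closure (moment_map ` torus_zeros f)"
proof -
  have "triangle_of_log ` Log_map ` torus_zeros f = moment_map ` torus_zeros f"
    unfolding image_image
    by (rule image_cong) (auto simp: torus_zeros_def triangle_of_log_Log_map)
  then show ?thesis by (simp add: compact_amoeba_def)
qed

section \<open>Tentacles\<close>

definition tentacles :: "(real \<times> real) set \<Rightarrow> real \<Rightarrow> (real \<times> real) set set" where
  "tentacles B \<epsilon> = (let A = compact_amoeba B in
     components {x \<in> A. \<exists>y \<in> A \<inter> frontier std_triangle. dist x y < \<epsilon>})"

text \<open>In logarithmic coordinates, the tentacles corresponding to the lattice segments of an edge of
  the Newton polytope are those going to infinity in the direction of the outer normal to that
  edge. Along a segment \<open>s\<close> of \<open>\<partial>\<^sup>eQ\<close> this normal is the outer normal to the side of the triangle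
  of size \<open>d\<close> containing \<open>s\<close>; taking it from the triangle also singles out one of the two normals
  if \<open>Q\<close> is itself a segment.\<close>

definition asymptotic_direction ::
  "(real \<times> real) set \<Rightarrow> (real \<times> real) set \<Rightarrow> real \<times> real \<Rightarrow> bool" where
  "asymptotic_direction B T v \<longleftrightarrow>
    (sgn \<longlongrightarrow> sgn v) (inf at_infinity (principal {u \<in> B. triangle_of_log u \<in> T}))"

definition outer_normal :: "(real \<times> real) set \<Rightarrow> (real \<times> real) set \<Rightarrow> real \<times> real \<Rightarrow> bool" where
  "outer_normal K s v \<longleftrightarrow> v \<noteq> 0 \<and> (\<forall>x\<in>s. \<forall>y\<in>K. v \<bullet> y \<le> v \<bullet> x)"

definition free_tentacle ::
  "nat \<Rightarrow> (real \<times> real) set \<Rightarrow> (real \<times> real) set \<Rightarrow> (real \<times> real) set \<Rightarrow> bool" where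
  "free_tentacle d Q B T \<longleftrightarrow>
    (\<exists>s \<in> lattice_segments (ext_boundary d Q). \<exists>v.
       outer_normal (dilate (real d) std_triangle) s v \<and> asymptotic_direction B T v)"

definition ends_allowed ::
  "nat \<Rightarrow> (real \<times> real) set \<Rightarrow> (real \<times> real) set \<Rightarrow> bool" where
  "ends_allowed p P T \<longleftrightarrow>
    (\<exists>e. T \<inter> frontier std_triangle = {e} \<and> e \<in> allowed_boundary p P)"

text \<open>The number of classically allowed tentacles of an amoeba \<open>B\<close> for the Newton polytope \<open>NP\<close>,
  i.e. the number common to all sufficiently small neighborhoods.\<close>

definition nu_AT ::
  "nat \<Rightarrow> (real \<times> real) set \<Rightarrow> nat \<Rightarrow> (real \<times> real) set \<Rightarrow> nat" where
  "nu_AT p P N B = (THE n. \<forall>\<^sub>F \<epsilon> in at_right 0.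
     card {T \<in> tentacles B \<epsilon>.
       free_tentacle (N * p) (dilate (real N) P) B T \<and> ends_allowed p P T} = n)"

end

(*
  An allowed tentacle is determined by its end point, so only the points of the compact amoeba in
  the classically allowed part of the boundary have to be counted. In projective coordinates adapted
  to a side of the triangle, these are the positions |w|^2 / (1 + |w|^2) of the roots w of the
  edge polynomial, the part of f supported on that side. The edge polynomial is a Gaussian
  polynomial whose coefficient variances are the binomial weights truncated to the exponents
  N a, ..., N b, and almost surely its N (b - a) roots have distinct moduli. It remains to see
  that on average only o(N) roots lie outside the allowed annulus with radii given by a / p and
  b / p. By Landau's inequality, m roots of modulus at least r exp(delta) force
  exp(2 delta m) to be bounded by the quotient of the sum of all |c_k|^2 W_k and its extreme term,
  where W_k are the weights at radius r. At the radius where the extreme term is the mode of the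
  binomial distribution this quotient is of polynomial size in N, and moving the radius by a factor
  exp(-delta) costs only exp(N o(delta)).
*)

theory Submission
  imports Defs "HOL-Computational_Algebra.Fundamental_Theorem_Algebra" "HOL-Real_Asymp.Real_Asymp"
begin

section \<open>Root counts from Landau's inequality\<close>

text \<open>Since at most N (b - a) root positions exist on an edge, an upper bound for the stray
  roots settles the limit. Two logarithms would obstruct taking its expectation. That of the random
  coefficient sum is replaced by a linear quotient of mean at most 4. That of the extreme
  coefficient is controlled outside a ball of radius \<eta>; on the ball the trivial bound N (b - a)
  is paid with a small probability. The margin \<delta> is there because Landau's inequality gains
  nothing from roots on the circle itself; the price of dividing by 2 \<delta> is bearable because
  the exponential rate vanishes at the mode together with its derivative. So \<eta> and \<delta> are
  fixed before N grows. A boundary point of the amoeba sees only the modulus of a root, whence the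
  need for distinct moduli; the null set is found by freezing all but two coefficients, and Fubini
  then asks for measurable root counts. Since the measure is completed, it is enough to identify the
  tentacle count almost surely.\<close>

lemma root_flip_norm:
  fixes q :: "complex poly" and a :: complex
  assumes "degree q < m"
  shows "(\<Sum>k\<le>m. (cmod (coeff ([:-1, cnj a:] * q) k))\<^sup>2) = (\<Sum>k\<le>m. (cmod (coeff ([:-a, 1:] * q) k))\<^sup>2)"
proof -
  let ?u = "\<lambda>k. (cmod (coeff q k))\<^sup>2"
  let ?v = "\<lambda>k. if k = 0 then 0 else (cmod (coeff q (k - 1)))\<^sup>2"
  have shift: "(\<Sum>k\<le>m. ?v k) = (\<Sum>k\<le>m. ?u k)"
  proof -
    obtain m' where m: "m = Suc m'" using assms by (cases m) auto
    have "(\<Sum>k\<le>m. ?v k) = (\<Sum>k\<le>m'. ?u k)"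
      unfolding m by (subst sum.atMost_Suc_shift) simp
    also have "\<dots> = (\<Sum>k\<le>m. ?u k)"
      using assms by (simp add: m coeff_eq_0)
    finally show ?thesis .
  qed
  \<comment> \<open>On the unit circle the two linear factors have equal modulus. Coefficientwise,
    the cross terms agree, and what remains is a multiple of a difference of neighbouring squared
    moduli, whose sum telescopes.\<close>
  have eq: "(cmod (coeff ([:-1, cnj a:] * q) k))\<^sup>2 - (cmod (coeff ([:-a, 1:] * q) k))\<^sup>2
      = ((cmod a)\<^sup>2 - 1) * (?v k - ?u k)" for k
  proof (cases k)
    case 0
    then show ?thesis by (simp add: norm_mult power_mult_distrib algebra_simps)
  next
    case (Suc l)
    have c: "(cmod (x - y))\<^sup>2 = (cmod x)\<^sup>2 + (cmod y)\<^sup>2 - 2 * Re (x * cnj y)" for x y :: complex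
      by (simp only: cmod_power2) (simp add: power2_eq_square algebra_simps)
    have "coeff ([:-1, cnj a:] * q) k = cnj a * coeff q l - coeff q k"
         "coeff ([:-a, 1:] * q) k = coeff q l - a * coeff q k"
      using Suc by (simp_all)
    then show ?thesis
      using Suc by (simp only: c) (simp add: norm_mult power_mult_distrib algebra_simps)
  qed
  have "(\<Sum>k\<le>m. (cmod (coeff ([:-1, cnj a:] * q) k))\<^sup>2) - (\<Sum>k\<le>m. (cmod (coeff ([:-a, 1:] * q) k))\<^sup>2)
      = ((cmod a)\<^sup>2 - 1) * ((\<Sum>k\<le>m. ?v k) - (\<Sum>k\<le>m. ?u k))"
    by (simp only: sum_subtractf[symmetric] eq sum_distrib_left)
  with shift show ?thesis by simp
qed

text \<open>The induction runs over all \<open>q\<close>, so that a factor already reflected is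
  absorbed into \<open>q\<close>; the degree bound leaves room for the factors still to
  come.\<close>

lemma root_flips_norm:
  fixes q :: "complex poly" and a :: "'i \<Rightarrow> complex"
  assumes "finite I" and "q \<noteq> 0" and "degree q + card I \<le> m"
  shows "(\<Sum>k\<le>m. (cmod (coeff ((\<Prod>i\<in>I. if cmod (a i) > 1 then [:-1, cnj (a i):] else [:-a i, 1:]) * q) k))\<^sup>2)
    = (\<Sum>k\<le>m. (cmod (coeff ((\<Prod>i\<in>I. [:-a i, 1:]) * q) k))\<^sup>2)"
  using assms
proof (induction I arbitrary: q)
  case empty
  then show ?case by simp
next
  case (insert i I)
  let ?h = "\<lambda>i. if cmod (a i) > 1 then [:-1, cnj (a i):] else [:-a i, 1:]"
  let ?l = "\<lambda>i. [:-a i, 1:]"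
  have ne: "?h i \<noteq> 0" by simp
  have deg: "degree (?h i * q) \<le> Suc (degree q)"
    using degree_mult_le[of "?h i" q] by (auto split: if_splits)
  have d2: "degree ((\<Prod>i\<in>I. ?l i) * q) < m"
  proof -
    have "degree (\<Prod>i\<in>I. ?l i) \<le> card I"
      using degree_prod_sum_le[of I ?l] insert.hyps by (simp add: o_def)
    with degree_mult_le[of "\<Prod>i\<in>I. ?l i" q] insert.prems insert.hyps show ?thesis by simp
  qed
  have "(\<Sum>k\<le>m. (cmod (coeff ((\<Prod>i\<in>insert i I. ?h i) * q) k))\<^sup>2)
      = (\<Sum>k\<le>m. (cmod (coeff ((\<Prod>i\<in>I. ?h i) * (?h i * q)) k))\<^sup>2)"
    using insert.hyps by (simp add: mult_ac del: mult_pCons_left mult_pCons_right)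
  also have "\<dots> = (\<Sum>k\<le>m. (cmod (coeff ((\<Prod>i\<in>I. ?l i) * (?h i * q)) k))\<^sup>2)"
    using insert.prems insert.hyps deg ne by (intro insert.IH) (auto simp del: mult_pCons_left mult_pCons_right)
  also have "\<dots> = (\<Sum>k\<le>m. (cmod (coeff (?h i * ((\<Prod>i\<in>I. ?l i) * q)) k))\<^sup>2)"
    by (simp only: mult.left_commute)
  also have "\<dots> = (\<Sum>k\<le>m. (cmod (coeff (?l i * ((\<Prod>i\<in>I. ?l i) * q)) k))\<^sup>2)"
    using root_flip_norm[OF d2] by simp
  also have "\<dots> = (\<Sum>k\<le>m. (cmod (coeff ((\<Prod>i\<in>insert i I. ?l i) * q) k))\<^sup>2)"
    using insert.hyps by (simp add: mult.assoc del: mult_pCons_left mult_pCons_right)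
  finally show ?case .
qed

text \<open>The coefficient at \<open>card I\<close> is read off formally, whether or not it is the
  leading one.\<close>

lemma coeff_prod_sum_degree:
  fixes f :: "'i \<Rightarrow> 'a::comm_ring_1 poly"
  assumes "finite I" "\<And>i. i \<in> I \<Longrightarrow> degree (f i) \<le> 1"
  shows "coeff (\<Prod>i\<in>I. f i) (card I) = (\<Prod>i\<in>I. coeff (f i) 1) \<and> degree (\<Prod>i\<in>I. f i) \<le> card I"
  using assms
proof (induction I)
  case (insert i I)
  have "coeff (f i * (\<Prod>i\<in>I. f i)) (1 + card I) = coeff (f i) 1 * coeff (\<Prod>i\<in>I. f i) (card I)"
  proof -
    have f: "f i = [:coeff (f i) 0, coeff (f i) 1:]"
      using insert.prems[of i] by (intro poly_eqI) (auto simp: coeff_pCons coeff_eq_0 split: nat.splits)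
    have "coeff (\<Prod>i\<in>I. f i) (Suc (card I)) = 0"
      using insert by (intro coeff_eq_0) auto
    then show ?thesis by (subst f) simp
  qed
  moreover have "degree (f i * (\<Prod>i\<in>I. f i)) \<le> 1 + card I"
    using insert degree_mult_le[of "f i" "\<Prod>i\<in>I. f i"] by fastforce
  ultimately show ?case using insert by simp
qed simp

text \<open>Landau's inequality: reflecting the roots outside the unit disc at the unit circle does not
  change the sum of the squared moduli of the coefficients.\<close>

lemma landau_lead:
  fixes a :: "nat \<Rightarrow> complex" and c :: complex and n :: nat
  defines "q \<equiv> smult c (\<Prod>i<n. [:-a i, 1:])"
  shows "(cmod c)\<^sup>2 * (\<Prod>i<n. (max 1 (cmod (a i)))\<^sup>2) \<le> (\<Sum>k\<le>n. (cmod (coeff q k))\<^sup>2)"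
proof (cases "c = 0")
  case False
  let ?h = "\<lambda>i. if cmod (a i) > 1 then [:-1, cnj (a i):] else [:-a i, 1:]"
  have "coeff (\<Prod>i<n. ?h i) n = (\<Prod>i<n. coeff (?h i) 1)"
    using coeff_prod_sum_degree[of "{..<n}" ?h] by simp
  \<comment> \<open>A reflected root contributes its modulus to the top coefficient, any other root
    contributes 1. Landau's product is thus a single term of the coefficient sum.\<close>
  moreover have "cmod (coeff (?h i) 1) = max 1 (cmod (a i))" for i by auto
  ultimately have "(cmod (coeff (\<Prod>i<n. ?h i) n))\<^sup>2 = (\<Prod>i<n. (max 1 (cmod (a i)))\<^sup>2)"
    by (simp add: prod_norm[symmetric] prod_power_distrib)
  then have "(cmod c)\<^sup>2 * (\<Prod>i<n. (max 1 (cmod (a i)))\<^sup>2) = (cmod (coeff ((\<Prod>i<n. ?h i) * [:c:]) n))\<^sup>2"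
    by (simp add: norm_mult power_mult_distrib)
  also have "\<dots> \<le> (\<Sum>k\<le>n. (cmod (coeff ((\<Prod>i<n. ?h i) * [:c:]) k))\<^sup>2)"
    by (rule member_le_sum) auto
  also have "\<dots> = (\<Sum>k\<le>n. (cmod (coeff ((\<Prod>i<n. [:-a i, 1:]) * [:c:]) k))\<^sup>2)"
    using False by (intro root_flips_norm) auto
  also have "\<dots> = (\<Sum>k\<le>n. (cmod (coeff q k))\<^sup>2)" by (simp add: q_def)
  finally show ?thesis .
qed (simp add: sum_nonneg)

text \<open>The same bound read from the constant term, which carries a factor |a_i| for each root:
  |a| max(1, 1/|a|) = max(1, |a|).\<close>

lemma landau_const:
  fixes a :: "nat \<Rightarrow> complex" and c :: complex and n :: nat
  assumes "\<And>i. i < n \<Longrightarrow> a i \<noteq> 0"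
  defines "q \<equiv> smult c (\<Prod>i<n. [:-a i, 1:])"
  shows "(cmod (coeff q 0))\<^sup>2 * (\<Prod>i<n. (max 1 (1 / cmod (a i)))\<^sup>2) \<le> (\<Sum>k\<le>n. (cmod (coeff q k))\<^sup>2)"
proof -
  have "coeff q 0 = c * (\<Prod>i<n. - a i)"
    by (simp add: q_def poly_0_coeff_0[symmetric] poly_prod)
  then have "(cmod (coeff q 0))\<^sup>2 * (\<Prod>i<n. (max 1 (1 / cmod (a i)))\<^sup>2)
      = (cmod c)\<^sup>2 * (\<Prod>i<n. (cmod (a i) * max 1 (1 / cmod (a i)))\<^sup>2)"
    by (simp add: norm_mult power_mult_distrib prod_norm[symmetric] prod_power_distrib prod.distrib)
  also have "(\<Prod>i<n. (cmod (a i) * max 1 (1 / cmod (a i)))\<^sup>2) = (\<Prod>i<n. (max 1 (cmod (a i)))\<^sup>2)"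
    using assms(1) by (intro prod.cong) (auto simp: max_def field_simps)
  finally show ?thesis
    using landau_lead[where c=c and n=n and a=a] by (simp add: q_def)
qed

lemma card_power_le_prod:
  fixes u :: "'i \<Rightarrow> real"
  assumes "finite I" "t \<ge> 1" "\<And>i. i \<in> I \<Longrightarrow> u i \<ge> 1" "S \<subseteq> I" "\<And>i. i \<in> S \<Longrightarrow> u i \<ge> t"
  shows "t ^ card S \<le> (\<Prod>i\<in>I. u i)"
proof -
  have nn: "0 \<le> u i" if "i \<in> I" for i using assms(3)[OF that] by simp
  have "t ^ card S = (\<Prod>i\<in>S. t)" by simp
  also have "\<dots> \<le> (\<Prod>i\<in>S. u i)"
    using assms by (intro prod_mono) auto
  also have "\<dots> \<le> (\<Prod>i\<in>I. u i)"
    using assms nn by (intro prod_mono2) auto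
  finally show ?thesis .
qed

text \<open>Rescaling the variable by \<open>r\<close> transports estimates on the unit circle to
  the circle of radius \<open>r\<close>.\<close>

lemma poly_scale_roots:
  fixes a :: "nat \<Rightarrow> complex" and c :: complex and n :: nat and r :: real
  assumes "r > 0"
  defines "q \<equiv> smult c (\<Prod>i<n. [:-a i, 1:])"
  shows "coeff (smult (c * r ^ n) (\<Prod>i<n. [:-(a i / r), 1:])) k = coeff q k * r ^ k"
proof -
  have "smult (c * r ^ n) (\<Prod>i<n. [:-(a i / r), 1:]) = smult c (\<Prod>i<n. [:-a i, r:])"
  proof -
    have "[:-a i, r:] = smult r [:-(a i / r), 1:]" for i using assms by simp
    then have "(\<Prod>i<n. [:-a i, complex_of_real r:]) = (\<Prod>i<n. smult r [:-(a i / r), 1:])"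
      by simp
    also have "\<dots> = smult (r ^ n) (\<Prod>i<n. [:-(a i / r), 1:])"
      by (simp add: prod_smult del: smult_pCons)
    finally show ?thesis by simp
  qed
  also have "\<dots> = q \<circ>\<^sub>p [:0, r:]"
    by (simp add: q_def pcompose_smult pcompose_prod pcompose_pCons)
  also have "coeff \<dots> k = coeff q k * r ^ k"
    by (simp add: coeff_pcompose_linear mult.commute)
  finally show ?thesis .
qed

text \<open>After division by \<open>r\<close>, each counted root contributes a factor of at least
  t^2 to the product in Landau's inequality; all other factors are at least 1.\<close>

lemma large_roots_bound:
  fixes a :: "nat \<Rightarrow> complex" and c :: complex and n :: nat and r t :: real
  assumes "r > 0" "t \<ge> 1"
  defines "q \<equiv> smult c (\<Prod>i<n. [:-a i, 1:])"
  shows "(cmod c * r ^ n)\<^sup>2 * (t\<^sup>2) ^ card {i. i < n \<and> cmod (a i) \<ge> r * t} \<le> (\<Sum>k\<le>n. (cmod (coeff q k) * r ^ k)\<^sup>2)"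
proof -
  let ?q = "smult (c * r ^ n) (\<Prod>i<n. [:-(a i / r), 1:])"
  have co: "cmod (coeff ?q k) = cmod (coeff q k) * r ^ k" for k
    using assms by (subst poly_scale_roots) (auto simp: q_def norm_mult norm_power)
  have "(t\<^sup>2) ^ card {i. i < n \<and> cmod (a i) \<ge> r * t} \<le> (\<Prod>i<n. (max 1 (cmod (a i / r)))\<^sup>2)"
    using assms(1,2) by (intro card_power_le_prod power_mono) (auto simp: norm_divide le_max_iff_disj field_simps)
  then have "(cmod c * r ^ n)\<^sup>2 * (t\<^sup>2) ^ card {i. i < n \<and> cmod (a i) \<ge> r * t}
      \<le> (cmod (c * r ^ n))\<^sup>2 * (\<Prod>i<n. (max 1 (cmod (a i / r)))\<^sup>2)"
    using assms(1,2) by (simp add: norm_mult norm_power mult_left_mono)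
  also have "\<dots> \<le> (\<Sum>k\<le>n. (cmod (coeff ?q k))\<^sup>2)"
    by (rule landau_lead)
  finally show ?thesis unfolding co .
qed

lemma small_roots_bound:
  fixes a :: "nat \<Rightarrow> complex" and c :: complex and n :: nat and r t :: real
  assumes "r > 0" "t \<ge> 1" and nz: "\<And>i. i < n \<Longrightarrow> a i \<noteq> 0"
  defines "q \<equiv> smult c (\<Prod>i<n. [:-a i, 1:])"
  shows "(cmod (coeff q 0))\<^sup>2 * (t\<^sup>2) ^ card {i. i < n \<and> cmod (a i) * t \<le> r} \<le> (\<Sum>k\<le>n. (cmod (coeff q k) * r ^ k)\<^sup>2)"
proof -
  let ?q = "smult (c * r ^ n) (\<Prod>i<n. [:-(a i / r), 1:])"
  have co: "cmod (coeff ?q k) = cmod (coeff q k) * r ^ k" for k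
    using assms by (subst poly_scale_roots) (auto simp: q_def norm_mult norm_power)
  have "(t\<^sup>2) ^ card {i. i < n \<and> cmod (a i) * t \<le> r} \<le> (\<Prod>i<n. (max 1 (1 / cmod (a i / r)))\<^sup>2)"
    using assms(1-3) by (intro card_power_le_prod power_mono) (auto simp: norm_divide le_max_iff_disj field_simps)
  then have "(cmod (coeff q 0))\<^sup>2 * (t\<^sup>2) ^ card {i. i < n \<and> cmod (a i) * t \<le> r}
      \<le> (cmod (coeff ?q 0))\<^sup>2 * (\<Prod>i<n. (max 1 (1 / cmod (a i / r)))\<^sup>2)"
    unfolding co by (simp add: mult_left_mono)
  also have "\<dots> \<le> (\<Sum>k\<le>n. (cmod (coeff ?q k))\<^sup>2)"
    using assms(1,3) by (intro landau_const) auto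
  finally show ?thesis unfolding co .
qed

section \<open>Tilted binomial weights\<close>

text \<open>The quotient of consecutive weights is (d - k) j / ((k + 1) (d - j)), which is at least
  1 for k < j and at most 1 for k \<ge> j; so the weights increase up to \<open>j\<close> and
  decrease afterwards.\<close>

lemma binomial_weight_le_mode:
  assumes "j < d"
  shows "real (d choose k) * (real j / real (d - j)) ^ k \<le> real (d choose j) * (real j / real (d - j)) ^ j"
proof -
  let ?t = "\<lambda>k. real (d choose k) * (real j / real (d - j)) ^ k"
  have step: "?t (Suc k) * (real (Suc k) * real (d - j)) = ?t k * (real (d - k) * real j)" for k
  proof -
    have "real (Suc k) * real (d choose Suc k) = real (d - k) * real (d choose k)"
      using binomial_absorb_comp[of d k] binomial_absorption[of k d]
      by (metis of_nat_mult)
    then have "(real (Suc k) * real (d choose Suc k)) * (real j * (real j / real (d - j)) ^ k)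
        = real (d - k) * real (d choose k) * (real j * (real j / real (d - j)) ^ k)" by simp
    moreover have "real (d - j) * (real j / real (d - j)) ^ Suc k = real j * (real j / real (d - j)) ^ k"
      using assms by simp
    ultimately show ?thesis by (simp only: mult_ac)
  qed
  have pos: "?t k \<ge> 0" for k by simp
  have up: "?t k \<le> ?t (Suc k)" if "Suc k \<le> j" for k
  proof -
    have "d * Suc k \<le> (d + 1) * j" using that mult_le_mono2[OF that, of d] by (simp add: algebra_simps)
    then have "Suc k * (d - j) \<le> (d - k) * j"
      using that assms by (simp add: diff_mult_distrib diff_mult_distrib2 algebra_simps)
    then have "real (Suc k) * real (d - j) \<le> real (d - k) * real j"
      by (metis of_nat_le_iff of_nat_mult)
    then have "?t k * (real (Suc k) * real (d - j)) \<le> ?t (Suc k) * (real (Suc k) * real (d - j))"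
      unfolding step using pos by (intro mult_left_mono)
    then show ?thesis using assms by (subst (asm) mult_le_cancel_right) auto
  qed
  have down: "?t (Suc k) \<le> ?t k" if "j \<le> k" for k
  proof (cases "k < d")
    case True
    have "d * j \<le> d * k" using that by (rule mult_le_mono2)
    moreover have "(d + 1) * j = d * j + j" "d * Suc k = d * k + d" by simp_all
    ultimately have "(d + 1) * j \<le> d * Suc k" using assms by linarith
    then have "(d - k) * j \<le> Suc k * (d - j)"
      using that assms True by (simp add: diff_mult_distrib diff_mult_distrib2 algebra_simps)
    then have "real (d - k) * real j \<le> real (Suc k) * real (d - j)"
      by (metis of_nat_le_iff of_nat_mult)
    then have "?t (Suc k) * (real (Suc k) * real (d - j)) \<le> ?t k * (real (Suc k) * real (d - j))"
      unfolding step using pos by (intro mult_left_mono)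
    then show ?thesis using assms by (subst (asm) mult_le_cancel_right) auto
  qed (simp add: binomial_eq_0)
  show ?thesis
  proof (cases "k \<le> j")
    case True
    then show ?thesis
    proof (induction rule: inc_induct)
      case (step n)
      then show ?case using up[of n] by linarith
    qed simp
  next
    case False
    then have "j \<le> k" by simp
    then show ?thesis
    proof (induction rule: dec_induct)
      case (step n)
      then show ?case using down[of n] by linarith
    qed simp
  qed
qed

text \<open>The largest of the \<open>d + 1\<close> terms is at least their average. This factor is
  the polynomial loss in the final estimate.\<close>

lemma binomial_mode_ge:
  assumes "j < d"
  shows "(1 + real j / real (d - j)) ^ d \<le> (real d + 1) * (real (d choose j) * (real j / real (d - j)) ^ j)"
proof -
  have "(1 + real j / real (d - j)) ^ d = (\<Sum>k\<le>d. real (d choose k) * (real j / real (d - j)) ^ k)"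
    by (subst add.commute) (simp add: binomial_ring)
  also have "\<dots> \<le> (\<Sum>k\<le>d. real (d choose j) * (real j / real (d - j)) ^ j)"
    by (intro sum_mono binomial_weight_le_mode assms)
  finally show ?thesis by (simp add: algebra_simps)
qed

text \<open>The exponential growth rate of the total weight relative to the modal one, when the
  binomial weights with mode \<open>b\<close> are tilted by \<open>exp (2 * s)\<close>.\<close>

definition tilt_rate :: "nat \<Rightarrow> nat \<Rightarrow> real \<Rightarrow> real" where
  "tilt_rate p b s = real p * ln ((real (p - b) + real b * exp (2 * s)) / real p) - 2 * real b * s"

text \<open>At 0 the logarithmic term has derivative \<open>2 * b\<close>, twice the mean of the
  binomial distribution with p trials and mode \<open>b\<close>, and this cancels the linear term.
  Tilting by \<delta> therefore costs only o(\<delta>) in the exponent.\<close>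

lemma tilt_rate_small:
  assumes "b \<le> p" "0 < p"
  shows "((\<lambda>s. tilt_rate p b s / s) \<longlongrightarrow> 0) (at 0)"
proof -
  have "(tilt_rate p b has_real_derivative 0) (at 0)"
    unfolding tilt_rate_def using assms
    by (auto intro!: derivative_eq_intros simp: of_nat_diff)
  moreover have "tilt_rate p b 0 = 0" using assms by (simp add: tilt_rate_def of_nat_diff)
  ultimately show ?thesis by (simp add: DERIV_def)
qed

text \<open>Compare with the untilted weights: tilting multiplies the sum by ((1 + R) / (1 +
  \<rho>))^(N p) and the modal term by exp(2 s N b). The quotient of these factors is exp(N *
  tilt_rate).\<close>

lemma tilted_binomial_ratio:
  fixes p b N :: nat and s :: real
  assumes "b < p" "0 < b" "N > 0"
  defines "R \<equiv> (real b / real (p - b)) * exp (2 * s)"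
  shows "(\<Sum>k\<le>N*p. real ((N*p) choose k) * R ^ k) / (real ((N*p) choose (N*b)) * R ^ (N*b))
    \<le> (real (N*p) + 1) * exp (real N * tilt_rate p b s)"
proof -
  define \<rho> where "\<rho> = real b / real (p - b)"
  have pos: "\<rho> > 0" "real (p - b) > 0" "R > 0" using assms by (auto simp: \<rho>_def)
  have rho: "real (N*b) / real (N*p - N*b) = \<rho>"
    using assms by (simp add: \<rho>_def right_diff_distrib' [symmetric] diff_mult_distrib2[symmetric] del: of_nat_diff)
  have R: "R = \<rho> * exp (2 * s)" by (simp add: R_def \<rho>_def)
  let ?B = "real ((N*p) choose (N*b))"
  have B: "?B > 0" using assms by (simp add: zero_less_binomial)
  have mode: "(1 + \<rho>) ^ (N*p) \<le> (real (N*p) + 1) * (?B * \<rho> ^ (N*b))"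
    using binomial_mode_ge[of "N*b" "N*p"] assms by (simp only: rho) simp
  have "(\<Sum>k\<le>N*p. real ((N*p) choose k) * R ^ k) = (1 + R) ^ (N*p)"
    by (subst add.commute) (simp add: binomial_ring)
  also have "\<dots> = (1 + \<rho>) ^ (N*p) * ((1 + R) / (1 + \<rho>)) ^ (N*p)"
    using pos by (simp add: power_divide)
  also have "\<dots> \<le> (real (N*p) + 1) * (?B * \<rho> ^ (N*b)) * ((1 + R) / (1 + \<rho>)) ^ (N*p)"
    using mode pos by (intro mult_right_mono) auto
  also have "((1 + R) / (1 + \<rho>)) ^ (N*p) = exp (real N * (tilt_rate p b s + 2 * real b * s))"
  proof -
    have "(1 + R) / (1 + \<rho>) = (real (p - b) + real b * exp (2 * s)) / real p"
      using pos assms by (simp add: R \<rho>_def field_simps of_nat_diff)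
    moreover have "\<dots> > 0" using assms by (intro divide_pos_pos add_pos_pos) auto
    ultimately have "((1 + R) / (1 + \<rho>)) ^ (N*p) = exp (ln ((real (p - b) + real b * exp (2 * s)) / real p)) ^ (N*p)"
      by simp
    also have "\<dots> = exp (real (N*p) * ln ((real (p - b) + real b * exp (2 * s)) / real p))"
      by (simp only: exp_of_nat_mult)
    finally show ?thesis by (simp add: tilt_rate_def algebra_simps)
  qed
  also have "(real (N*p) + 1) * (?B * \<rho> ^ (N*b)) * exp (real N * (tilt_rate p b s + 2 * real b * s))
      = (?B * R ^ (N*b)) * ((real (N*p) + 1) * exp (real N * tilt_rate p b s))"
    by (simp add: R power_mult_distrib exp_of_nat_mult[symmetric] exp_add algebra_simps)
  finally show ?thesis
    using B pos by (simp add: pos_divide_le_eq mult_ac)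
qed

section \<open>Complex Gaussian variables\<close>

lemma nn_integral_complex_exp_square:
  assumes "s > 0"
  shows "(\<integral>\<^sup>+c. ennreal (exp (- s * (cmod c)\<^sup>2)) \<partial>lborel) = ennreal (pi / s)"
proof -
  have real: "(\<integral>\<^sup>+x. ennreal (exp (- s * x\<^sup>2)) \<partial>lborel) = ennreal (sqrt (pi / s))"
  proof -
    define \<sigma> where "\<sigma> = sqrt (1 / (2 * s))"
    have sg: "\<sigma> > 0" "2 * \<sigma>\<^sup>2 = 1 / s" using assms by (auto simp: \<sigma>_def)
    have eq: "exp (- s * x\<^sup>2) = sqrt (pi / s) * normal_density 0 \<sigma> x" for x
    proof -
      have "normal_density 0 \<sigma> x = 1 / sqrt (pi / s) * exp (- s * x\<^sup>2)"
        unfolding normal_density_def using sg assms by (simp add: mult.commute[of 2] mult.assoc)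
      then show ?thesis using assms by simp
    qed
    have "(\<integral>\<^sup>+x. ennreal (exp (- s * x\<^sup>2)) \<partial>lborel)
        = (\<integral>\<^sup>+x. ennreal (sqrt (pi / s)) * ennreal (normal_density 0 \<sigma> x) \<partial>lborel)"
      using assms by (simp only: eq) (simp add: ennreal_mult')
    also have "\<dots> = ennreal (sqrt (pi / s)) * (\<integral>\<^sup>+x. ennreal (normal_density 0 \<sigma> x) \<partial>lborel)"
      by (rule nn_integral_cmult) simp
    also have "(\<integral>\<^sup>+x. ennreal (normal_density 0 \<sigma> x) \<partial>lborel) = 1"
      using sg prob_space.emeasure_space_1[OF prob_space_normal_density[of \<sigma> 0]]
      by (simp add: emeasure_density)
    finally show ?thesis by simp
  qed
  have "exp (- s * (cmod c)\<^sup>2) = (\<Prod>b\<in>Basis. exp (- s * (c \<bullet> b)\<^sup>2))" for c :: complex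
    by (simp add: Basis_complex_def cmod_power2 algebra_simps exp_add[symmetric])
  then have "(\<integral>\<^sup>+c. ennreal (exp (- s * (cmod c)\<^sup>2)) \<partial>lborel)
      = (\<integral>\<^sup>+c. (\<Prod>b\<in>Basis. ennreal (exp (- s * ((c::complex) \<bullet> b)\<^sup>2))) \<partial>lborel)"
    by (simp add: prod_ennreal)
  also have "\<dots> = (\<Prod>b\<in>(Basis::complex set). \<integral>\<^sup>+x. ennreal (exp (- s * x\<^sup>2)) \<partial>lborel)"
    by (rule nn_integral_lborel_prod) auto
  also have "\<dots> = ennreal (pi / s)"
    unfolding real using assms by (simp add: Basis_complex_def ennreal_mult'[symmetric] power2_eq_square)
  finally show ?thesis .
qed

lemma sets_std_complex_gaussian [simp, measurable_cong]: "sets std_complex_gaussian = sets borel"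
  and space_std_complex_gaussian [simp]: "space std_complex_gaussian = UNIV"
  by (auto simp: std_complex_gaussian_def)

lemma nn_integral_std_complex_gaussian:
  assumes [measurable]: "f \<in> borel_measurable borel"
  shows "(\<integral>\<^sup>+c. f c \<partial>std_complex_gaussian) = (\<integral>\<^sup>+c. ennreal (exp (- (cmod c)\<^sup>2) / pi) * f c \<partial>lborel)"
  unfolding std_complex_gaussian_def by (subst nn_integral_density) auto

lemma prob_space_std_complex_gaussian: "prob_space std_complex_gaussian"
proof
  have "emeasure std_complex_gaussian (space std_complex_gaussian)
      = (\<integral>\<^sup>+c. ennreal (1 / pi) * ennreal (exp (- 1 * (cmod c)\<^sup>2)) \<partial>lborel)"
    unfolding std_complex_gaussian_def
    by (simp add: emeasure_density ennreal_mult'[symmetric])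
  also have "\<dots> = ennreal (1 / pi) * ennreal (pi / 1)"
    by (subst nn_integral_cmult) (simp_all only: nn_integral_complex_exp_square, simp)
  finally show "emeasure std_complex_gaussian (space std_complex_gaussian) = 1"
    by (simp add: ennreal_mult'[symmetric] del: ennreal_1)
qed

interpretation std_complex_gaussian: prob_space std_complex_gaussian
  by (rule prob_space_std_complex_gaussian)

lemma AE_std_complex_gaussian: "AE c in lborel. P c \<Longrightarrow> AE c in std_complex_gaussian. P c"
  unfolding std_complex_gaussian_def by (subst AE_density) auto

text \<open>Any finite constant serves. Trading |c|^2 for half of the exponent reduces the integral
  to a Gaussian one and gives 4 in place of the exact value 1.\<close>

lemma std_complex_gaussian_second_moment:
  "(\<integral>\<^sup>+c. ennreal ((cmod c)\<^sup>2) \<partial>std_complex_gaussian) \<le> 4"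
proof -
  have "t * exp (- t) \<le> 2 * exp (- (1/2) * t)" for t :: real
  proof -
    have "t \<le> 2 * exp (t / 2)" using exp_ge_add_one_self[of "t/2"] by linarith
    then have "t * exp (-t) \<le> 2 * exp (t / 2) * exp (-t)" by (intro mult_right_mono) auto
    also have "\<dots> = 2 * exp (- (1/2) * t)" by (simp add: exp_add[symmetric])
    finally show ?thesis .
  qed
  then have le: "exp (- (cmod c)\<^sup>2) / pi * (cmod c)\<^sup>2 \<le> 2 / pi * exp (- (1/2) * (cmod c)\<^sup>2)" for c
    by (simp add: field_simps)
  have "(\<integral>\<^sup>+c. ennreal ((cmod c)\<^sup>2) \<partial>std_complex_gaussian)
      = (\<integral>\<^sup>+c. ennreal (exp (- (cmod c)\<^sup>2) / pi * (cmod c)\<^sup>2) \<partial>lborel)"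
    by (subst nn_integral_std_complex_gaussian) (simp_all only: ennreal_mult''[symmetric] zero_le_power2, simp_all)
  also have "\<dots> \<le> (\<integral>\<^sup>+c. ennreal (2 / pi) * ennreal (exp (- (1/2) * (cmod c)\<^sup>2)) \<partial>lborel)"
    using le by (intro nn_integral_mono) (simp add: ennreal_mult'[symmetric] ennreal_leI)
  also have "\<dots> = ennreal (2 / pi) * ennreal (pi / (1/2))"
    by (subst nn_integral_cmult) (simp, subst nn_integral_complex_exp_square, simp_all)
  also have "\<dots> = 4" by (simp add: ennreal_mult'[symmetric] del: ennreal_numeral) simp
  finally show ?thesis .
qed

text \<open>Continuity from above at the null set \<open>{0}\<close>. The condition \<eta> \<le> 1
  keeps - ln \<eta> nonnegative in the later bounds.\<close>

lemma std_complex_gaussian_small_ball: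
  assumes "\<gamma> > 0"
  shows "\<exists>\<eta>>0. \<eta> \<le> 1 \<and> measure std_complex_gaussian (ball 0 \<eta>) < \<gamma>"
proof -
  let ?B = "\<lambda>n. ball (0::complex) (1 / real (Suc n))"
  have "(\<Inter>n. ?B n) = {0}"
  proof -
    have "x = 0" if "\<And>n. cmod x < 1 / real (Suc n)" for x
    proof (rule ccontr)
      assume "x \<noteq> 0"
      then obtain n where "inverse (real (Suc n)) < cmod x" using reals_Archimedean[of "cmod x"] by auto
      with that[of n] show False by (simp add: inverse_eq_divide)
    qed
    then show ?thesis by auto
  qed
  moreover have "(\<lambda>n. measure std_complex_gaussian (?B n)) \<longlonglongrightarrow> measure std_complex_gaussian (\<Inter>n. ?B n)"
    by (intro std_complex_gaussian.finite_Lim_measure_decseq)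
      (auto simp: decseq_def intro!: subset_ball divide_left_mono)
  moreover have "measure std_complex_gaussian {0} = 0"
  proof -
    have "AE c in std_complex_gaussian. c \<noteq> 0"
      by (rule AE_std_complex_gaussian) (rule AE_lborel_singleton)
    then have "emeasure std_complex_gaussian {0} = 0"
      by (subst (asm) AE_iff_measurable[where N="{0}"]) auto
    then show ?thesis by (simp add: measure_def)
  qed
  ultimately have "(\<lambda>n. measure std_complex_gaussian (?B n)) \<longlonglongrightarrow> 0" by simp
  then have "eventually (\<lambda>n. measure std_complex_gaussian (?B n) < \<gamma>) sequentially"
    using assms by (rule order_tendstoD)
  then obtain n where "measure std_complex_gaussian (?B n) < \<gamma>"
    by (auto simp: eventually_sequentially)
  then show ?thesis by (intro exI[of _ "1 / real (Suc n)"]) auto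
qed

section \<open>Measurability of root counts\<close>

text \<open>On a compact set a continuous function has a zero iff its modulus takes arbitrarily
  small values, and these can be sought in a countable dense subset.\<close>

lemma pred_zero_in_compact:
  fixes h :: "'a \<Rightarrow> complex \<Rightarrow> complex"
  assumes "compact K" and [measurable]: "\<And>z. (\<lambda>c. h c z) \<in> borel_measurable M"
    and cont: "\<And>c. continuous_on UNIV (h c)"
  shows "Measurable.pred M (\<lambda>c. \<exists>z\<in>K. h c z = 0)"
proof -
  obtain D where D: "countable D" "D \<subseteq> K" "K \<subseteq> closure D"
    using separable by blast
  have "(\<exists>z\<in>K. h c z = 0) \<longleftrightarrow> (\<forall>n. \<exists>z\<in>D. cmod (h c z) < 1 / real (Suc n))" for c
  proof
    assume "\<exists>z\<in>K. h c z = 0"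
    then obtain z where z: "z \<in> K" "h c z = 0" by blast
    show "\<forall>n. \<exists>z\<in>D. cmod (h c z) < 1 / real (Suc n)"
    proof
      fix n
      let ?U = "{z. cmod (h c z) < 1 / real (Suc n)}"
      have "open ?U"
        using cont[of c] by (intro open_Collect_less continuous_intros) auto
      moreover have "z \<in> ?U" using z by simp
      ultimately show "\<exists>z\<in>D. cmod (h c z) < 1 / real (Suc n)"
        using z D by (metis (no_types, lifting) closure_iff_nhds_not_empty disjoint_iff mem_Collect_eq order_refl subsetD)
    qed
  next
    assume *: "\<forall>n. \<exists>z\<in>D. cmod (h c z) < 1 / real (Suc n)"
    then have "K \<noteq> {}" using D by blast
    moreover have "continuous_on K (\<lambda>z. cmod (h c z))"
      using cont[of c] by (intro continuous_intros) (auto intro: continuous_on_subset)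
    ultimately obtain z where z: "z \<in> K" "\<And>w. w \<in> K \<Longrightarrow> cmod (h c z) \<le> cmod (h c w)"
      using continuous_attains_inf[OF assms(1)] by blast
    have "h c z = 0"
    proof (rule ccontr)
      assume "h c z \<noteq> 0"
      then obtain n where n: "inverse (real (Suc n)) < cmod (h c z)"
        using reals_Archimedean[of "cmod (h c z)"] by auto
      obtain w where "w \<in> D" "cmod (h c w) < 1 / real (Suc n)" using * by blast
      with z(2)[of w] D n show False by (auto simp: inverse_eq_divide)
    qed
    with z show "\<exists>z\<in>K. h c z = 0" by blast
  qed
  moreover have "Measurable.pred M (\<lambda>c. \<forall>n. \<exists>z\<in>D. cmod (h c z) < 1 / real (Suc n))"
    using D(1) by (intro pred_intros_countable pred_intros_countable_bounded) measurable
  ultimately show ?thesis by simp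
qed

text \<open>The number of points is determined by which rational closed intervals are hit: peel off
  the smallest point with a rational interval around it and count the rest to its right.\<close>

lemma measurable_card_random_set:
  fixes R :: "'a \<Rightarrow> real set"
  assumes hit: "\<And>u v. v < \<beta> \<Longrightarrow> Measurable.pred M (\<lambda>c. \<exists>x\<in>R c. u \<le> x \<and> x \<le> v)"
  shows "(\<lambda>c. card (R c \<inter> {\<alpha><..<\<beta>})) \<in> M \<rightarrow>\<^sub>M count_space UNIV"
proof -
  \<comment> \<open>At least \<open>k\<close> points in (t, \<beta>), phrased through finite subsets
    so that it also makes sense for an infinite random set.\<close>
  define L where "L = (\<lambda>k t c. \<exists>F. finite F \<and> card F = k \<and> F \<subseteq> R c \<inter> {t<..<\<beta>})"
  have L_Suc: "L (Suc k) t c \<longleftrightarrow>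
      (\<exists>u v :: rat. t < of_rat u \<and> of_rat v < \<beta> \<and> (\<exists>x\<in>R c. of_rat u \<le> x \<and> x \<le> of_rat v) \<and> L k (of_rat v) c)"
    for k t c
  proof
    assume "L (Suc k) t c"
    then obtain F where F: "finite F" "card F = Suc k" "F \<subseteq> R c \<inter> {t<..<\<beta>}"
      unfolding L_def by blast
    define x where "x = Min F"
    have x: "x \<in> F" "\<And>y. y \<in> F \<Longrightarrow> x \<le> y" using F by (auto simp: x_def card_gt_0_iff intro!: Min_in)
    have "t < x" using x F by auto
    then obtain u where u: "t < of_rat u" "of_rat u < x" using of_rat_dense by blast
    \<comment> \<open>Inserting \<beta> keeps the set nonempty and forces the separating rational
      below \<beta> even when \<open>x\<close> is the only point.\<close>
    let ?G = "insert \<beta> (F - {x})"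
    have "finite ?G" "?G \<noteq> {}" using F by auto
    have "x < Min ?G"
      using F x \<open>finite ?G\<close> by (subst Min_gr_iff) (auto simp: order.strict_iff_order)
    then obtain v where v: "x < of_rat v" "of_rat v < Min ?G" using of_rat_dense by blast
    then have "\<forall>y\<in>?G. of_rat v < y" using \<open>finite ?G\<close> by (subst (asm) Min_gr_iff) auto
    then have "L k (of_rat v) c" unfolding L_def
      using F x \<open>\<forall>y\<in>?G. of_rat v < y\<close> by (intro exI[of _ "F - {x}"]) (auto simp: subset_iff)
    moreover have "of_rat v < \<beta>" using \<open>\<forall>y\<in>?G. of_rat v < y\<close> by auto
    ultimately show "\<exists>u v :: rat. t < of_rat u \<and> of_rat v < \<beta> \<and>
        (\<exists>x\<in>R c. of_rat u \<le> x \<and> x \<le> of_rat v) \<and> L k (of_rat v) c"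
      using u v x F by (intro exI[of _ u] exI[of _ v]) (auto intro!: bexI[of _ x])
  next
    assume "\<exists>u v :: rat. t < of_rat u \<and> of_rat v < \<beta> \<and>
        (\<exists>x\<in>R c. of_rat u \<le> x \<and> x \<le> of_rat v) \<and> L k (of_rat v) c"
    then obtain u v :: rat and x F where *: "t < of_rat u" "of_rat v < \<beta>" "x \<in> R c"
      "of_rat u \<le> x" "x \<le> of_rat v" "finite F" "card F = k" "F \<subseteq> R c \<inter> {of_rat v<..<\<beta>}"
      unfolding L_def by blast
    have "x \<notin> F" using * by auto
    then show "L (Suc k) t c" unfolding L_def
      using * by (intro exI[of _ "insert x F"]) (fastforce)
  qed
  have L_meas: "Measurable.pred M (L k t)" for k t
  proof (induction k arbitrary: t)
    case 0
    have "L 0 t c" for c by (auto simp: L_def)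
    then have "L 0 t = (\<lambda>_. True)" by auto
    then show ?case by simp
  next
    case (Suc k)
    note [measurable] = Suc.IH
    have "Measurable.pred M (\<lambda>c. \<exists>u v :: rat. t < of_rat u \<and> of_rat v < \<beta> \<and>
        (\<exists>x\<in>R c. of_rat u \<le> x \<and> x \<le> of_rat v) \<and> L k (of_rat v) c)"
    proof (intro pred_intros_countable)
      fix u v :: rat
      show "Measurable.pred M (\<lambda>c. t < of_rat u \<and> of_rat v < \<beta> \<and>
        (\<exists>x\<in>R c. of_rat u \<le> x \<and> x \<le> of_rat v) \<and> L k (of_rat v) c)"
      proof (cases "of_rat v < \<beta>")
        case True
        note [measurable] = hit[OF True, of "of_rat u"]
        show ?thesis by measurable
      qed simp
    qed
    then show ?case by (simp only: L_Suc[abs_def])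
  qed
  \<comment> \<open>The cardinality of an infinite set is 0 by convention, so the value 0 also
    occurs when all \<open>L k\<close> hold.\<close>
  have card_iff: "card (R c \<inter> {\<alpha><..<\<beta>}) = j \<longleftrightarrow>
      (L j \<alpha> c \<and> \<not> L (Suc j) \<alpha> c) \<or> (j = 0 \<and> (\<forall>k. L k \<alpha> c))" for j c
  proof -
    let ?S = "R c \<inter> {\<alpha><..<\<beta>}"
    show ?thesis
    proof (cases "finite ?S")
      case True
      have L: "L k \<alpha> c \<longleftrightarrow> k \<le> card ?S" for k
      proof
        assume "L k \<alpha> c"
        then show "k \<le> card ?S" unfolding L_def using True card_mono by blast
      next
        assume "k \<le> card ?S"
        then obtain F where "F \<subseteq> ?S" "card F = k" "finite F" by (rule obtain_subset_with_card_n)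
        then show "L k \<alpha> c" unfolding L_def by blast
      qed
      have "\<not> (\<forall>k. L k \<alpha> c)" unfolding L using Suc_n_not_le_n by blast
      moreover have "card ?S = j \<longleftrightarrow> L j \<alpha> c \<and> \<not> L (Suc j) \<alpha> c" unfolding L by linarith
      ultimately show ?thesis by blast
    next
      case False
      then have "L k \<alpha> c" for k
        unfolding L_def using infinite_arbitrarily_large by blast
      then show ?thesis using False by auto
    qed
  qed
  show ?thesis
  proof (subst measurable_count_space_eq2_countable, safe)
    fix j :: nat
    note [measurable] = L_meas
    have "Measurable.pred M (\<lambda>c. card (R c \<inter> {\<alpha><..<\<beta>}) = j)"
      unfolding card_iff by measurable
    then have "{c \<in> space M. card (R c \<inter> {\<alpha><..<\<beta>}) = j} \<in> sets M" by (simp add: pred_def)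
    moreover have "(\<lambda>c. card (R c \<inter> {\<alpha><..<\<beta>})) -` {j} \<inter> space M
        = {c \<in> space M. card (R c \<inter> {\<alpha><..<\<beta>}) = j}" by auto
    ultimately show "(\<lambda>c. card (R c \<inter> {\<alpha><..<\<beta>})) -` {j} \<inter> space M \<in> sets M" by simp
  qed auto
qed

text \<open>The value is the first coordinate of \<open>moment_map (w, 0)\<close>, the place where a
  root \<open>w\<close> shows up on the bottom side. Roots of equal modulus share one
  position.\<close>

definition root_positions :: "complex poly \<Rightarrow> real set" where
  "root_positions g = {(cmod w)\<^sup>2 / (1 + (cmod w)\<^sup>2) | w. poly g w = 0}"

lemma finite_root_positions: "g \<noteq> 0 \<Longrightarrow> finite (root_positions g)"
  using poly_roots_finite[of g] by (simp add: root_positions_def)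

text \<open>A position at most v < 1 bounds the modulus of \<open>w\<close>, which makes the set of
  candidates compact; this is the purpose of \<beta> \<le> 1.\<close>

lemma measurable_card_root_positions:
  fixes g :: "'a \<Rightarrow> complex poly"
  assumes "\<And>z. (\<lambda>c. poly (g c) z) \<in> borel_measurable M" and "\<beta> \<le> 1"
  shows "(\<lambda>c. card (root_positions (g c) \<inter> {\<alpha><..<\<beta>})) \<in> M \<rightarrow>\<^sub>M count_space UNIV"
proof (rule measurable_card_random_set)
  fix u v :: real assume "v < \<beta>"
  then have v: "v < 1" using assms by simp
  let ?\<sigma> = "\<lambda>w::complex. (cmod w)\<^sup>2 / (1 + (cmod w)\<^sup>2)"
  let ?K = "{w. u \<le> ?\<sigma> w \<and> ?\<sigma> w \<le> v}"
  have pos: "1 + (cmod w)\<^sup>2 > 0" for w using zero_le_power2[of "cmod w"] by linarith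
  have "continuous_on UNIV ?\<sigma>"
    by (intro continuous_intros ballI) (metis pos less_irrefl)
  then have "closed ?K"
    by (intro closed_Collect_conj closed_Collect_le continuous_on_const) assumption+
  moreover have "bounded ?K"
  proof (rule boundedI)
    fix w assume "w \<in> ?K"
    then have "(cmod w)\<^sup>2 \<le> v * (1 + (cmod w)\<^sup>2)" using pos[of w] by (simp add: pos_divide_le_eq)
    then have "(1 - v) * (cmod w)\<^sup>2 \<le> v" by (simp add: algebra_simps)
    then have "(cmod w)\<^sup>2 \<le> v / (1 - v)" using v by (simp add: pos_le_divide_eq mult.commute)
    then show "norm w \<le> sqrt (v / (1 - v))" by (rule real_le_rsqrt)
  qed
  ultimately have "compact ?K" by (simp add: compact_eq_bounded_closed)
  then have "Measurable.pred M (\<lambda>c. \<exists>z\<in>?K. poly (g c) z = 0)"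
    by (rule pred_zero_in_compact[where h = "\<lambda>c. poly (g c)", OF _ assms(1)])
      (rule continuous_on_poly[OF continuous_on_id])
  moreover have "(\<exists>x\<in>root_positions (g c). u \<le> x \<and> x \<le> v) \<longleftrightarrow> (\<exists>z\<in>?K. poly (g c) z = 0)" for c
    unfolding root_positions_def by blast
  ultimately show "Measurable.pred M (\<lambda>c. \<exists>x\<in>root_positions (g c). u \<le> x \<and> x \<le> v)" by simp
qed

section \<open>Roots of distinct moduli\<close>

lemma coeff_sum_monom: "coeff (\<Sum>k\<le>n. monom (y k) k) j = (if j \<le> n then y j else 0)"
  by (simp add: coeff_sum coeff_monom)

lemma poly_sum_monom:
  fixes y :: "nat \<Rightarrow> 'a::comm_ring_1"
  shows "poly (\<Sum>k\<le>n. monom (y k) k) z = (\<Sum>k\<le>n. y k * z ^ k)"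
  by (simp add: poly_sum poly_monom)

lemma sum_monom_factorization:
  fixes y :: "nat \<Rightarrow> complex"
  assumes "y n \<noteq> 0"
  obtains a where "(\<Sum>k\<le>n. monom (y k) k) = smult (y n) (\<Prod>i<n. [:-a i, 1:])"
proof -
  let ?g = "\<Sum>k\<le>n. monom (y k) k"
  have deg: "degree ?g = n"
    using assms by (intro antisym degree_le le_degree) (auto simp: coeff_sum_monom)
  obtain a where "smult (lead_coeff ?g) (\<Prod>i<degree ?g. [:-a i, 1:]) = ?g"
    by (rule complex_poly_decompose')
  with deg show ?thesis by (intro that[of a]) (simp add: coeff_sum_monom)
qed

text \<open>The polynomial (g(z) - g(w)) / (z - w) for g with coefficients \<open>y\<close>. On the
  diagonal it is g'(z), so multiple roots are covered as well.\<close>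

definition divided_difference :: "nat \<Rightarrow> (nat \<Rightarrow> complex) \<Rightarrow> complex \<Rightarrow> complex \<Rightarrow> complex" where
  "divided_difference n y z w = (\<Sum>k\<le>n. y k * (\<Sum>i<k. z ^ (k - Suc i) * w ^ i))"

lemma divided_difference_zero:
  fixes y :: "nat \<Rightarrow> complex"
  assumes "(\<Sum>k\<le>n. monom (y k) k) = [:-z, 1:] * [:-w, 1:] * q"
  shows "divided_difference n y z w = 0"
proof -
  let ?g = "\<Sum>k\<le>n. monom (y k) k"
  \<comment> \<open>The explicit quotient of the polynomial by \<open>[:-z, 1:]\<close>. Cancelling
    this factor leaves \<open>w\<close> as a root of \<open>D\<close> also when
    \<open>w = z\<close>.\<close>
  define D where "D = (\<Sum>k\<le>n. smult (y k) (\<Sum>i<k. monom (z ^ (k - Suc i)) i))"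
  have D: "poly D x = divided_difference n y z x" for x
    by (simp add: D_def divided_difference_def poly_sum poly_monom)
  have "[:-z, 1:] * D = ?g"
  proof (rule poly_eq_poly_eq_iff[THEN iffD1], rule ext)
    fix x
    have "poly ?g z = 0" unfolding assms poly_mult by simp
    then have "poly ?g x = (\<Sum>k\<le>n. y k * (x ^ k - z ^ k))"
      by (simp add: poly_sum_monom right_diff_distrib sum_subtractf)
    also have "\<dots> = (x - z) * divided_difference n y z x"
      by (simp add: divided_difference_def power_diff_sumr2 sum_distrib_left mult_ac)
    finally show "poly ([:-z, 1:] * D) x = poly ?g x" by (simp add: D algebra_simps)
  qed
  then have "[:-z, 1:] * D = [:-z, 1:] * ([:-w, 1:] * q)" by (simp only: assms mult.assoc)
  then have "D = [:-w, 1:] * q" by (subst (asm) mult_cancel_left) auto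
  then have "poly D w = 0" by simp
  then show ?thesis by (simp add: D)
qed

text \<open>Fubini: for a fixed first component the slice is a circle or a point, hence
  null.\<close>

lemma negligible_equal_moduli: "negligible {p :: complex \<times> complex. cmod (fst p) = cmod (snd p)}"
proof -
  let ?S = "{p :: complex \<times> complex. cmod (fst p) = cmod (snd p)}"
  have "closed ?S" by (intro closed_Collect_eq continuous_intros)
  then have S: "?S \<in> sets borel" by (rule borel_closed)
  have "open {p :: complex \<times> complex. cmod (fst p) \<noteq> cmod (snd p)}"
    by (intro open_Collect_neq continuous_intros)
  then have O: "{p :: complex \<times> complex. cmod (fst p) \<noteq> cmod (snd p)} \<in> sets (borel \<Otimes>\<^sub>M borel)"
    unfolding borel_prod by (rule borel_open)
  have "AE z in lborel. AE w in lborel. (z, w) \<notin> ?S"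
  proof (rule AE_I2)
    fix z :: complex
    have "negligible (sphere (0::complex) (cmod z))" by (rule negligible_sphere)
    then have "sphere (0::complex) (cmod z) \<in> null_sets lborel"
      by (metis negligible_iff_null_sets null_sets_completion_iff closed_sphere borel_closed sets_lborel)
    then have "AE w in lborel. w \<notin> sphere (0::complex) (cmod z)" by (rule AE_not_in)
    then show "AE w in lborel. (z, w) \<notin> ?S" by (rule eventually_mono) auto
  qed
  then have "AE p in lborel \<Otimes>\<^sub>M lborel. p \<notin> ?S"
    using O by (intro lborel_pair.AE_pair_measure) (auto simp: space_pair_measure)
  then have "?S \<in> null_sets lborel"
    using S by (subst (asm) lborel_prod) (simp add: AE_iff_null_sets)
  then show ?thesis by (simp add: negligible_iff_null_sets null_sets_completionI)
qed

text \<open>For z \<noteq> w the equations say that both are roots, for z = w that z is a multiple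
  root.\<close>

definition equal_moduli_roots :: "nat \<Rightarrow> (nat \<Rightarrow> complex) \<Rightarrow> bool" where
  "equal_moduli_roots n y \<longleftrightarrow>
    (\<exists>z w. cmod z = cmod w \<and> (\<Sum>k\<le>n. y k * z ^ k) = 0 \<and> divided_difference n y z w = 0)"

text \<open>Two roots \<open>z\<close>, \<open>w\<close> (possibly equal) determine the two lowest coefficients from the
  others; a pair of roots of equal modulus thus confines these to the image of a null set under a
  polynomial map.\<close>

lemma negligible_equal_moduli_coeffs:
  fixes y :: "nat \<Rightarrow> complex"
  assumes "n \<ge> 2"
  shows "negligible {(u, v). equal_moduli_roots n (y(0 := u, 1 := v))}"
    (is "negligible ?B")
proof -
  \<comment> \<open>In the divided difference the term k = 0 is empty and the term k = 1 is just the
    coefficient itself, so its vanishing gives \<open>v = - h (z, w)\<close>. The root equation then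
    yields \<open>u\<close>, and \<Phi> collects both solutions.\<close>
  define h where "h = (\<lambda>p :: complex \<times> complex. \<Sum>k=2..n. y k * (\<Sum>i<k. fst p ^ (k - Suc i) * snd p ^ i))"
  define \<Phi> where "\<Phi> = (\<lambda>p :: complex \<times> complex. (h p * fst p - (\<Sum>k=2..n. y k * fst p ^ k), - h p))"
  have split: "(\<Sum>k\<le>n. f k) = f 0 + f 1 + (\<Sum>k=2..n. f k)" for f :: "nat \<Rightarrow> complex"
  proof -
    have "{..n} = insert 0 (insert 1 {2..n})" using assms by auto
    then show ?thesis by (simp add: add.assoc)
  qed
  have "?B \<subseteq> \<Phi> ` {p. cmod (fst p) = cmod (snd p)}"
    unfolding equal_moduli_roots_def
  proof clarify
    fix u v z w
    assume *: "cmod z = cmod w" "(\<Sum>k\<le>n. (y(0 := u, 1 := v)) k * z ^ k) = 0"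
      "divided_difference n (y(0 := u, 1 := v)) z w = 0"
    have "(\<Sum>k=2..n. (y(0 := u, 1 := v)) k * z ^ k) = (\<Sum>k=2..n. y k * z ^ k)"
      by (intro sum.cong) auto
    moreover have "(\<Sum>k=2..n. (y(0 := u, 1 := v)) k * (\<Sum>i<k. z ^ (k - Suc i) * w ^ i)) = h (z, w)"
      unfolding h_def by (intro sum.cong) auto
    ultimately have "v = - h (z, w)" "u + v * z + (\<Sum>k=2..n. y k * z ^ k) = 0"
      using *(2,3) by (simp_all add: split divided_difference_def eq_neg_iff_add_eq_0)
    moreover from this(2) have "u = - (v * z + (\<Sum>k=2..n. y k * z ^ k))"
      by (metis eq_neg_iff_add_eq_0 add.assoc)
    ultimately have "(u, v) = \<Phi> (z, w)"
      by (simp add: \<Phi>_def)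
    then show "(u, v) \<in> \<Phi> ` {p. cmod (fst p) = cmod (snd p)}"
      using *(1) by (intro image_eqI[of _ _ "(z, w)"]) auto
  qed
  moreover have "negligible (\<Phi> ` {p. cmod (fst p) = cmod (snd p)})"
  proof (rule negligible_differentiable_image_negligible[OF order_refl negligible_equal_moduli])
    have "\<Phi> differentiable (at p)" for p
      unfolding \<Phi>_def h_def
      by (intro differentiable_Pair differentiable_diff differentiable_minus differentiable_mult
          differentiable_sum differentiable_power differentiable_const ballI finite_atLeastAtMost
          finite_lessThan bounded_linear_imp_differentiable bounded_linear_fst bounded_linear_snd)
    then show "\<Phi> differentiable_on {p. cmod (fst p) = cmod (snd p)}"
      by (simp add: differentiable_on_def differentiable_at_withinI)
  qed
  ultimately show ?thesis by (rule negligible_subset[rotated])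
qed

lemma position_nonneg_less_1: "0 \<le> (cmod w)\<^sup>2 / (1 + (cmod w)\<^sup>2)" "(cmod w)\<^sup>2 / (1 + (cmod w)\<^sup>2) < 1"
proof -
  have "1 + (cmod w)\<^sup>2 > 0" by (intro add_pos_nonneg) auto
  then show "0 \<le> (cmod w)\<^sup>2 / (1 + (cmod w)\<^sup>2)" "(cmod w)\<^sup>2 / (1 + (cmod w)\<^sup>2) < 1"
    by (simp_all add: pos_divide_less_eq)
qed

lemma position_eq_iff:
  "(cmod w)\<^sup>2 / (1 + (cmod w)\<^sup>2) = (cmod w')\<^sup>2 / (1 + (cmod w')\<^sup>2) \<longleftrightarrow> cmod w = cmod w'"
proof -
  have "1 + (cmod w)\<^sup>2 > 0" "1 + (cmod w')\<^sup>2 > 0" by (auto intro: add_pos_nonneg)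
  then show ?thesis by (simp add: frac_eq_eq less_imp_neq[symmetric] algebra_simps)
qed

section \<open>Polynomials with independent Gaussian coefficients\<close>

definition sampled_poly :: "nat \<Rightarrow> (nat \<Rightarrow> 'i) \<Rightarrow> (nat \<Rightarrow> real) \<Rightarrow> ('i \<Rightarrow> complex) \<Rightarrow> complex poly" where
  "sampled_poly n idx r c = (\<Sum>k\<le>n. monom (c (idx k) * of_real (r k)) k)"

abbreviation gaussian_family :: "'i set \<Rightarrow> ('i \<Rightarrow> complex) measure" where
  "gaussian_family I \<equiv> Pi\<^sub>M I (\<lambda>_. std_complex_gaussian)"

lemma measurable_gaussian_family_component [measurable]:
  "i \<in> I \<Longrightarrow> (\<lambda>c. c i) \<in> borel_measurable (gaussian_family I)"
  using measurable_component_singleton[of i I "\<lambda>_. std_complex_gaussian"]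
  by (simp cong: measurable_cong_sets)

lemma prob_space_gaussian_family: "prob_space (gaussian_family I)"
  by (intro prob_space_PiM prob_space_std_complex_gaussian)

lemma AE_gaussian_family_component:
  assumes "i \<in> I" "AE x in lborel. P x"
  shows "AE c in gaussian_family I. P (c i)"
  using assms by (intro AE_PiM_component prob_space_std_complex_gaussian AE_std_complex_gaussian)

lemma sampled_poly_measurable:
  assumes "\<And>k. k \<le> n \<Longrightarrow> idx k \<in> I"
  shows "(\<lambda>c. poly (sampled_poly n idx r c) z) \<in> borel_measurable (gaussian_family I)"
  unfolding sampled_poly_def poly_sum_monom
  using assms by (intro borel_measurable_sum borel_measurable_times measurable_gaussian_family_component) auto

text \<open>The exceptional pairs are the preimage of a null set under a linear isomorphism, which
  rescales by \<open>r 0\<close> and \<open>r 1\<close> and swaps the components into the order of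
  integration. Fubini gives the iterated form.\<close>

lemma equal_moduli_rare:
  assumes "n \<ge> 2" "r 0 \<noteq> 0" "r 1 \<noteq> 0"
  shows "AE v in std_complex_gaussian. AE u in std_complex_gaussian.
    \<not> equal_moduli_roots n (\<lambda>k. (y(0 := u, 1 := v)) k * complex_of_real (r k))"
proof -
  let ?Y = "\<lambda>u v. (\<lambda>k. y k * complex_of_real (r k))(0 := u, 1 := v)"
  let ?Q = "\<lambda>u v. equal_moduli_roots n (?Y u v)"
  define B where "B = {(u, v). ?Q u v}"
  define s where "s = (\<lambda>(v, u). (u * complex_of_real (r 0), v * complex_of_real (r 1)))"
  define t where "t = (\<lambda>(u, v). (v / complex_of_real (r 1), u / complex_of_real (r 0)))"
  have B: "negligible B" unfolding B_def by (rule negligible_equal_moduli_coeffs[OF assms(1)])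
  have ts: "t (s q) = q" "s (t q) = q" for q
    using assms(2,3) by (auto simp: s_def t_def split: prod.splits)
  have "s -` B = t ` B"
  proof (intro set_eqI iffI)
    fix q assume "q \<in> s -` B"
    then show "q \<in> t ` B" using ts(1)[of q] by (metis vimage_eq imageI)
  next
    fix q assume "q \<in> t ` B"
    then show "q \<in> s -` B" using ts(2) by auto
  qed
  moreover have "negligible (t ` B)"
  proof (rule negligible_differentiable_image_negligible[OF order_refl B])
    have "linear t" unfolding t_def
      by (rule linearI) (auto simp: add_divide_distrib scaleR_conv_of_real)
    then show "t differentiable_on B" by (rule linear_imp_differentiable_on)
  qed
  ultimately have "negligible (s -` B)" by simp
  then have "AE p in lborel. p \<notin> s -` B"
    by (metis negligible_iff_null_sets AE_not_in AE_completion_iff)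
  then have "AE p in lborel \<Otimes>\<^sub>M lborel. p \<notin> s -` B" by (simp only: lborel_prod)
  from lborel_pair.AE_pair[OF this]
  have "AE v in lborel. AE u in lborel. \<not> ?Q (u * complex_of_real (r 0)) (v * complex_of_real (r 1))"
    by (simp only: vimage_eq s_def B_def mem_Collect_eq case_prod_conv)
  moreover have "?Y (u * complex_of_real (r 0)) (v * complex_of_real (r 1)) = (\<lambda>k. (y(0 := u, 1 := v)) k * complex_of_real (r k))" for u v
    by auto
  ultimately have "AE v in lborel. AE u in lborel.
      \<not> equal_moduli_roots n (\<lambda>k. (y(0 := u, 1 := v)) k * complex_of_real (r k))"
    by (simp only:)
  then have "AE v in lborel. AE u in std_complex_gaussian.
      \<not> equal_moduli_roots n (\<lambda>k. (y(0 := u, 1 := v)) k * complex_of_real (r k))"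
    by (rule eventually_mono) (rule AE_std_complex_gaussian)
  then show ?thesis by (rule AE_std_complex_gaussian)
qed

text \<open>Fubini with all other components frozen, applied to the indicator of the failure
  set.\<close>

lemma AE_gaussian_family_two_components:
  fixes P :: "('i \<Rightarrow> complex) \<Rightarrow> bool"
  assumes "finite I" "i \<in> I" "j \<in> I" "i \<noteq> j"
    and meas: "Measurable.pred (gaussian_family I) P"
    and ae: "\<And>x. AE v in std_complex_gaussian. AE u in std_complex_gaussian. P (x(j := v, i := u))"
  shows "AE c in gaussian_family I. P c"
proof -
  interpret product_sigma_finite "\<lambda>_::'i. std_complex_gaussian" by unfold_locales
  define J where "J = I - {i, j}"
  have J: "finite J" "finite (insert j J)" "I = insert i (insert j J)" "i \<notin> insert j J" "j \<notin> J"
    using assms by (auto simp: J_def)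
  define f where "f = (\<lambda>c. indicator {c. \<not> P c} c :: ennreal)"
  have f: "f \<in> borel_measurable (gaussian_family I)"
    unfolding f_def indicator_def using meas by measurable
  have "(\<integral>\<^sup>+c. f c \<partial>gaussian_family I)
      = (\<integral>\<^sup>+x. (\<integral>\<^sup>+u. f (x(i := u)) \<partial>std_complex_gaussian) \<partial>gaussian_family (insert j J))"
    using f J by (simp only: J(3)) (rule product_nn_integral_insert)
  also have "\<dots> = (\<integral>\<^sup>+x. (\<integral>\<^sup>+v. (\<integral>\<^sup>+u. f (x(j := v, i := u)) \<partial>std_complex_gaussian) \<partial>std_complex_gaussian) \<partial>gaussian_family J)"
  proof (rule product_nn_integral_insert)
    have "(\<lambda>(x, u). x(i := u)) \<in> gaussian_family (insert j J) \<Otimes>\<^sub>M std_complex_gaussian \<rightarrow>\<^sub>M gaussian_family I"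
      unfolding J(3) by (rule measurable_add_dim)
    from measurable_compose[OF this f]
    show "(\<lambda>x. \<integral>\<^sup>+u. f (x(i := u)) \<partial>std_complex_gaussian) \<in> borel_measurable (gaussian_family (insert j J))"
      by (intro std_complex_gaussian.borel_measurable_nn_integral) (simp add: case_prod_beta')
  qed (use J in auto)
  also have "\<dots> = (\<integral>\<^sup>+x. 0 \<partial>gaussian_family J)"
  proof (rule nn_integral_cong)
    fix x :: "'i \<Rightarrow> complex"
    have "AE v in std_complex_gaussian. (\<integral>\<^sup>+u. f (x(j := v, i := u)) \<partial>std_complex_gaussian) = 0"
      using ae[of x]
    proof (rule eventually_mono)
      fix v assume "AE u in std_complex_gaussian. P (x(j := v, i := u))"
      then have "AE u in std_complex_gaussian. f (x(j := v, i := u)) = 0"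
        by (rule eventually_mono) (simp add: f_def)
      then have "(\<integral>\<^sup>+u. f (x(j := v, i := u)) \<partial>std_complex_gaussian) = (\<integral>\<^sup>+u. 0 \<partial>std_complex_gaussian)"
        by (rule nn_integral_cong_AE)
      then show "(\<integral>\<^sup>+u. f (x(j := v, i := u)) \<partial>std_complex_gaussian) = 0" by simp
    qed
    then have "(\<integral>\<^sup>+v. (\<integral>\<^sup>+u. f (x(j := v, i := u)) \<partial>std_complex_gaussian) \<partial>std_complex_gaussian)
        = (\<integral>\<^sup>+v. 0 \<partial>std_complex_gaussian)" by (rule nn_integral_cong_AE)
    then show "(\<integral>\<^sup>+v. (\<integral>\<^sup>+u. f (x(j := v, i := u)) \<partial>std_complex_gaussian) \<partial>std_complex_gaussian) = 0"
      by simp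
  qed
  finally have "AE c in gaussian_family I. f c = 0"
    using f by (simp add: nn_integral_0_iff_AE)
  then show ?thesis by (rule eventually_mono) (auto simp: f_def indicator_def split: if_splits)
qed

text \<open>Once the other coefficients are frozen, two roots of equal modulus confine the two
  lowest coefficients to a null set; for n < 2 there is no pair of roots.\<close>

lemma AE_distinct_moduli:
  fixes idx :: "nat \<Rightarrow> 'i"
  assumes "finite I" "\<And>k. k \<le> n \<Longrightarrow> idx k \<in> I" "inj_on idx {..n}" "\<And>k. r k > 0"
  shows "AE c in gaussian_family I. c (idx 0) \<noteq> 0 \<and> c (idx n) \<noteq> 0 \<and>
    (\<exists>a. sampled_poly n idx r c = smult (c (idx n) * of_real (r n)) (\<Prod>i<n. [:-a i, 1:]) \<and>
      inj_on (\<lambda>i. cmod (a i)) {..<n})"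
proof -
  let ?y = "\<lambda>c k. c (idx k) * complex_of_real (r k)"
  let ?M = "gaussian_family I"
  have nz: "AE c in ?M. c (idx k) \<noteq> 0" if "k \<le> n" for k
    using assms(2)[OF that] by (rule AE_gaussian_family_component) (rule AE_lborel_singleton)
  \<comment> \<open>Distinctness is phrased as a cardinality because that is known to be measurable.
    All positions lie in [0, 1), so the interval loses none of them.\<close>
  define P where "P = (\<lambda>c. c (idx n) \<noteq> 0 \<longrightarrow> card (root_positions (sampled_poly n idx r c) \<inter> {-1<..<1}) = n)"
  let ?pos = "\<lambda>w. (cmod w)\<^sup>2 / (1 + (cmod w)\<^sup>2)"
  have pos: "?pos w \<in> {-1<..<1}" for w
    using position_nonneg_less_1[of w] by (simp add: less_le_trans[of "-1" 0])
  note pos_inj = position_eq_iff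
  have card: "card (root_positions (smult l (\<Prod>i<n. [:-a i, 1:])) \<inter> {-1<..<1}) = n \<longleftrightarrow> inj_on (\<lambda>i. cmod (a i)) {..<n}"
    if "l \<noteq> 0" for l and a :: "nat \<Rightarrow> complex"
  proof -
    have "root_positions (smult l (\<Prod>i<n. [:-a i, 1:])) = (\<lambda>i. ?pos (a i)) ` {..<n}"
      using that by (auto simp: root_positions_def poly_prod)
    then have "root_positions (smult l (\<Prod>i<n. [:-a i, 1:])) \<inter> {-1<..<1} = (\<lambda>i. ?pos (a i)) ` {..<n}"
      using pos by auto
    then have "card (root_positions (smult l (\<Prod>i<n. [:-a i, 1:])) \<inter> {-1<..<1}) = n
        \<longleftrightarrow> inj_on (\<lambda>i. ?pos (a i)) {..<n}"
      using inj_on_iff_eq_card[of "{..<n}" "\<lambda>i. ?pos (a i)"] by simp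
    then show ?thesis by (simp add: inj_on_def pos_inj)
  qed
  have fac: "\<exists>a. sampled_poly n idx r c = smult (?y c n) (\<Prod>i<n. [:-a i, 1:])" if "c (idx n) \<noteq> 0" for c
  proof -
    have "?y c n \<noteq> 0" using that assms(4)[of n] by simp
    then obtain a where "(\<Sum>k\<le>n. monom (?y c k) k) = smult (?y c n) (\<Prod>i<n. [:-a i, 1:])"
      by (rule sum_monom_factorization)
    then show ?thesis unfolding sampled_poly_def by (intro exI[of _ a])
  qed
  have lnz: "?y c n \<noteq> 0" if "c (idx n) \<noteq> 0" for c
    using that assms(4)[of n] by simp
  have "AE c in ?M. P c"
  proof (cases "n \<ge> 2")
    case False
    have "P c" for c
    proof -
      have "inj_on (\<lambda>i. cmod (a i)) {..<n}" for a :: "nat \<Rightarrow> complex"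
        using False by (intro inj_onI) auto
      then show ?thesis unfolding P_def using fac[of c] card[OF lnz[of c]] by metis
    qed
    then show ?thesis by simp
  next
    case True
    have "idx 0 \<in> I" "idx 1 \<in> I" "idx 0 \<noteq> idx 1"
      using assms(2)[of 0] assms(2)[of 1] inj_onD[OF assms(3), of 0 1] True by auto
    then show ?thesis
    proof (rule AE_gaussian_family_two_components[OF assms(1)])
      have [measurable]: "(\<lambda>c. card (root_positions (sampled_poly n idx r c) \<inter> {-1<..<1})) \<in> ?M \<rightarrow>\<^sub>M count_space UNIV"
        using assms(2) by (intro measurable_card_root_positions sampled_poly_measurable) simp_all
      have f: "(\<lambda>c. c (idx n)) \<in> borel_measurable ?M"
        using assms(2)[of n] by (intro measurable_gaussian_family_component) simp
      have "Measurable.pred borel (\<lambda>z::complex. z \<noteq> 0)" by measurable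
      from measurable_compose[OF f this] have "Measurable.pred ?M (\<lambda>c. c (idx n) \<noteq> 0)" .
      moreover have "Measurable.pred ?M (\<lambda>c. card (root_positions (sampled_poly n idx r c) \<inter> {-1<..<1}) = n)"
        by measurable
      ultimately show "Measurable.pred ?M P" unfolding P_def by (rule pred_intros_logic)
    next
      fix x :: "'i \<Rightarrow> complex"
      define y where "y = (\<lambda>k. x (idx k))"
      have "AE v in std_complex_gaussian. AE u in std_complex_gaussian.
        \<not> equal_moduli_roots n (\<lambda>k. (y(0 := u, 1 := v)) k * complex_of_real (r k))"
        using True assms(4)[of 0] assms(4)[of 1] by (intro equal_moduli_rare) auto
      then show "AE v in std_complex_gaussian. AE u in std_complex_gaussian. P (x(idx 1 := v, idx 0 := u))"
      proof (rule eventually_mono)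
        fix v
        assume "AE u in std_complex_gaussian.
          \<not> equal_moduli_roots n (\<lambda>k. (y(0 := u, 1 := v)) k * complex_of_real (r k))"
        then show "AE u in std_complex_gaussian. P (x(idx 1 := v, idx 0 := u))"
        proof (rule eventually_mono)
          fix u
          let ?c = "x(idx 1 := v, idx 0 := u)"
          let ?Y = "\<lambda>k. (y(0 := u, 1 := v)) k * complex_of_real (r k)"
          assume no: "\<not> equal_moduli_roots n ?Y"
          have "?c (idx k) = (y(0 := u, 1 := v)) k" if "k \<le> n" for k
            using that True inj_on_eq_iff[OF assms(3), of k 0] inj_on_eq_iff[OF assms(3), of k 1]
            by (auto simp: y_def)
          then have g: "sampled_poly n idx r ?c = (\<Sum>k\<le>n. monom (?Y k) k)"
            unfolding sampled_poly_def by (intro sum.cong) auto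
          show "P ?c"
            unfolding P_def
          proof
            assume nz: "?c (idx n) \<noteq> 0"
            from nz obtain a where a: "sampled_poly n idx r ?c = smult (?y ?c n) (\<Prod>i<n. [:-a i, 1:])"
              using fac[of "?c"] by blast
            have "inj_on (\<lambda>i. cmod (a i)) {..<n}"
            proof (rule ccontr)
              assume "\<not> inj_on (\<lambda>i. cmod (a i)) {..<n}"
              then obtain i j where ij: "i < n" "j < n" "i \<noteq> j" "cmod (a i) = cmod (a j)"
                by (auto simp: inj_on_def)
              have pr: "(\<Prod>i<n. f i) = f i * f j * (\<Prod>i\<in>{..<n} - {i} - {j}. f i)" for f :: "nat \<Rightarrow> complex poly"
                using ij prod.remove[of "{..<n}" i f] prod.remove[of "{..<n} - {i}" j f]
                by (simp add: mult.assoc)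
              have eq: "(\<Sum>k\<le>n. monom (?Y k) k)
                  = [:-a i, 1:] * [:-a j, 1:] * smult (?y ?c n) (\<Prod>i\<in>{..<n} - {i} - {j}. [:-a i, 1:])"
                using a g pr[of "\<lambda>i. [:-a i, 1:]"] by (simp only: mult_smult_right)
              have "poly (\<Sum>k\<le>n. monom (?Y k) k) (a i) = 0"
                unfolding eq poly_mult by simp
              then have "(\<Sum>k\<le>n. ?Y k * a i ^ k) = 0" unfolding poly_sum_monom .
              moreover have "divided_difference n ?Y (a i) (a j) = 0"
                by (rule divided_difference_zero[OF eq])
              ultimately have "equal_moduli_roots n ?Y"
                unfolding equal_moduli_roots_def using ij(4) by blast
              with no show False by contradiction
            qed
            then show "card (root_positions (sampled_poly n idx r ?c) \<inter> {-1<..<1}) = n"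
              unfolding a by (rule card[THEN iffD2, rotated]) (rule lnz[of "?c", OF nz])
          qed
        qed
      qed
    qed
  qed
  with nz[OF le0] nz[OF order_refl] show ?thesis
  proof eventually_elim
    case (elim c)
    obtain a where a: "sampled_poly n idx r c = smult (?y c n) (\<Prod>i<n. [:-a i, 1:])"
      using fac[of c, OF elim(2)] by (rule exE)
    have "card (root_positions (smult (?y c n) (\<Prod>i<n. [:-a i, 1:])) \<inter> {-1<..<1}) = n"
      using elim(2,3) unfolding P_def a by (rule mp[rotated])
    then have "inj_on (\<lambda>i. cmod (a i)) {..<n}" by (rule card[THEN iffD1, rotated]) (rule lnz[of c, OF elim(2)])
    with a elim(1,2) show ?case by blast
  qed
qed

section \<open>The expected number of allowed roots\<close>

text \<open>Let S be the weighted coefficient sum and T the total weight. Taking logarithms in the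
  hypothesis and using ln(S / T) \<le> S / T - 1 leaves a bound that is linear in the random sum.
  For |c_j| < \<eta>, where ln |c_j| is out of control, m \<le> n is used instead.\<close>

lemma count_bound:
  fixes c :: "nat \<Rightarrow> complex" and W :: "nat \<Rightarrow> real" and n m j :: nat
  assumes W: "\<And>k. W k > 0" and j: "j \<le> n" and cj: "c j \<noteq> 0" and m: "m \<le> n" and eta: "0 < \<eta>" "\<eta> \<le> 1"
    and \<delta>: "\<delta> > 0"
    and le: "(cmod (c j))\<^sup>2 * W j * (exp (2 * \<delta>)) ^ m \<le> (\<Sum>k\<le>n. (cmod (c k))\<^sup>2 * W k)"
    and ratio: "ln ((\<Sum>k\<le>n. W k) / W j) \<le> L"
  shows "real m \<le> real n * indicator (ball 0 \<eta>) (c j)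
    + (L + (\<Sum>k\<le>n. (cmod (c k))\<^sup>2 * W k) / (\<Sum>k\<le>n. W k) - 2 * ln \<eta>) / (2 * \<delta>)"
proof -
  let ?S = "\<Sum>k\<le>n. (cmod (c k))\<^sup>2 * W k" and ?T = "\<Sum>k\<le>n. W k"
  have Wj: "W j \<le> ?T" using j W by (intro member_le_sum) (auto intro: less_imp_le)
  then have T: "?T > 0" using W[of j] by linarith
  have S: "?S \<ge> 0" using W by (intro sum_nonneg mult_nonneg_nonneg) (auto intro: less_imp_le)
  have eta': "ln \<eta> \<le> 0" using eta by simp
  have L: "L \<ge> 0" using ratio Wj W[of j] by (smt (verit) ln_ge_zero le_divide_eq_1_pos)
  show ?thesis
  proof (cases "cmod (c j) < \<eta>")
    case True
    have "0 \<le> (L + ?S / ?T - 2 * ln \<eta>) / (2 * \<delta>)"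
      using L S T eta' \<delta> by (intro divide_nonneg_nonneg add_nonneg_nonneg diff_ge_0_iff_ge[THEN iffD2]) (auto intro: order_trans[of _ 0])
    then show ?thesis using True m by simp
  next
    case False
    have pos: "(cmod (c j))\<^sup>2 * W j * (exp (2 * \<delta>)) ^ m > 0" using cj W[of j] by simp
    then have Sp: "?S > 0" using le by linarith
    have "ln ((cmod (c j))\<^sup>2 * W j * (exp (2 * \<delta>)) ^ m) \<le> ln ?S"
      using le pos by simp
    moreover have "ln ((cmod (c j))\<^sup>2 * W j * (exp (2 * \<delta>)) ^ m) = 2 * ln (cmod (c j)) + ln (W j) + 2 * \<delta> * real m"
      using cj W[of j] by (simp add: ln_mult ln_realpow)
    moreover have "ln ?S \<le> ln ?T + ?S / ?T - 1"
      using ln_le_minus_one[of "?S / ?T"] Sp T by (simp add: ln_div)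
    moreover have "ln ?T - ln (W j) \<le> L" using ratio T W[of j] by (simp add: ln_div)
    moreover have "ln \<eta> \<le> ln (cmod (c j))" using False eta cj by simp
    ultimately have "2 * \<delta> * real m \<le> L + ?S / ?T - 2 * ln \<eta>" by linarith
    then have "real m \<le> (L + ?S / ?T - 2 * ln \<eta>) / (2 * \<delta>)"
      using \<delta> by (simp add: field_simps)
    then show ?thesis using False by simp
  qed
qed

lemma distr_gaussian_family_component:
  assumes "i \<in> I"
  shows "distr (gaussian_family I) std_complex_gaussian (\<lambda>c. c i) = std_complex_gaussian"
  by (rule distr_PiM_component[where M = "\<lambda>_. std_complex_gaussian", OF prob_space_std_complex_gaussian assms])

lemma gaussian_second_moment:
  assumes "i \<in> I"
  shows "integrable (gaussian_family I) (\<lambda>c. (cmod (c i))\<^sup>2)"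
    and "(\<integral>c. (cmod (c i))\<^sup>2 \<partial>gaussian_family I) \<le> 4"
proof -
  have meas: "(\<lambda>c. c i) \<in> gaussian_family I \<rightarrow>\<^sub>M std_complex_gaussian"
    by (rule measurable_component_singleton[where M = "\<lambda>_. std_complex_gaussian", OF assms])
  have f: "(\<lambda>z. ennreal ((cmod z)\<^sup>2)) \<in> borel_measurable std_complex_gaussian"
    unfolding measurable_cong_sets[OF sets_std_complex_gaussian refl] by measurable
  have le: "(\<integral>\<^sup>+c. ennreal ((cmod (c i))\<^sup>2) \<partial>gaussian_family I) \<le> 4"
    using std_complex_gaussian_second_moment nn_integral_distr[OF meas, of "\<lambda>z. ennreal ((cmod z)\<^sup>2)"] f
    by (simp only: distr_gaussian_family_component[OF assms])
  have c: "(\<lambda>c. c i) \<in> borel_measurable (gaussian_family I)"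
    using assms by (rule measurable_gaussian_family_component)
  have "(\<lambda>z. (cmod z)\<^sup>2) \<in> borel_measurable borel" by measurable
  from measurable_compose[OF c this]
  have bm: "(\<lambda>c. (cmod (c i))\<^sup>2) \<in> borel_measurable (gaussian_family I)" .
  have fin: "(\<integral>\<^sup>+c. ennreal ((cmod (c i))\<^sup>2) \<partial>gaussian_family I) < \<infinity>"
    using le by (rule order_le_less_trans) simp
  show int: "integrable (gaussian_family I) (\<lambda>c. (cmod (c i))\<^sup>2)"
    by (rule integrableI_nonneg[OF bm _ fin]) simp
  have "ennreal (\<integral>c. (cmod (c i))\<^sup>2 \<partial>gaussian_family I) = (\<integral>\<^sup>+c. ennreal ((cmod (c i))\<^sup>2) \<partial>gaussian_family I)"
    by (rule nn_integral_eq_integral[OF int, symmetric]) simp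
  also have "\<dots> \<le> ennreal 4" using le by simp
  finally show "(\<integral>c. (cmod (c i))\<^sup>2 \<partial>gaussian_family I) \<le> 4"
    by (subst (asm) ennreal_le_iff) simp_all
qed

lemma gaussian_family_integral_component:
  fixes f :: "complex \<Rightarrow> real"
  assumes "i \<in> I" and f: "f \<in> borel_measurable borel"
  shows "(\<integral>c. f (c i) \<partial>gaussian_family I) = integral\<^sup>L std_complex_gaussian f"
proof -
  have "f \<in> borel_measurable std_complex_gaussian"
    unfolding measurable_cong_sets[OF sets_std_complex_gaussian refl] by (rule f)
  note fm = this
  have meas: "(\<lambda>c. c i) \<in> gaussian_family I \<rightarrow>\<^sub>M std_complex_gaussian"
    by (rule measurable_component_singleton[where M = "\<lambda>_. std_complex_gaussian", OF assms(1)])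
  have "integral\<^sup>L (distr (gaussian_family I) std_complex_gaussian (\<lambda>c. c i)) f = (\<integral>c. f (c i) \<partial>gaussian_family I)"
    by (rule integral_distr[OF meas fm])
  then show ?thesis by (simp only: distr_gaussian_family_component[OF assms(1)])
qed

lemma gaussian_small_prob:
  fixes \<eta> :: real
  assumes "i \<in> I"
  defines "f \<equiv> indicator (ball 0 \<eta>) :: complex \<Rightarrow> real"
  shows "integrable (gaussian_family I) (\<lambda>c. f (c i))"
    and "(\<integral>c. f (c i) \<partial>gaussian_family I) = measure std_complex_gaussian (ball 0 \<eta>)"
proof -
  note fin = prob_space.finite_measure[OF prob_space_gaussian_family]
  have f: "f \<in> borel_measurable borel" unfolding f_def by (rule borel_measurable_indicator) simp
  have c: "(\<lambda>c. c i) \<in> borel_measurable (gaussian_family I)"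
    using assms(1) by (rule measurable_gaussian_family_component)
  have comp: "(\<lambda>c. f (c i)) \<in> borel_measurable (gaussian_family I)"
    by (rule measurable_compose[OF c f])
  have bound: "norm (f z) \<le> 1" for z :: complex by (simp add: f_def indicator_def)
  show "integrable (gaussian_family I) (\<lambda>c. f (c i))"
    by (rule finite_measure.integrable_const_bound[OF fin _ comp, of 1]) (rule AE_I2, rule bound)
  have "integral\<^sup>L std_complex_gaussian f = measure std_complex_gaussian (ball 0 \<eta>)"
    by (simp add: f_def)
  then show "(\<integral>c. f (c i) \<partial>gaussian_family I) = measure std_complex_gaussian (ball 0 \<eta>)"
    by (simp only: gaussian_family_integral_component[OF assms(1) f])
qed

section \<open>Stray roots of an edge polynomial\<close>

lemma sampled_poly_coeff: "coeff (sampled_poly n idx r c) k = (if k \<le> n then c (idx k) * of_real (r k) else 0)"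
  by (simp add: sampled_poly_def coeff_sum_monom)

text \<open>The square of the bounding radius is b / (p - b), exactly the ratio for which the
  binomial weight at N b is modal. This coincidence is what makes Landau's inequality sharp enough
  at the ends of the allowed interval.\<close>

lemma position_less_iff:
  assumes "0 \<le> b" "b < p"
  shows "(cmod w)\<^sup>2 / (1 + (cmod w)\<^sup>2) < b / p \<longleftrightarrow> cmod w < sqrt (b / (p - b))"
    and "b / p < (cmod w)\<^sup>2 / (1 + (cmod w)\<^sup>2) \<longleftrightarrow> sqrt (b / (p - b)) < cmod w"
proof -
  have p: "1 + (cmod w)\<^sup>2 > 0" "p > 0" "p - b > 0" using assms by (auto intro: add_pos_nonneg)
  have sq: "cmod w = sqrt ((cmod w)\<^sup>2)" by simp
  have "(cmod w)\<^sup>2 / (1 + (cmod w)\<^sup>2) < b / p \<longleftrightarrow> (cmod w)\<^sup>2 < b / (p - b)"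
    using p by (simp add: divide_simps) (auto simp: algebra_simps)
  also have "\<dots> \<longleftrightarrow> cmod w < sqrt (b / (p - b))" by (subst (2) sq) (simp only: real_sqrt_less_iff)
  finally show "(cmod w)\<^sup>2 / (1 + (cmod w)\<^sup>2) < b / p \<longleftrightarrow> cmod w < sqrt (b / (p - b))" .
  have "b / p < (cmod w)\<^sup>2 / (1 + (cmod w)\<^sup>2) \<longleftrightarrow> b / (p - b) < (cmod w)\<^sup>2"
    using p by (simp add: divide_simps) (auto simp: algebra_simps)
  also have "\<dots> \<longleftrightarrow> sqrt (b / (p - b)) < cmod w" by (subst (2) sq) (simp only: real_sqrt_less_iff)
  finally show "b / p < (cmod w)\<^sup>2 / (1 + (cmod w)\<^sup>2) \<longleftrightarrow> sqrt (b / (p - b)) < cmod w" .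
qed

text \<open>The inverse of the monomial norm along a side, see
  \<open>monom_norm_edge_exponent\<close>. The value 1 beyond \<open>d\<close> keeps the weights
  positive for every index.\<close>

definition edge_weight :: "nat \<Rightarrow> nat \<Rightarrow> real" where
  "edge_weight d k = (if k \<le> d then sqrt (real (d choose k) * (real d + 1) * (real d + 2)) else 1)"

lemma edge_weight_pos: "edge_weight d k > 0"
  by (auto simp: edge_weight_def zero_less_binomial)

text \<open>Truncating the exponents to N a, ..., N b only decreases the numerator, so the estimate
  for the full binomial sum applies; factors common to all weights cancel.\<close>

lemma weight_ratio_bound:
  fixes p a b j N :: nat and s :: real
  assumes "0 < N" "a \<le> j" "j \<le> b" "b \<le> p" "0 < j" "j < p"
  defines "R \<equiv> (real j / real (p - j)) * exp (2 * s)"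
  defines "W \<equiv> \<lambda>k. (edge_weight (N * p) (N * a + k))\<^sup>2 * R ^ k"
  shows "ln ((\<Sum>k\<le>N*(b-a). W k) / W (N*(j-a))) \<le> ln (real (N*p) + 1) + real N * tilt_rate p j s"
proof -
  let ?d = "N * p" and ?n = "N * (b - a)"
  let ?V = "\<lambda>k. real (?d choose k) * R ^ k"
  have R: "R > 0" using assms by (simp add: R_def)
  \<comment> \<open>The common factor of the weights; the power of \<open>R\<close> compensates the
    shift of the index by \<open>N * a\<close>.\<close>
  define K where "K = (real ?d + 1) * (real ?d + 2) / R ^ (N * a)"
  have idx: "N * a + k \<le> ?d" if "k \<le> ?n" for k
  proof -
    have "N * a + N * (b - a) = N * b" using assms by (simp flip: add_mult_distrib2)
    moreover have "N * b \<le> N * p" using assms by simp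
    ultimately show ?thesis using that by linarith
  qed
  have W: "W k = K * ?V (N * a + k)" if "k \<le> ?n" for k
    using idx[OF that] R by (simp add: W_def K_def edge_weight_def power_add)
  have jn: "N * (j - a) \<le> ?n" "N * a + N * (j - a) = N * j"
    using assms by (auto simp: add_mult_distrib2[symmetric])
  have d1: "real ?d + 1 > 0" by (rule add_nonneg_pos) simp_all
  have "real ?d + 2 > 0" by (rule add_nonneg_pos) simp_all
  with d1 have K: "K > 0" unfolding K_def using R by (intro divide_pos_pos mult_pos_pos zero_less_power)
  have Vpos: "?V k \<ge> 0" for k using R by simp
  have Vj: "?V (N * j) > 0" using assms R by (simp add: zero_less_binomial)
  have Wn: "(\<Sum>k\<le>?n. W k) = K * (\<Sum>k\<le>?n. ?V (N * a + k))"
    by (simp only: sum_distrib_left) (intro sum.cong refl W, simp)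
  have Wj: "W (N*(j-a)) = K * ?V (N * j)"
    using W[OF jn(1)] by (simp only: jn(2))
  have "(\<Sum>k\<le>?n. W k) / W (N*(j-a)) = (\<Sum>k\<le>?n. ?V (N * a + k)) / ?V (N * j)"
    unfolding Wn Wj using K by (intro mult_divide_mult_cancel_left) simp
  also have "\<dots> \<le> (\<Sum>k\<le>?d. ?V k) / ?V (N * j)"
  proof (rule divide_right_mono)
    have "(\<Sum>k\<le>?n. ?V (N * a + k)) = (\<Sum>k\<in>(+) (N * a) ` {..?n}. ?V k)"
      by (subst sum.reindex) (auto simp: o_def)
    also have "\<dots> \<le> (\<Sum>k\<le>?d. ?V k)"
      using idx Vpos by (intro sum_mono2) auto
    finally show "(\<Sum>k\<le>?n. ?V (N * a + k)) \<le> (\<Sum>k\<le>?d. ?V k)" .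
  qed (use Vpos in auto)
  also have "\<dots> \<le> (real ?d + 1) * exp (real N * tilt_rate p j s)"
    unfolding R_def using assms by (intro tilted_binomial_ratio) auto
  finally have le: "(\<Sum>k\<le>?n. W k) / W (N*(j-a)) \<le> (real ?d + 1) * exp (real N * tilt_rate p j s)" .
  have "?V (N * j) \<le> (\<Sum>k\<le>?n. ?V (N * a + k))"
    using member_le_sum[of "N * (j - a)" "{..?n}" "\<lambda>k. ?V (N * a + k)"] jn Vpos by simp
  then have "0 < (\<Sum>k\<le>?n. W k) / W (N*(j-a))"
    unfolding Wn Wj using K Vj by (intro divide_pos_pos mult_pos_pos[OF K]) linarith+
  then have "ln ((\<Sum>k\<le>?n. W k) / W (N*(j-a))) \<le> ln ((real ?d + 1) * exp (real N * tilt_rate p j s))"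
    using le by simp
  also have "\<dots> = ln (real ?d + 1) + real N * tilt_rate p j s"
    using d1 by (subst ln_mult) (simp_all del: of_nat_mult)
  finally show ?thesis .
qed

text \<open>The right-hand side of \<open>count_bound\<close> as a random variable: a bound for a
  number of stray roots, not that number itself.\<close>

definition exceptional_roots ::
  "nat \<Rightarrow> (nat \<Rightarrow> 'i) \<Rightarrow> (nat \<Rightarrow> real) \<Rightarrow> nat \<Rightarrow> real \<Rightarrow> real \<Rightarrow> real \<Rightarrow> ('i \<Rightarrow> complex) \<Rightarrow> real" where
  "exceptional_roots n idx W j L \<eta> \<delta> c = real n * indicator (ball 0 \<eta>) (c (idx j))
    + (L + (\<Sum>k\<le>n. (cmod (c (idx k)))\<^sup>2 * W k) / (\<Sum>k\<le>n. W k) - 2 * ln \<eta>) / (2 * \<delta>)"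

lemma exceptional_roots_nonneg:
  assumes "\<And>k. W k \<ge> 0" "L \<ge> 0" "0 < \<eta>" "\<eta> \<le> 1" "0 < \<delta>"
  shows "exceptional_roots n idx W j L \<eta> \<delta> c \<ge> 0"
proof -
  have "(\<Sum>k\<le>n. (cmod (c (idx k)))\<^sup>2 * W k) / (\<Sum>k\<le>n. W k) \<ge> 0"
    using assms by (intro divide_nonneg_nonneg sum_nonneg) auto
  moreover have "ln \<eta> \<le> 0" using assms by simp
  ultimately have "(L + (\<Sum>k\<le>n. (cmod (c (idx k)))\<^sup>2 * W k) / (\<Sum>k\<le>n. W k) - 2 * ln \<eta>) / (2 * \<delta>) \<ge> 0"
    using assms by (intro divide_nonneg_nonneg) linarith+
  then show ?thesis by (simp add: exceptional_roots_def)
qed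

text \<open>Linearity is enough, as no logarithm of a random quantity is left. The second moment
  bounds the mean of the weighted quotient by 4.\<close>

lemma exceptional_roots_expectation:
  assumes idx: "\<And>k. k \<le> n \<Longrightarrow> idx k \<in> I" and "j \<le> n" and W: "\<And>k. W k \<ge> 0" and \<delta>: "0 < \<delta>"
    and \<gamma>: "measure std_complex_gaussian (ball 0 \<eta>) \<le> \<gamma>"
  shows "integrable (gaussian_family I) (exceptional_roots n idx W j L \<eta> \<delta>)"
    and "(\<integral>c. exceptional_roots n idx W j L \<eta> \<delta> c \<partial>gaussian_family I)
      \<le> real n * \<gamma> + (L + 4 - 2 * ln \<eta>) / (2 * \<delta>)"
proof -
  let ?M = "gaussian_family I"
  interpret M: prob_space ?M by (rule prob_space_gaussian_family)
  let ?S = "\<lambda>c. \<Sum>k\<le>n. (cmod (c (idx k)))\<^sup>2 * W k" and ?T = "\<Sum>k\<le>n. W k"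
  have int1: "integrable ?M (\<lambda>c. indicator (ball 0 \<eta>) (c (idx j)) :: real)"
    and val1: "(\<integral>c. indicator (ball 0 \<eta>) (c (idx j)) \<partial>?M) = measure std_complex_gaussian (ball 0 \<eta>)"
    using gaussian_small_prob[OF idx[OF assms(2)], of \<eta>] by auto
  have intS: "integrable ?M ?S"
    using idx by (intro Bochner_Integration.integrable_sum integrable_mult_left gaussian_second_moment(1)) simp
  have "(\<integral>c. ?S c \<partial>?M) = (\<Sum>k\<le>n. (\<integral>c. (cmod (c (idx k)))\<^sup>2 * W k \<partial>?M))"
    using idx by (intro Bochner_Integration.integral_sum integrable_mult_left gaussian_second_moment(1)) simp
  also have "\<dots> = (\<Sum>k\<le>n. (\<integral>c. (cmod (c (idx k)))\<^sup>2 \<partial>?M) * W k)" by simp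
  also have "\<dots> \<le> (\<Sum>k\<le>n. 4 * W k)"
    using idx W by (intro sum_mono mult_right_mono gaussian_second_moment(2)) simp_all
  finally have valS: "(\<integral>c. ?S c \<partial>?M) \<le> 4 * ?T" by (simp add: sum_distrib_left)
  have T: "?T \<ge> 0" using W by (intro sum_nonneg) simp
  have valST: "(\<integral>c. ?S c \<partial>?M) / ?T \<le> 4"
  \<comment> \<open>For total weight 0 the quotient is 0 by the convention for division.\<close>
  proof (cases "?T = 0")
    case False
    with T have "?T > 0" by simp
    then show ?thesis using valS by (simp add: pos_divide_le_eq)
  qed simp
  have intR: "integrable ?M (\<lambda>c. (L + ?S c / ?T - 2 * ln \<eta>) / (2 * \<delta>))"
    by (intro integrable_divide Bochner_Integration.integrable_diff Bochner_Integration.integrable_add intS M.integrable_const)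
  have int1n: "integrable ?M (\<lambda>c. real n * indicator (ball 0 \<eta>) (c (idx j)))"
    by (rule integrable_mult_right[OF int1])
  show "integrable ?M (exceptional_roots n idx W j L \<eta> \<delta>)"
    unfolding exceptional_roots_def[abs_def] by (rule Bochner_Integration.integrable_add[OF int1n intR])
  have "(\<integral>c. exceptional_roots n idx W j L \<eta> \<delta> c \<partial>?M)
      = real n * measure std_complex_gaussian (ball 0 \<eta>) + (\<integral>c. (L + ?S c / ?T - 2 * ln \<eta>) / (2 * \<delta>) \<partial>?M)"
    unfolding exceptional_roots_def Bochner_Integration.integral_add[OF int1n intR] by (simp add: val1)
  also have "(\<integral>c. (L + ?S c / ?T - 2 * ln \<eta>) / (2 * \<delta>) \<partial>?M) = (L + (\<integral>c. ?S c \<partial>?M) / ?T - 2 * ln \<eta>) / (2 * \<delta>)"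
  proof -
    have i: "integrable ?M (\<lambda>c. L + ?S c / ?T)"
      by (intro Bochner_Integration.integrable_add integrable_divide intS M.integrable_const)
    have "(\<integral>c. (L + ?S c / ?T - 2 * ln \<eta>) \<partial>?M) = (\<integral>c. (L + ?S c / ?T) \<partial>?M) - 2 * ln \<eta>"
      by (subst Bochner_Integration.integral_diff[OF i M.integrable_const]) (simp add: M.prob_space)
    also have "(\<integral>c. (L + ?S c / ?T) \<partial>?M) = L + (\<integral>c. ?S c \<partial>?M) / ?T"
      by (subst Bochner_Integration.integral_add[OF M.integrable_const integrable_divide[OF intS]]) (simp add: M.prob_space)
    finally show ?thesis by simp
  qed
  also have "real n * measure std_complex_gaussian (ball 0 \<eta>) + (L + (\<integral>c. ?S c \<partial>?M) / ?T - 2 * ln \<eta>) / (2 * \<delta>)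
      \<le> real n * \<gamma> + (L + 4 - 2 * ln \<eta>) / (2 * \<delta>)"
    using \<gamma> valST \<delta> by (intro add_mono mult_left_mono divide_right_mono) auto
  finally show "(\<integral>c. exceptional_roots n idx W j L \<eta> \<delta> c \<partial>?M) \<le> real n * \<gamma> + (L + 4 - 2 * ln \<eta>) / (2 * \<delta>)" .
qed

text \<open>The absolute value makes the rate nonnegative without an appeal to convexity of
  \<open>tilt_rate\<close>.\<close>

definition edge_rate :: "nat \<Rightarrow> nat \<Rightarrow> nat \<Rightarrow> real \<Rightarrow> real" where
  "edge_rate N p j s = ln (real (N * p) + 1) + real N * \<bar>tilt_rate p j s\<bar>"

text \<open>The variance of the coefficient with index \<open>k\<close> times \<rho>^(2k), for the
  radius \<rho> = sqrt(j / (p - j)) exp(s).\<close>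

definition tilted_weight :: "nat \<Rightarrow> nat \<Rightarrow> nat \<Rightarrow> nat \<Rightarrow> real \<Rightarrow> nat \<Rightarrow> real" where
  "tilted_weight N p a j s k
    = (edge_weight (N * p) (N * a + k))\<^sup>2 * ((real j / real (p - j)) * exp (2 * s)) ^ k"

lemma tilted_weight_nonneg: "tilted_weight N p a j s k \<ge> 0"
  by (simp add: tilted_weight_def)

lemma edge_rate_nonneg: "edge_rate N p j s \<ge> 0"
proof -
  have "real (N * p) + 1 \<ge> 1" by simp
  then have "ln (real (N * p) + 1) \<ge> 0" by (rule ln_ge_zero)
  then show ?thesis by (simp add: edge_rate_def)
qed

lemma edge_exceptional_count:
  fixes N p a b j n m :: nat and c :: "'i \<Rightarrow> complex" and idx :: "nat \<Rightarrow> 'i" and s \<delta> \<eta> :: real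
  assumes N: "0 < N" "a \<le> j" "j \<le> b" "b \<le> p" "0 < j" "j < p"
    and n: "n = N * (b - a)" and eta: "0 < \<eta>" "\<eta> \<le> 1" and \<delta>: "\<delta> > 0"
    and nz: "c (idx (N * (j - a))) \<noteq> 0" and m: "m \<le> n"
  defines "W \<equiv> tilted_weight N p a j s"
  assumes le: "(cmod (c (idx (N * (j - a)))))\<^sup>2 * W (N * (j - a)) * (exp (2 * \<delta>)) ^ m
    \<le> (\<Sum>k\<le>n. (cmod (c (idx k)))\<^sup>2 * W k)"
  shows "real m \<le> exceptional_roots n idx W (N * (j - a)) (edge_rate N p j s) \<eta> \<delta> c"
proof -
  have Wpos: "W k > 0" for k
    using N edge_weight_pos[of "N * p" "N * a + k"] by (simp add: W_def tilted_weight_def)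
  have "ln ((\<Sum>k\<le>n. W k) / W (N * (j - a))) \<le> ln (real (N * p) + 1) + real N * tilt_rate p j s"
    using weight_ratio_bound[OF N, of s] by (simp only: n W_def tilted_weight_def)
  also have "\<dots> \<le> edge_rate N p j s"
    unfolding edge_rate_def by (intro add_left_mono mult_left_mono) auto
  finally have ratio: "ln ((\<Sum>k\<le>n. W k) / W (N * (j - a))) \<le> edge_rate N p j s" .
  have jn: "N * (j - a) \<le> n" using N by (simp add: n)
  show ?thesis
    unfolding exceptional_roots_def
    by (rule count_bound[where c = "\<lambda>k. c (idx k)", OF Wpos jn nz m eta \<delta> le ratio])
qed

text \<open>The roots that are not counted lie in the closed disc given by a / p or beyond the open
  one given by b / p. The first kind is bounded through the constant coefficient, whose exponent is
  N a, the second through the leading one, whose exponent is N b.\<close>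

lemma root_positions_lower_bound:
  fixes N p a b n :: nat and c :: "'i \<Rightarrow> complex" and idx :: "nat \<Rightarrow> 'i" and \<delta> \<eta> :: real
  assumes N: "0 < N" "a < b" "b \<le> p" and n: "n = N * (b - a)"
    and eta: "0 < \<eta>" "\<eta> \<le> 1" and \<delta>: "\<delta> > 0"
    and nz: "c (idx 0) \<noteq> 0" "c (idx n) \<noteq> 0"
  defines "r \<equiv> \<lambda>k. edge_weight (N * p) (N * a + k)"
  assumes fac: "sampled_poly n idx r c = smult (c (idx n) * of_real (r n)) (\<Prod>i<n. [:-z i, 1:])"
    and inj: "inj_on (\<lambda>i. cmod (z i)) {..<n}"
  defines "Y \<equiv> card (root_positions (sampled_poly n idx r c) \<inter> {real a / real p<..<real b / real p})"
  shows "Y \<le> n"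
    and "real n \<le> real Y
      + exceptional_roots n idx (tilted_weight N p a a \<delta>) 0 (edge_rate N p a \<delta>) \<eta> \<delta> c
      + exceptional_roots n idx (tilted_weight N p a b (-\<delta>)) n (edge_rate N p b (-\<delta>)) \<eta> \<delta> c"
proof -
  let ?pos = "\<lambda>w. (cmod w)\<^sup>2 / (1 + (cmod w)\<^sup>2)"
  let ?g = "sampled_poly n idx r c"
  let ?U = "\<lambda>j k s. exceptional_roots n idx (tilted_weight N p a j s) k (edge_rate N p j s) \<eta> \<delta> c"
  let ?l = "c (idx n) * complex_of_real (r n)"
  have rpos: "r k > 0" for k unfolding r_def by (rule edge_weight_pos)
  have l: "?l \<noteq> 0" using nz(2) rpos[of n] by simp
  have rp: "root_positions ?g = (\<lambda>i. ?pos (z i)) ` {..<n}"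
  proof -
    have "poly ?g w = 0 \<longleftrightarrow> (\<exists>i<n. w = z i)" for w
      unfolding fac using l by (auto simp: poly_prod)
    then show ?thesis by (auto simp: root_positions_def)
  qed
  define K where "K = {i. i < n \<and> real a / real p < ?pos (z i) \<and> ?pos (z i) < real b / real p}"
  define K1 where "K1 = {i. i < n \<and> ?pos (z i) \<le> real a / real p}"
  define K2 where "K2 = {i. i < n \<and> real b / real p \<le> ?pos (z i)}"
  have "root_positions ?g \<inter> {real a / real p<..<real b / real p} = (\<lambda>i. ?pos (z i)) ` K"
    unfolding rp by (auto simp: K_def)
  moreover have "inj_on (\<lambda>i. ?pos (z i)) K"
    using inj by (auto simp: inj_on_def position_eq_iff K_def)
  ultimately have Y: "Y = card K" unfolding Y_def by (simp add: card_image)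
  have sub: "K \<subseteq> {..<n}" "K1 \<subseteq> {..<n}" "K2 \<subseteq> {..<n}" by (auto simp: K_def K1_def K2_def)
  have le: "card A \<le> n" if "A \<subseteq> {..<n}" for A :: "nat set"
    using card_mono[OF _ that] by simp
  show "Y \<le> n" unfolding Y by (rule le[OF sub(1)])
  have "{..<n} \<subseteq> K \<union> K1 \<union> K2" by (auto simp: K_def K1_def K2_def)
  then have "card {..<n} \<le> card (K \<union> K1 \<union> K2)"
    using sub by (intro card_mono) (auto intro: finite_subset)
  also have "\<dots> \<le> card K + card K1 + card K2"
    using card_Un_le[of "K \<union> K1" K2] card_Un_le[of K K1] by linarith
  finally have n_le: "real n \<le> real (card K) + real (card K1) + real (card K2)" by simp
  have coeff: "coeff ?g k = c (idx k) * of_real (r k)" if "k \<le> n" for k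
    using that by (simp add: sampled_poly_coeff)
  have nonneg: "?U j k s \<ge> 0" for j k s
    by (intro exceptional_roots_nonneg tilted_weight_nonneg edge_rate_nonneg eta \<delta>)
  have zn: "z i \<noteq> 0" if "i < n" for i
  proof
    assume "z i = 0"
    then have "poly ?g 0 = 0" unfolding fac using that by (auto simp: poly_prod)
    then have "coeff ?g 0 = 0" by (simp add: poly_0_coeff_0)
    then show False using coeff[of 0] nz(1) rpos[of 0] by simp
  qed
  have norm: "(cmod (coeff ?g k) * \<rho> ^ k)\<^sup>2 = (cmod (c (idx k)))\<^sup>2 * ((r k)\<^sup>2 * (\<rho>\<^sup>2) ^ k)"
    if "k \<le> n" for k \<rho>
    using rpos[of k] by (simp add: coeff[OF that] norm_mult power_mult_distrib power_mult[symmetric] mult.commute)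
  have rho: "(sqrt (real j / real (p - j)) * exp s)\<^sup>2 = (real j / real (p - j)) * exp (2 * s)" for j s
    by (simp add: power_mult_distrib exp_double[symmetric])
  have W: "(r k)\<^sup>2 * ((sqrt (real j / real (p - j)) * exp s)\<^sup>2) ^ k = tilted_weight N p a j s k" for j s k
    by (simp only: rho tilted_weight_def r_def)
  have exp2: "(exp \<delta>)\<^sup>2 = exp (2 * \<delta>)" by (rule exp_double[symmetric])
  have "real (card K1) \<le> ?U a 0 \<delta>"
  proof (cases "a = 0")
    case True
    \<comment> \<open>The inner circle has shrunk to the origin, which is not a root because the
      constant coefficient is nonzero.\<close>
    have "K1 = {}"
      using zn by (auto simp: K1_def True divide_le_0_iff not_le add_pos_nonneg)
    then show ?thesis using nonneg by simp
  next
    case False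
    \<comment> \<open>The radius lies a factor exp(\<delta>) outside the circle enclosing the stray
      roots, so each of them contributes exp(2 \<delta>) to Landau's product.\<close>
    define \<rho> where "\<rho> = sqrt (real a / real (p - a)) * exp \<delta>"
    have ap: "0 < a" "a < p" using False N by auto
    have rp: "\<rho> > 0" using ap by (simp add: \<rho>_def)
    have "K1 = {i. i < n \<and> cmod (z i) * exp \<delta> \<le> \<rho>}"
      using position_less_iff(2)[of "real a" "real p"] ap
      by (auto simp: K1_def \<rho>_def not_less[symmetric] of_nat_diff)
    then have "(cmod (coeff ?g 0))\<^sup>2 * (exp (2 * \<delta>)) ^ card K1 \<le> (\<Sum>k\<le>n. (cmod (coeff ?g k) * \<rho> ^ k)\<^sup>2)"
      using small_roots_bound[where n = n and a = z and c = ?l and r = \<rho> and t = "exp \<delta>"] rp \<delta> zn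
      by (simp only: fac[symmetric] exp2) simp
    also have "\<dots> = (\<Sum>k\<le>n. (cmod (c (idx k)))\<^sup>2 * tilted_weight N p a a \<delta> k)"
      by (intro sum.cong refl) (simp only: norm atMost_iff \<rho>_def W)
    also have "(cmod (coeff ?g 0))\<^sup>2 = (cmod (c (idx 0)))\<^sup>2 * tilted_weight N p a a \<delta> 0"
      using norm[of 0 \<rho>] by (simp add: W[symmetric])
    finally show ?thesis
      using edge_exceptional_count[where j = a and s = \<delta> and m = "card K1" and idx = idx and c = c and a = a and b = b and p = p and N = N and n = n] N ap n eta \<delta> nz(1) le[OF sub(2)]
      by simp
  qed
  moreover have "real (card K2) \<le> ?U b n (-\<delta>)"
  proof (cases "b = p")
    case True
    \<comment> \<open>The outer circle is at infinity: every position is below 1.\<close>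
    have "K2 = {}" using N position_nonneg_less_1(2) by (auto simp: K2_def True not_le)
    then show ?thesis using nonneg by simp
  next
    case False
    \<comment> \<open>The mirror image: now the radius lies a factor exp(\<delta>) inside the
      bounding circle, which is the tilt by -\<delta>.\<close>
    define \<rho> where "\<rho> = sqrt (real b / real (p - b)) * exp (-\<delta>)"
    have bp: "0 < b" "b < p" using False N by auto
    have rp: "\<rho> > 0" using bp by (simp add: \<rho>_def)
    have "\<rho> * exp \<delta> = sqrt (real b / real (p - b))"
      by (simp add: \<rho>_def exp_minus)
    then have "K2 = {i. i < n \<and> \<rho> * exp \<delta> \<le> cmod (z i)}"
      using position_less_iff(1)[of "real b" "real p"] bp
      by (auto simp: K2_def not_less[symmetric] of_nat_diff)
    then have "(cmod ?l * \<rho> ^ n)\<^sup>2 * (exp (2 * \<delta>)) ^ card K2 \<le> (\<Sum>k\<le>n. (cmod (coeff ?g k) * \<rho> ^ k)\<^sup>2)"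
      using large_roots_bound[where n = n and a = z and c = ?l and r = \<rho> and t = "exp \<delta>"] rp \<delta>
      by (simp only: fac[symmetric] exp2) simp
    also have "\<dots> = (\<Sum>k\<le>n. (cmod (c (idx k)))\<^sup>2 * tilted_weight N p a b (-\<delta>) k)"
      by (intro sum.cong refl) (simp only: norm atMost_iff \<rho>_def W)
    also have "(cmod ?l * \<rho> ^ n)\<^sup>2 = (cmod (c (idx n)))\<^sup>2 * tilted_weight N p a b (-\<delta>) n"
      using norm[of n \<rho>] by (simp only: coeff order_refl \<rho>_def W)
    finally show ?thesis
      using edge_exceptional_count[where j = b and s = "-\<delta>" and m = "card K2" and idx = idx and c = c and a = a and b = b and p = p and N = N and n = n] N bp n eta \<delta> nz(2) le[OF sub(3)]
      by simp
  qed
  ultimately show "real n \<le> real Y + ?U a 0 \<delta> + ?U b n (-\<delta>)"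
    using n_le unfolding Y by linarith
qed

text \<open>The part of f on an edge, stripped of the common power \<open>N * a\<close> of the side
  variable, which has no zeros in the torus.\<close>

definition edge_poly :: "nat \<Rightarrow> nat \<Rightarrow> nat \<Rightarrow> nat \<Rightarrow> (nat \<Rightarrow> 'i) \<Rightarrow> ('i \<Rightarrow> complex) \<Rightarrow> complex poly" where
  "edge_poly N p a b idx = sampled_poly (N * (b - a)) idx (\<lambda>k. edge_weight (N * p) (N * a + k))"

definition allowed_count :: "nat \<Rightarrow> nat \<Rightarrow> nat \<Rightarrow> nat \<Rightarrow> (nat \<Rightarrow> 'i) \<Rightarrow> ('i \<Rightarrow> complex) \<Rightarrow> nat" where
  "allowed_count N p a b idx c
    = card (root_positions (edge_poly N p a b idx c) \<inter> {real a / real p<..<real b / real p})"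

lemma allowed_count_measurable:
  assumes "\<And>k. k \<le> N * (b - a) \<Longrightarrow> idx k \<in> I" "b \<le> p"
  shows "allowed_count N p a b idx \<in> gaussian_family I \<rightarrow>\<^sub>M count_space UNIV"
  unfolding allowed_count_def[abs_def] edge_poly_def
  using assms by (intro measurable_card_root_positions sampled_poly_measurable) (auto simp: divide_le_eq_1)

text \<open>Almost surely the count is at most the degree and misses it by at most the two
  exceptional bounds, one for each end of the interval. The two ends account for the factor 2 before
  \<gamma> and for the constants 8 and 4.\<close>

lemma allowed_count_expectation:
  assumes N: "0 < N" "a < b" "b \<le> p" and "finite I"
    and idx: "\<And>k. k \<le> N * (b - a) \<Longrightarrow> idx k \<in> I" "inj_on idx {..N * (b - a)}"
    and eta: "0 < \<eta>" "\<eta> \<le> 1" and \<delta>: "\<delta> > 0"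
    and \<gamma>: "measure std_complex_gaussian (ball 0 \<eta>) \<le> \<gamma>"
  defines "Y \<equiv> \<lambda>c. real (allowed_count N p a b idx c)"
  shows "integrable (gaussian_family I) Y"
    and "integral\<^sup>L (gaussian_family I) Y \<le> real (N * (b - a))"
    and "real (N * (b - a)) - 2 * real (N * (b - a)) * \<gamma>
      - (edge_rate N p a \<delta> + edge_rate N p b (-\<delta>) + 8 - 4 * ln \<eta>) / (2 * \<delta>)
      \<le> integral\<^sup>L (gaussian_family I) Y"
proof -
  let ?M = "gaussian_family I" and ?n = "N * (b - a)"
  let ?Ua = "exceptional_roots ?n idx (tilted_weight N p a a \<delta>) 0 (edge_rate N p a \<delta>) \<eta> \<delta>"
  let ?Ub = "exceptional_roots ?n idx (tilted_weight N p a b (-\<delta>)) ?n (edge_rate N p b (-\<delta>)) \<eta> \<delta>"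
  interpret M: prob_space ?M by (rule prob_space_gaussian_family)
  have ae: "AE c in ?M. Y c \<le> real ?n \<and> real ?n \<le> Y c + ?Ua c + ?Ub c"
    using AE_distinct_moduli[where r = "\<lambda>k. edge_weight (N * p) (N * a + k)", OF \<open>finite I\<close> idx edge_weight_pos]
  proof (rule eventually_mono)
    fix c :: "'a \<Rightarrow> complex"
    assume *: "c (idx 0) \<noteq> 0 \<and> c (idx ?n) \<noteq> 0 \<and>
      (\<exists>z. sampled_poly ?n idx (\<lambda>k. edge_weight (N * p) (N * a + k)) c
        = smult (c (idx ?n) * of_real (edge_weight (N * p) (N * a + ?n))) (\<Prod>i<?n. [:-z i, 1:]) \<and>
        inj_on (\<lambda>i. cmod (z i)) {..<?n})"
    then obtain z where z: "sampled_poly ?n idx (\<lambda>k. edge_weight (N * p) (N * a + k)) c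
        = smult (c (idx ?n) * of_real (edge_weight (N * p) (N * a + ?n))) (\<Prod>i<?n. [:-z i, 1:])"
      "inj_on (\<lambda>i. cmod (z i)) {..<?n}" by blast
    have nz: "c (idx 0) \<noteq> 0" "c (idx ?n) \<noteq> 0" using * by auto
    show "Y c \<le> real ?n \<and> real ?n \<le> Y c + ?Ua c + ?Ub c"
      using root_positions_lower_bound[OF N refl eta \<delta> nz z]
      unfolding Y_def allowed_count_def edge_poly_def of_nat_le_iff by (rule conjI)
  qed
  have meas: "Y \<in> borel_measurable ?M"
    unfolding Y_def by (rule measurable_compose[OF allowed_count_measurable[OF idx(1) N(3)]]) simp_all
  show int: "integrable ?M Y"
    by (rule M.integrable_const_bound[OF _ meas, of "real ?n"]) (rule eventually_mono[OF ae], simp add: Y_def)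
  have "integral\<^sup>L ?M Y \<le> (\<integral>c. real ?n \<partial>?M)"
    by (rule integral_mono_AE[OF int M.integrable_const]) (rule eventually_mono[OF ae], simp)
  then show "integral\<^sup>L ?M Y \<le> real ?n" by (simp add: M.prob_space)
  have a: "integrable ?M ?Ua" "integral\<^sup>L ?M ?Ua \<le> real ?n * \<gamma> + (edge_rate N p a \<delta> + 4 - 2 * ln \<eta>) / (2 * \<delta>)"
    by (rule exceptional_roots_expectation[OF _ le0 tilted_weight_nonneg \<delta> \<gamma>], rule idx(1), assumption)+
  have b: "integrable ?M ?Ub" "integral\<^sup>L ?M ?Ub \<le> real ?n * \<gamma> + (edge_rate N p b (-\<delta>) + 4 - 2 * ln \<eta>) / (2 * \<delta>)"
    by (rule exceptional_roots_expectation[OF _ order_refl tilted_weight_nonneg \<delta> \<gamma>], rule idx(1), assumption)+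
  have i1: "integrable ?M (\<lambda>c. Y c + ?Ua c)" by (rule Bochner_Integration.integrable_add[OF int a(1)])
  have "(\<integral>c. real ?n \<partial>?M) \<le> (\<integral>c. Y c + ?Ua c + ?Ub c \<partial>?M)"
    by (rule integral_mono_AE[OF M.integrable_const Bochner_Integration.integrable_add[OF i1 b(1)]])
      (rule eventually_mono[OF ae], simp)
  also have "\<dots> = integral\<^sup>L ?M Y + integral\<^sup>L ?M ?Ua + integral\<^sup>L ?M ?Ub"
    by (simp only: Bochner_Integration.integral_add[OF i1 b(1)] Bochner_Integration.integral_add[OF int a(1)])
  also have "\<dots> \<le> integral\<^sup>L ?M Y + (real ?n * \<gamma> + (edge_rate N p a \<delta> + 4 - 2 * ln \<eta>) / (2 * \<delta>))
      + (real ?n * \<gamma> + (edge_rate N p b (-\<delta>) + 4 - 2 * ln \<eta>) / (2 * \<delta>))"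
    by (intro add_mono order_refl a(2) b(2))
  finally have "real ?n \<le> integral\<^sup>L ?M Y + (real ?n * \<gamma> + (edge_rate N p a \<delta> + 4 - 2 * ln \<eta>) / (2 * \<delta>))
      + (real ?n * \<gamma> + (edge_rate N p b (-\<delta>) + 4 - 2 * ln \<eta>) / (2 * \<delta>))"
    by (simp add: M.prob_space)
  moreover have "(edge_rate N p a \<delta> + 4 - 2 * ln \<eta>) / (2 * \<delta>) + (edge_rate N p b (-\<delta>) + 4 - 2 * ln \<eta>) / (2 * \<delta>)
      = (edge_rate N p a \<delta> + edge_rate N p b (-\<delta>) + 8 - 4 * ln \<eta>) / (2 * \<delta>)"
    by (simp add: add_divide_distrib[symmetric])
  ultimately show "real ?n - 2 * real ?n * \<gamma>
      - (edge_rate N p a \<delta> + edge_rate N p b (-\<delta>) + 8 - 4 * ln \<eta>) / (2 * \<delta>) \<le> integral\<^sup>L ?M Y"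
    by linarith
qed

lemma allowed_count_limit:
  fixes I :: "nat \<Rightarrow> 'i set" and idx :: "nat \<Rightarrow> nat \<Rightarrow> 'i"
  assumes ab: "a < b" "b \<le> p" and fin: "\<And>N. N > 0 \<Longrightarrow> finite (I N)"
    and idx: "\<And>N k. N > 0 \<Longrightarrow> k \<le> N * (b - a) \<Longrightarrow> idx N k \<in> I N" "\<And>N. N > 0 \<Longrightarrow> inj_on (idx N) {..N * (b - a)}"
  defines "E \<equiv> \<lambda>N. \<integral>c. real (allowed_count N p a b (idx N) c) \<partial>gaussian_family (I N)"
  shows "(\<lambda>N. E N / real N) \<longlonglongrightarrow> real (b - a)"
proof (rule LIMSEQ_I)
  fix e :: real assume e: "e > 0"
  define B where "B = real (b - a)"
  have B: "B > 0" using ab by (simp add: B_def)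
  \<comment> \<open>The two small balls together cost 2 B \<gamma> = e / 4 after division by
    N.\<close>
  define \<gamma> where "\<gamma> = e / (8 * B)"
  have \<gamma>: "\<gamma> > 0" using e B by (simp add: \<gamma>_def)
  obtain \<eta> where eta: "\<eta> > 0" "\<eta> \<le> 1" "measure std_complex_gaussian (ball 0 \<eta>) < \<gamma>"
    using std_complex_gaussian_small_ball[OF \<gamma>] by blast
  have "\<forall>\<^sub>F s in at 0. \<bar>tilt_rate p a s / s\<bar> < e / 4" "\<forall>\<^sub>F s in at 0. \<bar>tilt_rate p b s / s\<bar> < e / 4"
    using tendstoD[OF tilt_rate_small[of a p], of "e/4"] tendstoD[OF tilt_rate_small[of b p], of "e/4"] ab e
    by (simp_all add: dist_real_def)
  then have "\<forall>\<^sub>F s in at 0. \<bar>tilt_rate p a s / s\<bar> < e / 4 \<and> \<bar>tilt_rate p b s / s\<bar> < e / 4"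
    by (rule eventually_conj)
  then obtain d where d: "d > 0" "\<And>s. s \<noteq> 0 \<Longrightarrow> \<bar>s\<bar> < d \<Longrightarrow> \<bar>tilt_rate p a s / s\<bar> < e / 4 \<and> \<bar>tilt_rate p b s / s\<bar> < e / 4"
    unfolding eventually_at by (auto simp: dist_real_def)
  \<comment> \<open>Both rates are at most (e / 4) \<delta>; divided by 2 \<delta>, they cost N e /
    4 together. The choice does not depend on N.\<close>
  define \<delta> where "\<delta> = d / 2"
  have \<delta>: "\<delta> > 0" using d(1) by (simp add: \<delta>_def)
  have rates: "\<bar>tilt_rate p a \<delta>\<bar> \<le> e / 4 * \<delta>" "\<bar>tilt_rate p b (-\<delta>)\<bar> \<le> e / 4 * \<delta>"
    using d(2)[of \<delta>] d(2)[of "-\<delta>"] d(1) by (auto simp: \<delta>_def abs_divide field_simps)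
  \<comment> \<open>What is left beside the rates: the logarithm of the polynomial factor, and the
    constants from the second moment and the small ball. It grows like ln N before division by
    N.\<close>
  define rest where "rest = (\<lambda>N. (2 * ln (real N * real p + 1) + (8 - 4 * ln \<eta>)) / (2 * \<delta>) / real N)"
  have "rest \<longlonglongrightarrow> 0"
  proof -
    define K where "K = 8 - 4 * ln \<eta>"
    have p: "real p > 0" using ab by simp
    have "(\<lambda>N. (2 * ln (real N * real p + 1) + K) / real N) \<longlonglongrightarrow> 0"
      using p by real_asymp
    from tendsto_divide[OF this tendsto_const[of "2 * \<delta>"]] \<delta>
    show ?thesis by (simp add: rest_def K_def mult.commute)
  qed
  then have "\<forall>\<^sub>F N in sequentially. rest N < e / 4"
    using e by (intro order_tendstoD) auto
  then obtain N0 where N0: "\<And>N. N \<ge> N0 \<Longrightarrow> rest N < e / 4"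
    by (auto simp: eventually_sequentially)
  show "\<exists>no. \<forall>N\<ge>no. norm (E N / real N - real (b - a)) < e"
  proof (intro exI[of _ "Suc N0"] allI impI)
    fix N assume "Suc N0 \<le> N"
    then have N: "N > 0" "N \<ge> N0" by auto
    note bounds = allowed_count_expectation[OF N(1) ab fin[OF N(1)] idx(1)[OF N(1)] idx(2)[OF N(1)] eta(1,2) \<delta> less_imp_le[OF eta(3)]]
    have nN: "real (N * (b - a)) = real N * B" by (simp add: B_def)
    have up: "E N / real N \<le> B"
      using bounds(2) N(1) unfolding E_def nN by (simp add: pos_divide_le_eq mult.commute)
    have "(edge_rate N p a \<delta> + edge_rate N p b (-\<delta>) + 8 - 4 * ln \<eta>) / (2 * \<delta>)
        \<le> (2 * ln (real N * real p + 1) + (8 - 4 * ln \<eta>) + real N * (e / 2 * \<delta>)) / (2 * \<delta>)"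
    proof (rule divide_right_mono)
      have "edge_rate N p a \<delta> \<le> ln (real N * real p + 1) + real N * (e / 4 * \<delta>)"
        "edge_rate N p b (-\<delta>) \<le> ln (real N * real p + 1) + real N * (e / 4 * \<delta>)"
        unfolding edge_rate_def of_nat_mult by (intro add_left_mono mult_left_mono rates; simp)+
      then show "edge_rate N p a \<delta> + edge_rate N p b (-\<delta>) + 8 - 4 * ln \<eta>
          \<le> 2 * ln (real N * real p + 1) + (8 - 4 * ln \<eta>) + real N * (e / 2 * \<delta>)"
        by (simp add: algebra_simps)
    qed (use \<delta> in simp)
    also have "\<dots> = real N * rest N + real N * (e / 4)"
      using N(1) \<delta> by (simp add: rest_def field_simps)
    also have "\<dots> \<le> real N * (e / 4) + real N * (e / 4)"
      using N0[OF N(2)] by (intro add_right_mono mult_left_mono) auto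
    finally have "real N * B - 2 * (real N * B) * \<gamma> - (real N * (e / 4) + real N * (e / 4)) \<le> E N"
      using bounds(3) unfolding E_def nN by linarith
    moreover have "2 * (real N * B) * \<gamma> = real N * (e / 4)"
    proof -
      have "B * \<gamma> = e / 8" using B by (simp add: \<gamma>_def)
      then show ?thesis by (simp add: mult.assoc)
    qed
    ultimately have "real N * (B - 3 * e / 4) \<le> E N" unfolding right_diff_distrib by linarith
    then have "B - 3 * e / 4 \<le> E N / real N"
      using N(1) by (simp add: pos_le_divide_eq mult.commute)
    then show "norm (E N / real N - real (b - a)) < e"
      using up e by (simp add: B_def[symmetric] abs_if)
  qed
qed

section \<open>The sides of the triangle\<close>

text \<open>Affine involutions of the triangle of size \<open>d\<close> that exchange barycentric
  coordinates and carry side \<open>j\<close> to the bottom side. All local statements can thus be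
  proved on the bottom side.\<close>

definition side_map :: "nat \<Rightarrow> real \<Rightarrow> real \<times> real \<Rightarrow> real \<times> real" where
  "side_map j d x = (if j = 0 then x else if j = 1 then (snd x, fst x) else (fst x, d - fst x - snd x))"

lemma side_map_involution [simp]: "side_map j d (side_map j d x) = x"
  by (simp add: side_map_def)

lemma inj_side_map: "inj (side_map j d)"
  by (rule inj_on_inverseI[where g = "side_map j d"]) simp

lemma continuous_on_side_map [continuous_intros]:
  "continuous_on S f \<Longrightarrow> continuous_on S (\<lambda>x. side_map j d (f x))"
  by (cases "j = 0"; cases "j = 1") (auto simp: side_map_def intro!: continuous_intros)

lemma side_map_scaleR: "t *\<^sub>R side_map j d x = side_map j (t * d) (t *\<^sub>R x)"
  by (simp add: side_map_def algebra_simps)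

lemma image_side_map_iff: "x \<in> side_map j d ` S \<longleftrightarrow> side_map j d x \<in> S"
  by (metis image_iff side_map_involution)

lemma closure_side_map: "closure (side_map j d ` S) = side_map j d ` closure S"
proof -
  have le: "side_map j d ` closure S \<subseteq> closure (side_map j d ` S)" for S
    by (rule image_closure_subset)
      (auto intro!: continuous_on_side_map continuous_on_id closure_subset[THEN subsetD])
  have "side_map j d ` closure (side_map j d ` S) \<subseteq> closure S"
    using le[of "side_map j d ` S"] by (simp add: image_image)
  then have "side_map j d ` side_map j d ` closure (side_map j d ` S) \<subseteq> side_map j d ` closure S"
    by (rule image_mono)
  with le[of S] show ?thesis by (simp add: image_image)
qed

lemma side_map_closed_segment:
  "side_map j d ` closed_segment u v = closed_segment (side_map j d u) (side_map j d v)"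
proof -
  have "side_map j d ((1 - t) *\<^sub>R u + t *\<^sub>R v) = (1 - t) *\<^sub>R side_map j d u + t *\<^sub>R side_map j d v" for t
    by (simp add: side_map_def prod_eq_iff algebra_simps)
  then show ?thesis by (simp add: closed_segment_image_interval image_image)
qed

lemma dilate_triangle:
  assumes "d > 0"
  shows "dilate d std_triangle = {x. 0 \<le> fst x \<and> 0 \<le> snd x \<and> fst x + snd x \<le> d}"
proof (intro set_eqI iffI)
  fix x assume "x \<in> dilate d std_triangle"
  then obtain y where y: "x = d *\<^sub>R y" "y \<in> std_triangle" by blast
  then have "d * (fst y + snd y) \<le> d * 1" using assms by (intro mult_left_mono) (auto simp: std_triangle_def)
  then show "x \<in> {x. 0 \<le> fst x \<and> 0 \<le> snd x \<and> fst x + snd x \<le> d}"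
    using y assms by (auto simp: std_triangle_def algebra_simps)
next
  fix x assume x: "x \<in> {x. 0 \<le> fst x \<and> 0 \<le> snd x \<and> fst x + snd x \<le> d}"
  then have "(1 / d) *\<^sub>R x \<in> std_triangle"
    using assms by (auto simp: std_triangle_def divide_simps)
  moreover have "x = d *\<^sub>R ((1 / d) *\<^sub>R x)" using assms by simp
  ultimately show "x \<in> dilate d std_triangle" by blast
qed

lemma side_map_triangle:
  assumes "d > 0"
  shows "side_map j d x \<in> dilate d std_triangle \<longleftrightarrow> x \<in> dilate d std_triangle"
  unfolding dilate_triangle[OF assms] by (auto simp: side_map_def)

lemma interior_triangle:
  assumes "d > 0"
  shows "interior (dilate d std_triangle) = {x. 0 < fst x \<and> 0 < snd x \<and> fst x + snd x < d}"
proof -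
  have eq: "dilate d std_triangle = {x. (1, 0) \<bullet> x \<ge> 0} \<inter> {x. (0, 1) \<bullet> x \<ge> 0} \<inter> {x. (1, 1) \<bullet> x \<le> d}"
    unfolding dilate_triangle[OF assms] by (auto simp: inner_prod_def)
  show ?thesis unfolding eq interior_Int
    by (subst interior_halfspace_ge interior_halfspace_le; simp add: prod_eq_iff)+
      (auto simp: inner_prod_def)
qed

lemma closed_triangle: "closed std_triangle"
  unfolding std_triangle_def by (intro closed_Collect_conj closed_Collect_le continuous_intros)

lemma frontier_triangle:
  assumes "d > 0"
  shows "frontier (dilate d std_triangle) = (\<Union>j<3. {x \<in> dilate d std_triangle. snd (side_map j d x) = 0})"
proof -
  have "closed (dilate d std_triangle)" using closed_triangle by (rule closed_scaling)
  then have "frontier (dilate d std_triangle) = dilate d std_triangle - interior (dilate d std_triangle)"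
    by (simp add: frontier_def)
  also have "\<dots> = {x \<in> dilate d std_triangle. snd x = 0 \<or> fst x = 0 \<or> d - fst x - snd x = 0}"
    unfolding interior_triangle[OF assms] using dilate_triangle[OF assms] by auto
  also have "\<dots> = (\<Union>j<3. {x \<in> dilate d std_triangle. snd (side_map j d x) = 0})"
    by (auto simp: side_map_def numeral_3_eq_3 lessThan_Suc)
  finally show ?thesis .
qed

lemma closed_sides_eq:
  "closed_sides d = (\<lambda>j. {x \<in> dilate (real d) std_triangle. snd (side_map j (real d) x) = 0}) ` {..<3}"
proof -
  have "{..<3::nat} = {1, 0, 2}" by auto
  moreover have "{x \<in> dilate (real d) std_triangle. fst x + snd x = real d}
      = {x \<in> dilate (real d) std_triangle. real d - fst x - snd x = 0}" by auto
  ultimately show ?thesis by (simp add: closed_sides_def side_map_def)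
qed

definition open_side :: "nat \<Rightarrow> (real \<times> real) set" where
  "open_side j = side_map j 1 ` ({0<..<1} \<times> {0})"

lemma open_side_iff:
  "x \<in> open_side j \<longleftrightarrow> 0 < fst (side_map j 1 x) \<and> fst (side_map j 1 x) < 1 \<and> snd (side_map j 1 x) = 0"
  unfolding open_side_def image_side_map_iff by (auto simp: mem_Times_iff)

lemma open_side_frontier: "j < 3 \<Longrightarrow> open_side j \<subseteq> frontier std_triangle"
  using frontier_triangle[of 1] side_map_triangle[of 1 j] dilate_triangle[of 1]
  by (force simp: open_side_iff)

lemma open_side_disjoint:
  assumes "i < 3" "j < 3" "i \<noteq> j"
  shows "open_side i \<inter> open_side j = {}"
  using assms by (auto simp: open_side_iff side_map_def less_Suc_eq numeral_3_eq_3)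

text \<open>An open side is relatively open in the frontier: positivity of two barycentric
  coordinates is an open condition and forces the third to vanish there.\<close>

lemma frontier_minus_open_side_closed:
  assumes "j < 3"
  shows "closed (frontier std_triangle - open_side j)"
proof -
  let ?W = "{x. 0 < fst (side_map j 1 x) \<and> fst (side_map j 1 x) + snd (side_map j 1 x) < 1}"
  have "x \<in> ?W \<longleftrightarrow> x \<in> open_side j" if "x \<in> frontier std_triangle" for x
  proof -
    have x: "x \<in> std_triangle" "snd x = 0 \<or> fst x = 0 \<or> 1 - fst x - snd x = 0"
      using that frontier_triangle[of 1] by (auto simp: side_map_def numeral_3_eq_3 lessThan_Suc)
    consider "j = 0" | "j = 1" | "j = 2" using assms by linarith
    then show ?thesis using x by cases (auto simp: open_side_iff side_map_def std_triangle_def)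
  qed
  then have eq: "frontier std_triangle - open_side j = frontier std_triangle \<inter> - ?W" by blast
  have "open ?W"
    by (intro open_Collect_conj open_Collect_less continuous_intros)
  then show ?thesis unfolding eq by (intro closed_Int frontier_closed closed_Compl)
qed

text \<open>In homogeneous coordinates [1 : z1 : z2] these exchange two coordinates or none. They
  lift \<open>side_map\<close> through the moment map.\<close>

definition torus_map :: "nat \<Rightarrow> complex \<times> complex \<Rightarrow> complex \<times> complex" where
  "torus_map j z = (if j = 0 then z else if j = 1 then (snd z, fst z) else (fst z / snd z, 1 / snd z))"

lemma torus_map_torus: "z \<in> torus \<Longrightarrow> torus_map j z \<in> torus"
  by (auto simp: torus_map_def torus_def)

lemma torus_map_involution: "z \<in> torus \<Longrightarrow> torus_map j (torus_map j z) = z"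
  by (auto simp: torus_map_def torus_def)

lemma moment_map_torus_map:
  assumes "z \<in> torus"
  shows "moment_map (torus_map j z) = side_map j 1 (moment_map z)"
proof -
  obtain w t where z: "z = (w, t)" by (cases z)
  have t: "t \<noteq> 0" using assms by (auto simp: z torus_def)
  have n: "(norm (u, v))\<^sup>2 = (cmod u)\<^sup>2 + (cmod v)\<^sup>2" for u v :: complex
    by (simp add: norm_prod_def)
  have pos: "1 + ((cmod w)\<^sup>2 + (cmod t)\<^sup>2) > 0" by (intro add_pos_nonneg) auto
  have e1: "1 + ((cmod (w / t))\<^sup>2 + (cmod (1 / t))\<^sup>2) = ((cmod t)\<^sup>2 + ((cmod w)\<^sup>2 + 1)) / (cmod t)\<^sup>2"
    using t by (simp add: norm_divide power_divide add_divide_distrib)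
  have e2: "(cmod (w / t))\<^sup>2 = (cmod w)\<^sup>2 / (cmod t)\<^sup>2" "(cmod (1 / t))\<^sup>2 = 1 / (cmod t)\<^sup>2"
    by (simp_all add: norm_divide power_divide)
  have q: "(u / (cmod t)\<^sup>2) / (v / (cmod t)\<^sup>2) = u / v" for u v using t by simp
  have "moment_map (w / t, 1 / t) = side_map 2 1 (moment_map (w, t))"
    unfolding moment_map_def n fst_conv snd_conv e1 unfolding e2 q
    using pos by (simp add: side_map_def divide_simps)
  moreover have "moment_map (t, w) = (snd (moment_map (w, t)), fst (moment_map (w, t)))"
    unfolding moment_map_def n fst_conv snd_conv by (simp only: add.commute[of "(cmod t)\<^sup>2"])
  ultimately show ?thesis
    by (cases "j = 0"; cases "j = 1") (simp_all add: z torus_map_def side_map_def)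
qed

lemma moment_map_zeros_side:
  "moment_map ` torus_zeros f = side_map j 1 ` moment_map ` torus_zeros (\<lambda>z. f (torus_map j z))"
proof -
  have "torus_zeros f = torus_map j ` torus_zeros (\<lambda>z. f (torus_map j z))"
  proof (intro set_eqI iffI)
    fix z assume "z \<in> torus_zeros f"
    then have "torus_map j z \<in> torus_zeros (\<lambda>z. f (torus_map j z))" "z = torus_map j (torus_map j z)"
      by (auto simp: torus_zeros_def torus_map_torus torus_map_involution)
    then show "z \<in> torus_map j ` torus_zeros (\<lambda>z. f (torus_map j z))" by blast
  qed (auto simp: torus_zeros_def torus_map_torus)
  then have "moment_map ` torus_zeros f = (\<lambda>z. moment_map (torus_map j z)) ` torus_zeros (\<lambda>z. f (torus_map j z))"
    by (simp add: image_image)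
  also have "\<dots> = (\<lambda>z. side_map j 1 (moment_map z)) ` torus_zeros (\<lambda>z. f (torus_map j z))"
    by (rule image_cong) (auto simp: torus_zeros_def moment_map_torus_map)
  finally show ?thesis by (simp add: image_image)
qed

section \<open>Boundary points of the compact amoeba\<close>

text \<open>Every root is at least \<delta> away from \<open>w\<close>, so moving from
  \<open>w\<close> to \<open>v\<close> at most doubles each linear factor. The bound depends on the
  polynomial only through its degree and hence survives limits.\<close>

lemma poly_no_root_near_bound:
  fixes q :: "complex poly"
  assumes "q \<noteq> 0" "degree q \<le> D" and noroot: "\<And>u. cmod (u - w) < \<delta> \<Longrightarrow> poly q u \<noteq> 0"
    and v: "cmod (v - w) < \<delta>"
  shows "cmod (poly q v) \<le> 2 ^ D * cmod (poly q w)"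
proof -
  obtain a where a: "smult (lead_coeff q) (\<Prod>i<degree q. [:-a i, 1:]) = q"
    by (rule complex_poly_decompose')
  have val: "poly q u = lead_coeff q * (\<Prod>i<degree q. u - a i)" for u
    by (subst a[symmetric]) (simp add: poly_prod)
  have far: "\<delta> \<le> cmod (w - a i)" if "i < degree q" for i
  proof (rule ccontr)
    assume "\<not> \<delta> \<le> cmod (w - a i)"
    then have "poly q (a i) \<noteq> 0" by (intro noroot) (simp add: norm_minus_commute)
    then show False using that by (auto simp: val)
  qed
  have "cmod (poly q v) = cmod (lead_coeff q) * (\<Prod>i<degree q. cmod (v - a i))"
    by (simp add: val norm_mult prod_norm)
  also have "\<dots> \<le> cmod (lead_coeff q) * (\<Prod>i<degree q. 2 * cmod (w - a i))"
  proof (intro mult_left_mono prod_mono conjI)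
    fix i assume "i \<in> {..<degree q}"
    then have "\<delta> \<le> cmod (w - a i)" using far by simp
    moreover have "cmod (v - a i) \<le> cmod (v - w) + cmod (w - a i)"
      using norm_triangle_ineq[of "v - w" "w - a i"] by simp
    ultimately show "cmod (v - a i) \<le> 2 * cmod (w - a i)" using v by linarith
  qed simp_all
  also have "\<dots> = 2 ^ degree q * cmod (poly q w)"
    by (simp add: val norm_mult prod_norm prod.distrib)
  also have "\<dots> \<le> 2 ^ D * cmod (poly q w)"
    using assms(2) by (intro mult_right_mono power_increasing) auto
  finally show ?thesis .
qed

text \<open>A form of Hurwitz's theorem. If no zero with small t \<noteq> 0 existed near
  \<open>w\<close>, the preceding bound would pass to the limit t = 0, where its right-hand side
  vanishes; the polynomial at t = 0 would then be zero on a whole disc.\<close>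

lemma root_persists:
  fixes C :: "'e \<Rightarrow> complex" and m l :: "'e \<Rightarrow> nat"
  assumes fin: "finite E" and nz: "(\<Sum>e | e \<in> E \<and> l e = 0. monom (C e) (m e)) \<noteq> 0"
    and w: "poly (\<Sum>e | e \<in> E \<and> l e = 0. monom (C e) (m e)) w = 0" and \<delta>: "\<delta> > 0"
  shows "\<exists>t v. t \<noteq> 0 \<and> cmod t < \<delta> \<and> cmod (v - w) < \<delta> \<and> (\<Sum>e\<in>E. C e * (v ^ m e * t ^ l e)) = 0"
proof (rule ccontr)
  let ?g = "\<Sum>e | e \<in> E \<and> l e = 0. monom (C e) (m e)"
  let ?F = "\<lambda>v t. \<Sum>e\<in>E. C e * (v ^ m e * t ^ l e)"
  define q where "q t = (\<Sum>e\<in>E. monom (C e * t ^ l e) (m e))" for t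
  assume no: "\<not> ?thesis"
  have q: "poly (q t) v = ?F v t" for t v
    by (simp add: q_def poly_sum poly_monom mult_ac)
  define D where "D = Max (insert 0 (m ` E))"
  have deg: "degree (q t) \<le> D" for t
    unfolding q_def
  proof (rule degree_sum_le[OF fin])
    fix e assume "e \<in> E"
    then have "m e \<le> D" using fin by (auto simp: D_def intro: Max_ge)
    then show "degree (monom (C e * t ^ l e) (m e)) \<le> D"
      using degree_monom_le order_trans by blast
  qed
  have F0: "?F v 0 = poly ?g v" for v
  proof -
    have "?F v 0 = (\<Sum>e\<in>E. if l e = 0 then C e * v ^ m e else 0)"
      by (intro sum.cong) (auto simp: power_0_left)
    also have "\<dots> = (\<Sum>e | e \<in> E \<and> l e = 0. C e * v ^ m e)"
      using fin by (subst sum.inter_filter[symmetric]) auto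
    finally show ?thesis by (simp add: poly_sum poly_monom)
  qed
  have "poly ?g v = 0" if v: "cmod (v - w) < \<delta>" for v
  proof -
    have cont: "((\<lambda>t. ?F u t) \<longlongrightarrow> ?F u 0) (at 0)" for u
      by (intro tendsto_intros)
    have "\<forall>\<^sub>F t in at 0. cmod (?F v t) \<le> 2 ^ D * cmod (?F w t)"
      unfolding eventually_at
    proof (intro exI[of _ \<delta>] conjI ballI impI \<delta>)
      fix t :: complex assume t: "t \<noteq> 0 \<and> dist t 0 < \<delta>"
      have nr: "poly (q t) u \<noteq> 0" if "cmod (u - w) < \<delta>" for u
        using no t that by (auto simp: q)
      have "q t \<noteq> 0" using nr[of w] \<delta> by (metis diff_self norm_zero poly_0)
      from poly_no_root_near_bound[OF this deg nr v]
      show "cmod (?F v t) \<le> 2 ^ D * cmod (?F w t)" by (simp only: q)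
    qed
    moreover have "((\<lambda>t. cmod (?F v t)) \<longlongrightarrow> cmod (?F v 0)) (at 0)"
      by (intro tendsto_norm cont)
    moreover have "((\<lambda>t. 2 ^ D * cmod (?F w t)) \<longlongrightarrow> 2 ^ D * cmod (?F w 0)) (at 0)"
      by (intro tendsto_mult tendsto_const tendsto_norm cont)
    ultimately have "cmod (?F v 0) \<le> 2 ^ D * cmod (?F w 0)"
      by (intro tendsto_le[of "at 0"]) auto
    then show ?thesis unfolding F0 w by simp
  qed
  then have "ball w \<delta> \<subseteq> {v. poly ?g v = 0}"
    by (auto simp: dist_norm norm_minus_commute)
  moreover have "finite {v. poly ?g v = 0}" using nz by (rule poly_roots_finite)
  ultimately have "finite (ball w \<delta>)" by (rule finite_subset)
  then show False using uncountable_ball[OF \<delta>, of w] by (simp add: countable_finite)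
qed

lemma moment_map_eq:
  "moment_map (w, t) = ((cmod w)\<^sup>2 / (1 + (cmod w)\<^sup>2 + (cmod t)\<^sup>2), (cmod t)\<^sup>2 / (1 + (cmod w)\<^sup>2 + (cmod t)\<^sup>2))"
  by (simp add: moment_map_def norm_prod_def add.assoc)

lemma moment_denominator_pos: "1 + (cmod w)\<^sup>2 + (cmod t)\<^sup>2 > 0"
  by (intro add_pos_nonneg) auto

lemma continuous_on_moment_map: "continuous_on S moment_map"
proof -
  have "1 + (norm (z :: complex \<times> complex))\<^sup>2 \<noteq> 0" for z
    by (metis add_pos_nonneg less_irrefl zero_le_power2 zero_less_one)
  then show ?thesis
    unfolding moment_map_def[abs_def] by (intro continuous_intros ballI) auto
qed

text \<open>Torus zeros approaching the boundary point have bounded first coordinate because x < 1,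
  and a limit point is a root of the part with \<open>l e = 0\<close>. Conversely a root persists to
  nearby torus zeros, where x > 0 keeps the first coordinate away from 0.\<close>

lemma boundary_point_iff_root:
  fixes C :: "'e \<Rightarrow> complex" and m l :: "'e \<Rightarrow> nat"
  assumes fin: "finite E" and nz: "(\<Sum>e | e \<in> E \<and> l e = 0. monom (C e) (m e)) \<noteq> 0"
    and x: "0 < x" "x < 1"
  defines "Z \<equiv> torus_zeros (\<lambda>z. \<Sum>e\<in>E. C e * (fst z ^ m e * snd z ^ l e))"
  shows "(x, 0) \<in> closure (moment_map ` Z) \<longleftrightarrow>
    (\<exists>w. poly (\<Sum>e | e \<in> E \<and> l e = 0. monom (C e) (m e)) w = 0 \<and> x = (cmod w)\<^sup>2 / (1 + (cmod w)\<^sup>2))"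
proof
  let ?g = "\<Sum>e | e \<in> E \<and> l e = 0. monom (C e) (m e)"
  let ?F = "\<lambda>z. \<Sum>e\<in>E. C e * (fst z ^ m e * snd z ^ l e)"
  assume "(x, 0) \<in> closure (moment_map ` Z)"
  then obtain y where y: "\<And>n. y n \<in> moment_map ` Z" "y \<longlonglongrightarrow> (x, 0)"
    unfolding closure_sequential by blast
  then have "\<forall>n. \<exists>z. z \<in> Z \<and> y n = moment_map z" by blast
  then obtain z where z: "\<And>n. z n \<in> Z" "\<And>n. y n = moment_map (z n)" by metis
  \<comment> \<open>The inverse of the moment map on squared moduli. Along the sequence the
    denominator tends to 1 - x > 0.\<close>
  have sq: "(cmod (fst v))\<^sup>2 = fst (moment_map v) / (1 - fst (moment_map v) - snd (moment_map v))"
    "(cmod (snd v))\<^sup>2 = snd (moment_map v) / (1 - fst (moment_map v) - snd (moment_map v))" for v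
  proof -
    obtain w t where v: "v = (w, t)" by (cases v)
    have "1 - fst (moment_map v) - snd (moment_map v) = 1 / (1 + (cmod w)\<^sup>2 + (cmod t)\<^sup>2)"
      using moment_denominator_pos[of w t] by (simp add: v moment_map_eq field_simps)
    then show "(cmod (fst v))\<^sup>2 = fst (moment_map v) / (1 - fst (moment_map v) - snd (moment_map v))"
      "(cmod (snd v))\<^sup>2 = snd (moment_map v) / (1 - fst (moment_map v) - snd (moment_map v))"
      using moment_denominator_pos[of w t] by (simp_all add: v moment_map_eq)
  qed
  have y12: "(\<lambda>n. fst (y n)) \<longlonglongrightarrow> x" "(\<lambda>n. snd (y n)) \<longlonglongrightarrow> 0"
    using tendsto_fst[OF y(2)] tendsto_snd[OF y(2)] by simp_all
  have den: "(\<lambda>n. 1 - fst (y n) - snd (y n)) \<longlonglongrightarrow> 1 - x - 0"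
    by (intro tendsto_intros y12)
  have w2: "(\<lambda>n. (cmod (fst (z n)))\<^sup>2) \<longlonglongrightarrow> x / (1 - x - 0)"
    unfolding sq z(2)[symmetric] using x by (intro tendsto_divide y12 den) auto
  have "(\<lambda>n. (cmod (snd (z n)))\<^sup>2) \<longlonglongrightarrow> 0 / (1 - x - 0)"
    unfolding sq z(2)[symmetric] using x by (intro tendsto_divide y12 den) auto
  then have "(\<lambda>n. sqrt ((cmod (snd (z n)))\<^sup>2)) \<longlonglongrightarrow> sqrt (0 / (1 - x - 0))" by (rule tendsto_real_sqrt)
  then have t0: "(\<lambda>n. snd (z n)) \<longlonglongrightarrow> 0" by (simp add: tendsto_norm_zero_iff)
  have "(\<lambda>n. sqrt ((cmod (fst (z n)))\<^sup>2)) \<longlonglongrightarrow> sqrt (x / (1 - x - 0))" using w2 by (rule tendsto_real_sqrt)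
  then have nw: "(\<lambda>n. cmod (fst (z n))) \<longlonglongrightarrow> sqrt (x / (1 - x))" by simp
  then have "Bseq (\<lambda>n. cmod (fst (z n)))" by (intro convergent_imp_Bseq convergentI)
  then have "bounded (range (\<lambda>n. fst (z n)))"
    by (simp add: Bseq_eq_bounded[symmetric] Bseq_def)
  then obtain w r where r: "strict_mono r" "((\<lambda>n. fst (z n)) \<circ> r) \<longlonglongrightarrow> w"
    using bounded_imp_convergent_subsequence by blast
  have "(\<lambda>n. ?F (z (r n))) \<longlonglongrightarrow> ?F (w, 0)"
    using r(2) LIMSEQ_subseq_LIMSEQ[OF t0 r(1)] by (auto intro!: tendsto_intros simp: o_def)
  moreover have "?F (z (r n)) = 0" for n using z(1)[of "r n"] by (simp add: Z_def torus_zeros_def)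
  ultimately have "?F (w, 0) = 0" by (simp add: LIMSEQ_const_iff)
  moreover have "?F (w, 0) = poly ?g w"
  proof -
    have "?F (w, 0) = (\<Sum>e\<in>E. if l e = 0 then C e * w ^ m e else 0)"
      by (intro sum.cong) (auto simp: power_0_left)
    also have "\<dots> = (\<Sum>e | e \<in> E \<and> l e = 0. C e * w ^ m e)"
      using fin by (subst sum.inter_filter[symmetric]) auto
    finally show ?thesis by (simp add: poly_sum poly_monom)
  qed
  ultimately have root: "poly ?g w = 0" by simp
  have "(cmod w)\<^sup>2 = x / (1 - x)"
  proof -
    have "(\<lambda>n. cmod (fst (z (r n)))) \<longlonglongrightarrow> cmod w" using tendsto_norm[OF r(2)] by (simp add: o_def)
    moreover have "(\<lambda>n. cmod (fst (z (r n)))) \<longlonglongrightarrow> sqrt (x / (1 - x))"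
      using LIMSEQ_subseq_LIMSEQ[OF nw r(1)] by (simp add: o_def)
    ultimately have "cmod w = sqrt (x / (1 - x))" by (rule LIMSEQ_unique)
    then show ?thesis using x by simp
  qed
  moreover have "1 + x / (1 - x) = 1 / (1 - x)" using x by (simp add: field_simps)
  ultimately have "x = (cmod w)\<^sup>2 / (1 + (cmod w)\<^sup>2)"
    using x by simp
  with root show "\<exists>w. poly ?g w = 0 \<and> x = (cmod w)\<^sup>2 / (1 + (cmod w)\<^sup>2)" by auto
next
  let ?g = "\<Sum>e | e \<in> E \<and> l e = 0. monom (C e) (m e)"
  assume "\<exists>w. poly ?g w = 0 \<and> x = (cmod w)\<^sup>2 / (1 + (cmod w)\<^sup>2)"
  then obtain w where w: "poly ?g w = 0" "x = (cmod w)\<^sup>2 / (1 + (cmod w)\<^sup>2)" by blast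
  have w0: "w \<noteq> 0" using w(2) x by auto
  have "(w, 0) \<in> closure Z"
    unfolding closure_approachable
  proof (intro allI impI)
    fix e :: real assume e: "e > 0"
    define \<delta> where "\<delta> = min (e / 2) (cmod w)"
    have \<delta>: "\<delta> > 0" using e w0 by (simp add: \<delta>_def)
    obtain t v where tv: "t \<noteq> 0" "cmod t < \<delta>" "cmod (v - w) < \<delta>" "(\<Sum>e\<in>E. C e * (v ^ m e * t ^ l e)) = 0"
      using root_persists[OF fin nz w(1) \<delta>] by blast
    have "v \<noteq> 0" using tv(3) by (auto simp: \<delta>_def)
    then have "(v, t) \<in> Z" using tv by (simp add: Z_def torus_zeros_def torus_def)
    moreover have "dist (v, t) (w, 0) \<le> cmod (v - w) + cmod t"
      using norm_Pair_le[of "v - w" t] by (simp add: dist_norm)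
    then have "dist (v, t) (w, 0) < e" using tv(2,3) by (simp add: \<delta>_def)
    ultimately show "\<exists>y\<in>Z. dist y (w, 0) < e" by blast
  qed
  then have "moment_map (w, 0) \<in> moment_map ` closure Z" by blast
  also have "\<dots> \<subseteq> closure (moment_map ` Z)"
    by (rule image_closure_subset[OF continuous_on_moment_map]) (auto intro: closure_subset[THEN subsetD])
  finally show "(x, 0) \<in> closure (moment_map ` Z)" by (simp add: moment_map_eq w(2))
qed

section \<open>Tentacles at isolated boundary points\<close>

text \<open>By the separation by 2 \<epsilon>, the ball around \<open>e\<close> is disjoint from the
  union of the balls around the other points of \<open>D\<close>. These open sets cover the
  neighborhood, so a connected set through \<open>e\<close> stays in the first.\<close>

lemma component_of_isolated_point:
  fixes A D :: "'a::metric_space set"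
  assumes "D \<subseteq> A" "e \<in> D" "\<epsilon> > 0" and sep: "\<And>y. y \<in> D \<Longrightarrow> y \<noteq> e \<Longrightarrow> 2 * \<epsilon> \<le> dist e y"
  defines "U \<equiv> {x \<in> A. \<exists>y\<in>D. dist x y < \<epsilon>}"
  shows "connected_component_set U e \<inter> D = {e}"
proof -
  let ?C = "connected_component_set U e"
  let ?O = "\<Union>y\<in>D - {e}. ball y \<epsilon>"
  have e: "e \<in> U" using assms by (auto simp: U_def intro!: bexI[of _ e])
  then have eC: "e \<in> ?C" by (simp add: connected_component_refl)
  have CU: "?C \<subseteq> U" by (rule connected_component_subset)
  have sub: "?C \<subseteq> ball e \<epsilon> \<union> ?O"
  proof
    fix x assume "x \<in> ?C"
    then obtain y where "y \<in> D" "dist x y < \<epsilon>" using CU by (auto simp: U_def)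
    then show "x \<in> ball e \<epsilon> \<union> ?O" by (cases "y = e") (auto simp: dist_commute)
  qed
  have disj: "ball e \<epsilon> \<inter> ?O = {}"
  proof (rule ccontr)
    assume "ball e \<epsilon> \<inter> ?O \<noteq> {}"
    then obtain x where x: "x \<in> ball e \<epsilon>" "x \<in> ?O" by blast
    from x(2) obtain y where y: "y \<in> D - {e}" "x \<in> ball y \<epsilon>" by (rule UN_E)
    then show False using x(1) sep[of y] dist_triangle2[of e y x] by simp
  qed
  have "ball e \<epsilon> \<inter> ?C = {} \<or> ?O \<inter> ?C = {}"
    using connectedD[OF connected_connected_component, of "ball e \<epsilon>" ?O U e] sub disj by auto
  moreover have "e \<in> ball e \<epsilon> \<inter> ?C" using eC \<open>\<epsilon> > 0\<close> by simp
  ultimately have "?O \<inter> ?C = {}" by blast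
  with sub have "?C \<subseteq> ball e \<epsilon>" by blast
  then have "y = e" if "y \<in> ?C" "y \<in> D" for y
    using that sep[of y] \<open>\<epsilon> > 0\<close> by (cases "y = e") (auto simp: subset_iff)
  then show ?thesis using eC assms(2) by blast
qed

text \<open>Only the points of \<open>E\<close> are assumed isolated in \<open>D\<close>; the other
  boundary points may accumulate. For \<epsilon> below half of the least isolation radius, mapping a
  point of \<open>E\<close> to its component is a bijection.\<close>

lemma card_components_at_isolated_points:
  fixes A D E :: "'a::metric_space set"
  assumes "D \<subseteq> A" "E \<subseteq> D" "finite E" and iso: "\<And>e. e \<in> E \<Longrightarrow> \<exists>\<eta>>0. \<forall>y\<in>D. y \<noteq> e \<longrightarrow> \<eta> \<le> dist e y"
  shows "\<forall>\<^sub>F \<epsilon> in at_right 0.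
    card {T \<in> components {x \<in> A. \<exists>y\<in>D. dist x y < \<epsilon>}. \<exists>e. T \<inter> D = {e} \<and> e \<in> E} = card E"
proof -
  obtain \<eta> where \<eta>: "\<And>e. e \<in> E \<Longrightarrow> \<eta> e > 0" "\<And>e y. e \<in> E \<Longrightarrow> y \<in> D \<Longrightarrow> y \<noteq> e \<Longrightarrow> \<eta> e \<le> dist e y"
    using iso by metis
  \<comment> \<open>Inserting 1 gives a meaningful minimum when \<open>E\<close> is empty.\<close>
  define h where "h = Min (insert 1 (\<eta> ` E))"
  have h: "h > 0" "\<And>e. e \<in> E \<Longrightarrow> h \<le> \<eta> e"
    using \<eta>(1) \<open>finite E\<close> by (auto simp: h_def)
  have "card {T \<in> components {x \<in> A. \<exists>y\<in>D. dist x y < \<epsilon>}. \<exists>e. T \<inter> D = {e} \<and> e \<in> E} = card E"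
    if \<epsilon>: "0 < \<epsilon>" "\<epsilon> < h / 2" for \<epsilon>
  proof -
    let ?U = "{x \<in> A. \<exists>y\<in>D. dist x y < \<epsilon>}"
    have meet: "connected_component_set ?U e \<inter> D = {e}" if "e \<in> E" for e
    proof (rule component_of_isolated_point)
      fix y assume "y \<in> D" "y \<noteq> e"
      then show "2 * \<epsilon> \<le> dist e y" using \<eta>(2)[OF that] h(2)[OF that] \<epsilon> by fastforce
    qed (use assms that \<epsilon> in auto)
    have DU: "D \<subseteq> ?U" using assms(1) \<epsilon>(1) by (auto intro!: bexI)
    have "{T \<in> components ?U. \<exists>e. T \<inter> D = {e} \<and> e \<in> E} = (\<lambda>e. connected_component_set ?U e) ` E"
    proof (intro set_eqI iffI)
      fix T assume T: "T \<in> {T \<in> components ?U. \<exists>e. T \<inter> D = {e} \<and> e \<in> E}"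
      then obtain e where e: "T \<inter> D = {e}" "e \<in> E" by blast
      then have "e \<in> T" by blast
      have "T \<in> components ?U" using T by blast
      then obtain x where x: "T = connected_component_set ?U x" by (rule componentsE)
      have "connected_component_set ?U e = connected_component_set ?U x"
        using \<open>e \<in> T\<close> unfolding x by (rule connected_component_eq)
      then have "T = connected_component_set ?U e" unfolding x by (rule sym)
      then show "T \<in> (\<lambda>e. connected_component_set ?U e) ` E" using e by blast
    next
      fix T assume "T \<in> (\<lambda>e. connected_component_set ?U e) ` E"
      then obtain e where e: "e \<in> E" "T = connected_component_set ?U e" by blast
      have "e \<in> ?U" using DU assms(2) e(1) by blast
      then have "T \<in> components ?U" unfolding e(2) components_def by (rule imageI)
      then show "T \<in> {T \<in> components ?U. \<exists>e. T \<inter> D = {e} \<and> e \<in> E}" using meet[OF e(1)] e by auto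
    qed
    moreover have "inj_on (\<lambda>e. connected_component_set ?U e) E"
    proof (rule inj_onI)
      fix e e' assume "e \<in> E" "e' \<in> E" "connected_component_set ?U e = connected_component_set ?U e'"
      then have "{e} = {e'}" using meet[of e] meet[of e'] by (metis (no_types, lifting))
      then show "e = e'" by simp
    qed
    ultimately show ?thesis by (simp add: card_image)
  qed
  then show ?thesis
    using h(1) unfolding eventually_at_right_field by (intro exI[of _ "h / 2"]) auto
qed

section \<open>Logarithmic coordinates and asymptotic directions\<close>

definition log_of_triangle :: "real \<times> real \<Rightarrow> real \<times> real" where
  "log_of_triangle x = ((ln (fst x) - ln (1 - fst x - snd x)) / 2, (ln (snd x) - ln (1 - fst x - snd x)) / 2)"

lemma triangle_of_log_pos:
  "0 < fst (triangle_of_log u)" "0 < snd (triangle_of_log u)"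
  "0 < 1 - fst (triangle_of_log u) - snd (triangle_of_log u)"
proof -
  have p: "1 + exp (2 * fst u) + exp (2 * snd u) > 0" by (intro add_pos_pos) auto
  show "0 < fst (triangle_of_log u)" "0 < snd (triangle_of_log u)" using p by (auto simp: triangle_of_log_def)
  show "0 < 1 - fst (triangle_of_log u) - snd (triangle_of_log u)"
    using p by (simp add: triangle_of_log_def field_simps)
qed

lemma log_of_triangle_of_log: "log_of_triangle (triangle_of_log u) = u"
proof -
  define D where "D = 1 + exp (2 * fst u) + exp (2 * snd u)"
  have D: "D > 0" unfolding D_def by (intro add_pos_pos) auto
  have f: "fst (triangle_of_log u) = exp (2 * fst u) / D" "snd (triangle_of_log u) = exp (2 * snd u) / D"
    by (auto simp: triangle_of_log_def D_def)
  have "1 - exp (2 * fst u) / D - exp (2 * snd u) / D = 1 / D"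
    using D by (simp add: D_def field_simps)
  then show ?thesis
    using D by (simp add: log_of_triangle_def f ln_div prod_eq_iff)
qed

lemma compact_amoeba_triangle: "compact_amoeba B \<subseteq> std_triangle"
proof -
  have "triangle_of_log u \<in> std_triangle" for u
    using triangle_of_log_pos[of u] by (simp add: std_triangle_def)
  then show ?thesis
    unfolding compact_amoeba_def by (intro closure_minimal closed_triangle) blast
qed

text \<open>Outside a neighborhood of \<open>e\<close> the closure of the tentacle misses the
  frontier, so it is a compact part of the open triangle and has bounded logarithmic coordinates.
  Going to infinity inside the tentacle hence means approaching \<open>e\<close>.\<close>

lemma tendsto_tentacle_end:
  assumes T: "T \<in> tentacles B \<epsilon>" and "\<epsilon> > 0" and e: "T \<inter> frontier std_triangle = {e}"
  shows "(triangle_of_log \<longlongrightarrow> e) (inf at_infinity (principal {u \<in> B. triangle_of_log u \<in> T}))"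
proof (rule topological_tendstoI)
  fix V assume V: "open V" "e \<in> V"
  let ?A = "compact_amoeba B"
  let ?U = "{x \<in> ?A. \<exists>y \<in> ?A \<inter> frontier std_triangle. dist x y < \<epsilon>}"
  have Tc: "T \<in> components ?U" using T by (simp add: tentacles_def Let_def)
  have TA: "closure T \<subseteq> ?A"
    using in_components_subset[OF Tc] by (intro closure_minimal) (auto simp: compact_amoeba_def)
  obtain S where S: "closed S" "T = ?U \<inter> S"
    using closedin_component[OF Tc] unfolding closedin_closed by blast
  then have closed_in: "closure T \<inter> ?U \<subseteq> T"
    using closure_minimal[of T S] by blast
  define K where "K = closure T - V"
  have K: "K \<inter> frontier std_triangle = {}"
  proof (rule ccontr)
    assume "K \<inter> frontier std_triangle \<noteq> {}"
    then obtain y where y: "y \<in> closure T" "y \<notin> V" "y \<in> frontier std_triangle" by (auto simp: K_def)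
    \<comment> \<open>A frontier point of the amoeba belongs to every such neighborhood, and
      \<open>T\<close> is closed in it; so \<open>y\<close> would be a second end of the
      tentacle.\<close>
    then have "y \<in> ?U" using TA \<open>\<epsilon> > 0\<close> by (auto intro!: bexI[of _ y])
    then have "y \<in> T" using closed_in y by blast
    then show False using e y V by (metis IntI singletonD)
  qed
  have Ktri: "K \<subseteq> std_triangle" using TA compact_amoeba_triangle by (auto simp: K_def)
  have "bounded std_triangle"
    by (rule bounded_subset[OF bounded_cbox[of "(0, 0)" "(1, 1)"]])
      (auto simp: std_triangle_def cbox_Pair_eq)
  then have "bounded K" using Ktri bounded_subset by blast
  moreover have "closed K" unfolding K_def using V by (intro closed_Diff) auto
  ultimately have "compact K" by (simp add: compact_eq_bounded_closed)
  moreover have "continuous_on K log_of_triangle"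
  proof -
    have "0 < fst x \<and> 0 < snd x \<and> 0 < 1 - fst x - snd x" if "x \<in> K" for x
    proof -
      have "x \<in> std_triangle" "x \<notin> frontier std_triangle" using that Ktri K by auto
      then have "x \<in> interior std_triangle"
        using closed_triangle by (simp add: frontier_def)
      then show ?thesis using interior_triangle[of 1] by auto
    qed
    then show ?thesis
      unfolding log_of_triangle_def[abs_def] by (intro continuous_intros ballI) fastforce+
  qed
  ultimately have "bounded (log_of_triangle ` K)"
    by (intro compact_imp_bounded compact_continuous_image)
  then obtain R where R: "\<And>x. x \<in> K \<Longrightarrow> norm (log_of_triangle x) \<le> R"
    unfolding bounded_iff by blast
  have "\<forall>\<^sub>F u in at_infinity. u \<in> {u \<in> B. triangle_of_log u \<in> T} \<longrightarrow> triangle_of_log u \<in> V"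
    unfolding eventually_at_infinity
  proof (intro exI[of _ "R + 1"] allI impI)
    fix u :: "real \<times> real" assume u: "R + 1 \<le> norm u" "u \<in> {u \<in> B. triangle_of_log u \<in> T}"
    show "triangle_of_log u \<in> V"
    proof (rule ccontr)
      assume "triangle_of_log u \<notin> V"
      then have "triangle_of_log u \<in> K" using u closure_subset by (auto simp: K_def)
      from R[OF this] u show False by (simp add: log_of_triangle_of_log)
    qed
  qed
  then show "\<forall>\<^sub>F u in inf at_infinity (principal {u \<in> B. triangle_of_log u \<in> T}). triangle_of_log u \<in> V"
    by (simp add: eventually_inf_principal)
qed

lemma tendsto_sgn_asymptotic:
  fixes v w0 :: "'a::real_normed_vector" and t :: "'b \<Rightarrow> real" and w u :: "'b \<Rightarrow> 'a"
  assumes "filterlim t at_top F" "(w \<longlongrightarrow> w0) F" "v \<noteq> 0" and u: "\<And>x. u x = t x *\<^sub>R v + w x"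
  shows "((\<lambda>x. sgn (u x)) \<longlongrightarrow> sgn v) F"
proof -
  have "((\<lambda>x. inverse (t x) *\<^sub>R w x) \<longlongrightarrow> 0 *\<^sub>R w0) F"
    using tendsto_inverse_0_at_top[OF assms(1)] assms(2) by (rule tendsto_scaleR)
  then have "((\<lambda>x. v + inverse (t x) *\<^sub>R w x) \<longlongrightarrow> v + 0 *\<^sub>R w0) F" by (intro tendsto_add tendsto_const)
  then have "((\<lambda>x. sgn (v + inverse (t x) *\<^sub>R w x)) \<longlongrightarrow> sgn v) F"
    using assms(3) by (intro tendsto_sgn) simp_all
  moreover have "\<forall>\<^sub>F x in F. t x > 0" using assms(1) by (rule filterlim_at_top_dense[THEN iffD1, rule_format])
  then have "\<forall>\<^sub>F x in F. sgn (v + inverse (t x) *\<^sub>R w x) = sgn (u x)"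
  proof (rule eventually_mono)
    fix x assume t: "t x > 0"
    then have "u x = t x *\<^sub>R (v + inverse (t x) *\<^sub>R w x)" by (simp add: u scaleR_right_distrib)
    then show "sgn (v + inverse (t x) *\<^sub>R w x) = sgn (u x)"
      using t by (simp only: sgn_scaleR) simp
  qed
  ultimately show ?thesis by (rule tendsto_cong[THEN iffD1, rotated])
qed

definition side_normal :: "nat \<Rightarrow> real \<times> real" where
  "side_normal j = (if j = 0 then (0, -1) else if j = 1 then (-1, 0) else (1, 1))"

lemma outer_normal_side:
  assumes "d > 0" "j < 3" "\<And>x. x \<in> s \<Longrightarrow> snd (side_map j d x) = 0"
  shows "outer_normal (dilate d std_triangle) s (side_normal j)"
proof -
  consider "j = 0" | "j = 1" | "j = 2" using assms(2) by linarith
  then show ?thesis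
    unfolding outer_normal_def dilate_triangle[OF assms(1)] using assms(3)
    by cases (fastforce simp: side_normal_def side_map_def inner_prod_def prod_eq_iff)+
qed

text \<open>Logarithmic coordinates are half differences of logarithms of barycentric coordinates.
  At a point of an open side exactly one of these tends to 0, so \<open>u\<close> is a coefficient
  tending to infinity times the normal, plus a convergent remainder.\<close>

lemma tentacle_asymptotic_direction:
  assumes T: "T \<in> tentacles B \<epsilon>" "\<epsilon> > 0" "T \<inter> frontier std_triangle = {e}" and e: "e \<in> open_side j" "j < 3"
  shows "asymptotic_direction B T (side_normal j)"
proof -
  let ?F = "inf at_infinity (principal {u \<in> B. triangle_of_log u \<in> T})"
  let ?x = "\<lambda>u. fst (triangle_of_log u)" and ?y = "\<lambda>u. snd (triangle_of_log u)"
  let ?z = "\<lambda>u. 1 - fst (triangle_of_log u) - snd (triangle_of_log u)"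
  have lim: "(triangle_of_log \<longlongrightarrow> e) ?F" by (rule tendsto_tentacle_end[OF T])
  have x: "(?x \<longlongrightarrow> fst e) ?F" and y: "(?y \<longlongrightarrow> snd e) ?F" and z: "(?z \<longlongrightarrow> 1 - fst e - snd e) ?F"
    by (intro tendsto_intros lim)+
  have inv: "u = ((ln (?x u) - ln (?z u)) / 2, (ln (?y u) - ln (?z u)) / 2)" for u
    using log_of_triangle_of_log[of u] by (simp add: log_of_triangle_def)
  have lnlim: "((\<lambda>u. (ln (f u) - ln (g u)) / 2) \<longlongrightarrow> (ln a - ln b) / 2) ?F"
    if "(f \<longlongrightarrow> a) ?F" "(g \<longlongrightarrow> b) ?F" "a > 0" "b > 0" for f g :: "real \<times> real \<Rightarrow> real" and a b
    using that by (intro tendsto_intros) auto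
  have lninf: "filterlim (\<lambda>u. (ln (f u) - ln (g u)) / 2) at_top ?F"
    if f: "(f \<longlongrightarrow> a) ?F" "a > 0" and g: "(g \<longlongrightarrow> 0) ?F" "\<And>u. g u > 0" for f g :: "real \<times> real \<Rightarrow> real" and a
  proof -
    have "filterlim g (at_right 0) ?F"
      unfolding filterlim_at using g by (simp add: less_imp_neq[symmetric])
    then have "filterlim (\<lambda>u. ln (g u)) at_bot ?F" by (rule filterlim_compose[OF ln_at_0])
    then have "filterlim (\<lambda>u. - ln (g u)) at_top ?F" by (simp add: filterlim_uminus_at_top)
    then have "filterlim (\<lambda>u. ln (f u) + (- ln (g u))) at_top ?F"
      using f by (intro filterlim_tendsto_add_at_top[of _ "ln a"] tendsto_ln) auto
    then have "filterlim (\<lambda>u. (1 / 2) * (ln (f u) + (- ln (g u)))) at_top ?F"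
      by (intro filterlim_tendsto_pos_mult_at_top[of _ "1/2"]) auto
    moreover have "(\<lambda>u. (1 / 2) * (ln (f u) + (- ln (g u)))) = (\<lambda>u. (ln (f u) - ln (g u)) / 2)"
      by (simp add: fun_eq_iff)
    ultimately show ?thesis by (simp only:)
  qed
  have "((\<lambda>u. sgn u) \<longlongrightarrow> sgn (side_normal j)) ?F"
  proof -
    consider "j = 0" | "j = 1" | "j = 2" using e(2) by linarith
    then show ?thesis
    proof cases
      case 1
      then have e': "0 < fst e" "fst e < 1" "snd e = 0" using e(1) by (auto simp: open_side_iff side_map_def)
      show ?thesis
      proof (rule tendsto_sgn_asymptotic[where u = "\<lambda>u. u" and t = "\<lambda>u. (ln (?z u) - ln (?y u)) / 2" and w = "\<lambda>u. ((ln (?x u) - ln (?z u)) / 2, 0)"])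
        show "filterlim (\<lambda>u. (ln (?z u) - ln (?y u)) / 2) at_top ?F"
          using y z e' triangle_of_log_pos by (intro lninf[of _ "1 - fst e"]) auto
        show "((\<lambda>u. ((ln (?x u) - ln (?z u)) / 2, 0)) \<longlongrightarrow> ((ln (fst e) - ln (1 - fst e - snd e)) / 2, 0)) ?F"
          using x z e' by (intro tendsto_Pair lnlim tendsto_const) auto
        show "u = ((ln (?z u) - ln (?y u)) / 2) *\<^sub>R side_normal j + ((ln (?x u) - ln (?z u)) / 2, 0)" for u
          by (subst inv) (simp add: side_normal_def 1 field_simps)
      qed (simp add: side_normal_def 1 prod_eq_iff)
    next
      case 2
      then have e': "0 < snd e" "snd e < 1" "fst e = 0" using e(1) by (auto simp: open_side_iff side_map_def)
      show ?thesis
      proof (rule tendsto_sgn_asymptotic[where u = "\<lambda>u. u" and t = "\<lambda>u. (ln (?z u) - ln (?x u)) / 2" and w = "\<lambda>u. (0, (ln (?y u) - ln (?z u)) / 2)"])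
        show "filterlim (\<lambda>u. (ln (?z u) - ln (?x u)) / 2) at_top ?F"
          using x z e' triangle_of_log_pos by (intro lninf[of _ "1 - snd e"]) auto
        show "((\<lambda>u. (0, (ln (?y u) - ln (?z u)) / 2)) \<longlongrightarrow> (0, (ln (snd e) - ln (1 - fst e - snd e)) / 2)) ?F"
          using y z e' by (intro tendsto_Pair lnlim tendsto_const) auto
        show "u = ((ln (?z u) - ln (?x u)) / 2) *\<^sub>R side_normal j + (0, (ln (?y u) - ln (?z u)) / 2)" for u
          by (subst inv) (simp add: side_normal_def 2 field_simps)
      qed (simp add: side_normal_def 2 prod_eq_iff)
    next
      case 3
      then have e': "0 < fst e" "fst e < 1" "1 - fst e - snd e = 0" using e(1) by (auto simp: open_side_iff side_map_def)
      show ?thesis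
      \<comment> \<open>The third barycentric coordinate tends to 0 and enters both components
        alike, which gives the normal (1, 1); the remainder compares the other two.\<close>
      proof (rule tendsto_sgn_asymptotic[where u = "\<lambda>u. u" and t = "\<lambda>u. (ln (?x u) - ln (?z u)) / 2" and w = "\<lambda>u. (0, (ln (?y u) - ln (?x u)) / 2)"])
        show "filterlim (\<lambda>u. (ln (?x u) - ln (?z u)) / 2) at_top ?F"
          using x z e' triangle_of_log_pos by (intro lninf[of _ "fst e"]) auto
        show "((\<lambda>u. (0, (ln (?y u) - ln (?x u)) / 2)) \<longlongrightarrow> (0, (ln (snd e) - ln (fst e)) / 2)) ?F"
          using y x e' by (intro tendsto_Pair lnlim tendsto_const) auto
        show "u = ((ln (?x u) - ln (?z u)) / 2) *\<^sub>R side_normal j + (0, (ln (?y u) - ln (?x u)) / 2)" for u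
          by (subst inv) (simp add: side_normal_def 3 field_simps)
      qed (simp add: side_normal_def 3 prod_eq_iff)
    qed
  qed
  then show ?thesis by (simp add: asymptotic_direction_def)
qed

section \<open>Faces of the polytope on the sides of the triangle\<close>

definition side :: "nat \<Rightarrow> nat \<Rightarrow> (real \<times> real) set" where
  "side d j = {x \<in> dilate (real d) std_triangle. snd (side_map j (real d) x) = 0}"

definition axis_segment :: "real \<Rightarrow> real \<Rightarrow> (real \<times> real) set" where
  "axis_segment a b = {a..b} \<times> {0}"

lemma axis_segment_eq: "a \<le> b \<Longrightarrow> axis_segment a b = closed_segment (a, 0) (b, 0)"
proof -
  assume "a \<le> b"
  then have "closed_segment a b = {a..b}" by (simp add: closed_segment_eq_real_ivl)
  moreover have "closed_segment (a, 0) (b, 0) = closed_segment a b \<times> {0::real}"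
    by (auto simp: closed_segment_def)
  ultimately show ?thesis by (simp add: axis_segment_def)
qed

lemma axis_segment_interior:
  fixes a b :: real
  assumes "a < b"
  shows "closed_segment (a, 0) (b, 0) - {(a, 0), (b, 0)} = {a<..<b} \<times> {0::real}"
  unfolding axis_segment_eq[OF less_imp_le[OF assms], symmetric] axis_segment_def
  using assms by auto

lemma side_map_lattice: "side_map j (real d) x \<in> lattice \<longleftrightarrow> x \<in> lattice"
proof -
  have "side_map j (real d) x \<in> lattice" if "x \<in> lattice" for x
    using that by (auto simp: side_map_def lattice_def)
  then show ?thesis by (metis side_map_involution)
qed

lemma lattice_segments_side_map:
  "lattice_segments (side_map j (real d) ` X) = (`) (side_map j (real d)) ` lattice_segments X"
proof -
  let ?f = "side_map j (real d)"
  have sub: "?f ` s \<in> lattice_segments (?f ` X)" if s: "s \<in> lattice_segments X" for s X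
  proof -
    obtain u v where uv: "s = closed_segment u v" "u \<in> lattice" "v \<in> lattice" "u \<noteq> v"
      "closed_segment u v \<inter> lattice = {u, v}" "closed_segment u v \<subseteq> X"
      using s unfolding lattice_segments_def by blast
    have "closed_segment (?f u) (?f v) \<inter> lattice = ?f ` (closed_segment u v \<inter> lattice)"
      unfolding side_map_closed_segment[symmetric]
      by (auto simp: image_side_map_iff side_map_lattice)
    also have "\<dots> = {?f u, ?f v}" using uv(5) by simp
    finally have "closed_segment (?f u) (?f v) \<inter> lattice = {?f u, ?f v}" .
    moreover have "?f u \<noteq> ?f v" using uv(4) inj_side_map[of j d] by (simp add: inj_eq)
    moreover have "closed_segment (?f u) (?f v) \<subseteq> ?f ` X"
      using uv(6) unfolding side_map_closed_segment[symmetric] by (rule image_mono)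
    ultimately show ?thesis
      unfolding lattice_segments_def using uv(1-3)
      by (intro CollectI exI[of _ "?f u"] exI[of _ "?f v"]) (simp add: side_map_closed_segment side_map_lattice)
  qed
  show ?thesis
  proof (intro set_eqI iffI)
    fix s assume "s \<in> lattice_segments (?f ` X)"
    from sub[OF this] have "?f ` s \<in> lattice_segments X" by (simp add: image_image)
    moreover have "s = ?f ` ?f ` s" by (simp add: image_image)
    ultimately show "s \<in> (`) ?f ` lattice_segments X" by (rule rev_image_eqI)
  next
    fix s assume "s \<in> (`) ?f ` lattice_segments X"
    then show "s \<in> lattice_segments (?f ` X)" using sub by blast
  qed
qed

lemma lattice_segments_axis:
  "lattice_segments (axis_segment (real a) (real b)) = (\<lambda>i. axis_segment (real i) (real (Suc i))) ` {a..<b}"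
proof (intro set_eqI iffI)
  fix s assume "s \<in> lattice_segments (axis_segment (real a) (real b))"
  then obtain u v where uv: "s = closed_segment u v" "u \<in> lattice" "v \<in> lattice" "u \<noteq> v"
      "closed_segment u v \<inter> lattice = {u, v}" "closed_segment u v \<subseteq> axis_segment (real a) (real b)"
    unfolding lattice_segments_def by blast
  have key: "closed_segment u v \<in> (\<lambda>i. axis_segment (real i) (real (Suc i))) ` {a..<b}"
    if uv: "u \<in> lattice" "v \<in> lattice" "fst u < fst v" "closed_segment u v \<inter> lattice = {u, v}"
      "closed_segment u v \<subseteq> axis_segment (real a) (real b)" for u v
  proof -
    have "u \<in> axis_segment (real a) (real b)" "v \<in> axis_segment (real a) (real b)" using uv(5) by auto
    then have 0: "u = (fst u, 0)" "v = (fst v, 0)" "real a \<le> fst u" "fst v \<le> real b"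
      by (auto simp: axis_segment_def)
    obtain m n :: int where mn: "fst u = of_int m" "fst v = of_int n"
      using uv(1,2) by (auto simp: lattice_def elim!: Ints_cases)
    have "m < n" using uv(3) by (simp add: mn)
    then have le: "of_int m + 1 \<le> (of_int n :: real)" by linarith
    have seg: "closed_segment u v = axis_segment (fst u) (fst v)"
      using uv(3) 0(1,2) axis_segment_eq[of "fst u" "fst v"] by simp
    \<comment> \<open>The next lattice point after \<open>u\<close> lies on the segment, so it must
      be the other end.\<close>
    have "(of_int m + 1, 0) \<in> closed_segment u v \<inter> lattice"
      using le unfolding seg by (auto simp: axis_segment_def lattice_def mn)
    then have "(of_int m + 1, 0) = u \<or> (of_int m + 1, 0) = v" unfolding uv(4) by blast
    then have v: "fst v = fst u + 1" using mn by auto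
    have "m \<ge> 0" using 0(3) by (simp add: mn)
    then obtain i where i: "m = int i" using nonneg_int_cases by blast
    have "i \<in> {a..<b}" using 0(3,4) v by (simp add: mn(1) i)
    then show ?thesis unfolding seg using v by (intro image_eqI[of _ _ i]) (simp_all add: mn(1) i add.commute)
  qed
  have "u \<in> axis_segment (real a) (real b)" "v \<in> axis_segment (real a) (real b)" using uv(6) by auto
  then have "fst u \<noteq> fst v" using uv(4) by (auto simp: axis_segment_def)
  then consider "fst u < fst v" | "fst v < fst u" by linarith
  then show "s \<in> (\<lambda>i. axis_segment (real i) (real (Suc i))) ` {a..<b}"
  proof cases
    case 1
    then show ?thesis using key[OF uv(2,3)] uv by simp
  next
    case 2
    then show ?thesis using key[OF uv(3,2)] uv by (simp add: closed_segment_commute insert_commute)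
  qed
next
  fix s assume "s \<in> (\<lambda>i. axis_segment (real i) (real (Suc i))) ` {a..<b}"
  then obtain i where i: "i \<in> {a..<b}" "s = axis_segment (real i) (real (Suc i))" by blast
  have s: "s = closed_segment (real i, 0) (real (Suc i), 0)" unfolding i(2) by (rule axis_segment_eq) simp
  have "s \<inter> lattice = {(real i, 0), (real (Suc i), 0)}"
  proof (intro set_eqI iffI)
    fix x assume x: "x \<in> s \<inter> lattice"
    then obtain n :: int where n: "fst x = of_int n" by (auto simp: lattice_def elim!: Ints_cases)
    have "real i \<le> of_int n" "of_int n \<le> real (Suc i)" "snd x = 0"
      using x by (auto simp: i(2) axis_segment_def n[symmetric])
    then have "n = int i \<or> n = int (Suc i)" by linarith
    then show "x \<in> {(real i, 0), (real (Suc i), 0)}"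
      using n \<open>snd x = 0\<close> by (cases x) auto
  next
    fix x :: "real \<times> real" assume "x \<in> {(real i, 0), (real (Suc i), 0)}"
    then show "x \<in> s \<inter> lattice" unfolding i(2) by (auto simp: axis_segment_def lattice_def)
  qed
  moreover have "s \<subseteq> axis_segment (real a) (real b)"
    using i by (auto simp: axis_segment_def)
  ultimately show "s \<in> lattice_segments (axis_segment (real a) (real b))"
    unfolding lattice_segments_def s
    by (intro CollectI exI[of _ "(real i, 0)"] exI[of _ "(real (Suc i), 0)"] conjI refl)
      (simp_all add: lattice_def del: of_nat_Suc)
qed

lemma side_coordinate_affine:
  "snd (side_map j d (midpoint u v)) = (snd (side_map j d u) + snd (side_map j d v)) / 2"
  by (auto simp: side_map_def midpoint_def field_simps)

lemma side_coordinate_nonneg: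
  assumes "d > 0" "x \<in> dilate d std_triangle"
  shows "0 \<le> snd (side_map j d x)"
  using side_map_triangle[OF assms(1), of j x] assms(2) unfolding dilate_triangle[OF assms(1)] by blast

lemma ext_boundary_eq:
  assumes "d > 0" "Q \<subseteq> dilate (real d) std_triangle"
  shows "ext_boundary d Q = (\<Union>j<3. Q \<inter> side d j)"
  using frontier_triangle[of "real d"] assms by (auto simp: ext_boundary_def side_def)

text \<open>A segment in the boundary lies in the side containing its midpoint, since the barycentric
  coordinate of that side is affine and nonnegative.\<close>

lemma lattice_segments_ext_boundary:
  assumes "d > 0" "Q \<subseteq> dilate (real d) std_triangle"
  shows "lattice_segments (ext_boundary d Q) = (\<Union>j<3. lattice_segments (Q \<inter> side d j))"
proof (intro set_eqI iffI)
  fix s assume "s \<in> lattice_segments (ext_boundary d Q)"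
  then obtain u v where uv: "s = closed_segment u v" "u \<in> lattice" "v \<in> lattice" "u \<noteq> v"
      "closed_segment u v \<inter> lattice = {u, v}" "closed_segment u v \<subseteq> ext_boundary d Q"
    unfolding lattice_segments_def by blast
  have d: "real d > 0" using assms by simp
  have sub: "closed_segment u v \<subseteq> Q" "closed_segment u v \<subseteq> dilate (real d) std_triangle"
    using uv(6) assms(2) by (auto simp: ext_boundary_def)
  have "midpoint u v \<in> ext_boundary d Q" using uv(6) by auto
  then obtain j where j: "j < 3" "snd (side_map j (real d) (midpoint u v)) = 0"
    unfolding ext_boundary_eq[OF assms] by (auto simp: side_def)
  have "u \<in> dilate (real d) std_triangle" "v \<in> dilate (real d) std_triangle" using sub(2) by auto
  then have nn: "0 \<le> snd (side_map j (real d) u)" "0 \<le> snd (side_map j (real d) v)"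
    using side_coordinate_nonneg[OF d] by blast+
  have sum0: "(snd (side_map j (real d) u) + snd (side_map j (real d) v)) / 2 = 0"
    using j(2) unfolding side_coordinate_affine .
  have "x = 0 \<and> y = 0" if "0 \<le> x" "0 \<le> y" "(x + y) / 2 = 0" for x y :: real
    using that by (simp add: add_nonneg_eq_0_iff)
  from this[OF nn sum0] have z: "snd (side_map j (real d) u) = 0" "snd (side_map j (real d) v) = 0" by blast+
  have "snd (side_map j (real d) x) = 0" if "x \<in> closed_segment u v" for x
  proof -
    have "side_map j (real d) x \<in> closed_segment (side_map j (real d) u) (side_map j (real d) v)"
      using that unfolding side_map_closed_segment[symmetric] by (rule imageI)
    then show ?thesis using z by (auto simp: closed_segment_def)
  qed
  then have "closed_segment u v \<subseteq> Q \<inter> side d j" using sub unfolding side_def by blast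
  then have "s \<in> lattice_segments (Q \<inter> side d j)"
    unfolding lattice_segments_def using uv by blast
  then show "s \<in> (\<Union>j<3. lattice_segments (Q \<inter> side d j))" using j(1) by blast
next
  fix s assume "s \<in> (\<Union>j<3. lattice_segments (Q \<inter> side d j))"
  then obtain j where "j < 3" "s \<in> lattice_segments (Q \<inter> side d j)" by blast
  then show "s \<in> lattice_segments (ext_boundary d Q)"
    unfolding ext_boundary_eq[OF assms] lattice_segments_def by blast
qed

text \<open>Two sides share at most a vertex, while a lattice segment has two distinct ends.\<close>

lemma lattice_segments_sides_disjoint:
  assumes "d > 0" "i < 3" "j < 3" "i \<noteq> j"
  shows "lattice_segments (Q \<inter> side d i) \<inter> lattice_segments (Q \<inter> side d j) = {}"
proof (rule ccontr)
  assume "lattice_segments (Q \<inter> side d i) \<inter> lattice_segments (Q \<inter> side d j) \<noteq> {}"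
  then obtain s where s: "s \<in> lattice_segments (Q \<inter> side d i)" "s \<in> lattice_segments (Q \<inter> side d j)" by blast
  then have ss: "s \<subseteq> side d i \<inter> side d j" unfolding lattice_segments_def by blast
  obtain u v where "u \<in> s" "v \<in> s" "u \<noteq> v"
    using s(1) unfolding lattice_segments_def by (auto intro: ends_in_segment)
  moreover have "x = y" if "x \<in> side d i \<inter> side d j" "y \<in> side d i \<inter> side d j" for x y
  proof -
    have "i \<in> {0, 1, 2}" "j \<in> {0, 1, 2}" using assms(2,3) by auto
    then show ?thesis using that assms(4) by (auto simp: side_def side_map_def prod_eq_iff)
  qed
  ultimately show False using ss by blast
qed

definition side_bound :: "nat \<Rightarrow> nat \<Rightarrow> real" where
  "side_bound d j = (if j = 2 then real d else 0)"

lemma side_hyperplane: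
  assumes "j < 3"
  shows "snd (side_map j (real d) x) = side_bound d j - side_normal j \<bullet> x"
proof -
  have "j \<in> {0, 1, 2}" using assms by auto
  then show ?thesis by (auto simp: side_map_def side_bound_def side_normal_def inner_prod_def)
qed

lemma side_normal_nonzero: "side_normal j \<noteq> 0"
  by (simp add: side_normal_def prod_eq_iff)

lemma aff_dim_side_le:
  assumes "j < 3"
  shows "aff_dim (Q \<inter> side d j) \<le> 1"
proof -
  have "Q \<inter> side d j \<subseteq> {x. side_normal j \<bullet> x = side_bound d j}"
    using side_hyperplane[OF assms, of d] by (auto simp: side_def)
  then have "aff_dim (Q \<inter> side d j) \<le> aff_dim {x. side_normal j \<bullet> x = side_bound d j}"
    by (rule aff_dim_subset)
  also have "\<dots> = 1" using aff_dim_hyperplane[OF side_normal_nonzero, of j "side_bound d j"] by simp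
  finally show ?thesis .
qed

lemma lattice_segments_side_empty:
  assumes "j < 3" "aff_dim (Q \<inter> side d j) \<noteq> 1"
  shows "lattice_segments (Q \<inter> side d j) = {}"
proof (rule ccontr)
  assume "lattice_segments (Q \<inter> side d j) \<noteq> {}"
  then obtain u v where "u \<noteq> v" "closed_segment u v \<subseteq> Q \<inter> side d j"
    unfolding lattice_segments_def by blast
  then have "aff_dim {u, v} \<le> aff_dim (Q \<inter> side d j)" by (intro aff_dim_subset) auto
  then have "1 \<le> aff_dim (Q \<inter> side d j)" using \<open>u \<noteq> v\<close> by (simp add: aff_dim_2)
  then show False using aff_dim_side_le[OF assms(1), of Q d] assms(2) by linarith
qed

text \<open>The side lies on a supporting line, so it cuts out a face, and a face is the hull of
  some of the generating lattice points. In side coordinates it is an interval whose ends are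
  extreme generators, hence integers.\<close>

lemma polytope_side:
  assumes p: "p > 0" and P: "convex_integral_polytope P" "P \<subseteq> dilate (real p) std_triangle"
    and j: "j < 3" "aff_dim (P \<inter> side p j) = 1"
  shows "\<exists>a b. a < b \<and> b \<le> p \<and> P \<inter> side p j = side_map j (real p) ` axis_segment (real a) (real b)"
proof -
  let ?f = "side_map j (real p)"
  have rp: "real p > 0" using p by simp
  obtain S where S: "finite S" "S \<subseteq> lattice" "P = convex hull S"
    using P(1) unfolding convex_integral_polytope_def by blast
  have inP: "side_normal j \<bullet> x \<le> side_bound p j" if "x \<in> P" for x
    using side_coordinate_nonneg[OF rp, of x j] P(2) that side_hyperplane[OF j(1), of p x] by auto
  have eq: "P \<inter> side p j = P \<inter> {x. side_normal j \<bullet> x = side_bound p j}"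
    using P(2) side_hyperplane[OF j(1), of p] by (auto simp: side_def)
  have "(P \<inter> {x. side_normal j \<bullet> x = side_bound p j}) face_of P"
    using inP S(3) by (intro face_of_Int_supporting_hyperplane_le) (auto simp: convex_convex_hull)
  then have "P \<inter> side p j face_of (convex hull S)" unfolding eq using S(3) by simp
  then obtain S' where S': "S' \<subseteq> S" "P \<inter> side p j = convex hull S'"
    by (rule face_of_convex_hull_subset[OF finite_imp_compact[OF S(1)]])
  have fS': "finite S'" using S' S(1) finite_subset by blast
  have ne: "S' \<noteq> {}" using j(2) S'(2) by auto
  define X where "X = (\<lambda>x. fst (?f x)) ` S'"
  have X: "finite X" "X \<noteq> {}" using fS' ne by (auto simp: X_def)
  have on: "snd (?f x) = 0 \<and> fst (?f x) \<in> \<int> \<and> 0 \<le> fst (?f x) \<and> fst (?f x) \<le> real p" if "x \<in> S'" for x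
  proof -
    have x: "x \<in> side p j" using that S'(2) hull_subset[of S' convex] by blast
    have "x \<in> lattice" using that S'(1) S(2) by blast
    then have "?f x \<in> lattice" by (simp add: side_map_lattice)
    moreover have "?f x \<in> dilate (real p) std_triangle"
      using x side_map_triangle[OF rp] by (simp add: side_def)
    moreover have "snd (?f x) = 0" using x by (simp add: side_def)
    ultimately show ?thesis unfolding dilate_triangle[OF rp] by (auto simp: lattice_def mem_Times_iff)
  qed
  obtain u where u: "u \<in> S'" "fst (?f u) = Min X" using Min_in[OF X] by (auto simp: X_def)
  obtain v where v: "v \<in> S'" "fst (?f v) = Max X" using Max_in[OF X] by (auto simp: X_def)
  have range: "fst (?f x) \<in> {Min X..Max X}" if "x \<in> S'" for x
    using that X(1) by (auto simp: X_def)
  have le: "Min X \<le> Max X" using X by (simp add: Min_le)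
  have "?f u = (Min X, 0)" "?f v = (Max X, 0)"
    using on[OF u(1)] on[OF v(1)] u(2) v(2) by (simp_all add: prod_eq_iff)
  then have ends: "?f (Min X, 0) = u" "?f (Max X, 0) = v"
    using side_map_involution[of j "real p" u] side_map_involution[of j "real p" v] by simp_all
  have seg: "?f ` axis_segment (Min X) (Max X) = closed_segment u v"
    by (simp only: axis_segment_eq[OF le] side_map_closed_segment ends)
  have hull: "convex hull S' = ?f ` axis_segment (Min X) (Max X)"
  proof
    show "convex hull S' \<subseteq> ?f ` axis_segment (Min X) (Max X)"
    proof (rule hull_minimal)
      show "S' \<subseteq> ?f ` axis_segment (Min X) (Max X)"
        using on range by (auto simp: image_side_map_iff axis_segment_def mem_Times_iff)
      show "convex (?f ` axis_segment (Min X) (Max X))" unfolding seg by (rule convex_closed_segment)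
    qed
    show "?f ` axis_segment (Min X) (Max X) \<subseteq> convex hull S'"
      unfolding seg segment_convex_hull using u(1) v(1) by (intro hull_mono) auto
  qed
  \<comment> \<open>A single point would have affine dimension 0.\<close>
  have "Min X \<noteq> Max X"
  proof
    assume "Min X = Max X"
    then have "P \<inter> side p j = {u}" using S'(2) hull seg ends by simp
    then show False using j(2) by simp
  qed
  moreover obtain m n :: int where mn: "Min X = of_int m" "Max X = of_int n"
    using on[OF u(1)] on[OF v(1)] u(2) v(2) by (auto elim!: Ints_cases)
  moreover have "0 \<le> m" "n \<le> int p" using on[OF u(1)] on[OF v(1)] u(2) v(2) mn by auto
  ultimately have "nat m < nat n" "nat n \<le> p" "Min X = real (nat m)" "Max X = real (nat n)"
    using le by auto
  then show ?thesis using S'(2) hull by (intro exI[of _ "nat m"] exI[of _ "nat n"]) simp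
qed

lemma inj_side_map_axis_segments:
  "inj_on (\<lambda>i. side_map j d ` axis_segment (real i) (real (Suc i))) A"
proof (rule inj_onI)
  fix i k assume "side_map j d ` axis_segment (real i) (real (Suc i)) = side_map j d ` axis_segment (real k) (real (Suc k))"
  then have "axis_segment (real i) (real (Suc i)) = axis_segment (real k) (real (Suc k))"
    by (simp add: inj_image_eq_iff[OF inj_side_map])
  moreover have "(real i, 0) \<in> axis_segment (real i) (real (Suc i))" "(real k, 0) \<in> axis_segment (real k) (real (Suc k))"
    by (simp_all add: axis_segment_def)
  ultimately have "(real i, 0) \<in> axis_segment (real k) (real (Suc k))" "(real k, 0) \<in> axis_segment (real i) (real (Suc i))"
    by blast+
  then show "i = k" by (simp add: axis_segment_def)
qed

lemma lattice_length_ext_boundary: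
  assumes p: "p > 0" "P \<subseteq> dilate (real p) std_triangle"
    and J: "J = {j. j < 3 \<and> aff_dim (P \<inter> side p j) = 1}"
    and ab: "\<And>j. j \<in> J \<Longrightarrow> P \<inter> side p j = side_map j (real p) ` axis_segment (real (a j)) (real (b j))"
  shows "lattice_length (ext_boundary p P) = (\<Sum>j\<in>J. b j - a j)"
proof -
  have seg: "lattice_segments (P \<inter> side p j)
      = (\<lambda>i. side_map j (real p) ` axis_segment (real i) (real (Suc i))) ` {a j..<b j}" if "j \<in> J" for j
    by (simp only: ab[OF that] lattice_segments_side_map lattice_segments_axis image_image)
  have "lattice_segments (ext_boundary p P) = (\<Union>j\<in>J. lattice_segments (P \<inter> side p j))"
  proof (intro equalityI subsetI)
    fix s assume "s \<in> lattice_segments (ext_boundary p P)"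
    then obtain j where j: "j < 3" "s \<in> lattice_segments (P \<inter> side p j)"
      unfolding lattice_segments_ext_boundary[OF p] by blast
    then have "j \<in> J" unfolding J using lattice_segments_side_empty[OF j(1), of P p] by blast
    with j(2) show "s \<in> (\<Union>j\<in>J. lattice_segments (P \<inter> side p j))" by blast
  next
    fix s assume "s \<in> (\<Union>j\<in>J. lattice_segments (P \<inter> side p j))"
    then show "s \<in> lattice_segments (ext_boundary p P)"
      unfolding lattice_segments_ext_boundary[OF p] J by blast
  qed
  then have "lattice_length (ext_boundary p P) = card (\<Union>j\<in>J. lattice_segments (P \<inter> side p j))"
    by (simp add: lattice_length_def)
  also have "\<dots> = (\<Sum>j\<in>J. card (lattice_segments (P \<inter> side p j)))"
  proof (rule card_UN_disjoint)
    show "finite J" by (rule finite_subset[of _ "{..<3}"]) (auto simp: J)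
    show "\<forall>j\<in>J. finite (lattice_segments (P \<inter> side p j))" by (simp add: seg)
    show "\<forall>i\<in>J. \<forall>j\<in>J. i \<noteq> j \<longrightarrow> lattice_segments (P \<inter> side p i) \<inter> lattice_segments (P \<inter> side p j) = {}"
      using lattice_segments_sides_disjoint[OF p(1)] by (simp add: J)
  qed
  also have "\<dots> = (\<Sum>j\<in>J. b j - a j)"
    by (intro sum.cong refl) (simp only: seg card_image[OF inj_side_map_axis_segments] card_atLeastLessThan)
  finally show ?thesis .
qed

lemma allowed_boundary_eq:
  assumes p: "p > 0"
    and J: "J = {j. j < 3 \<and> aff_dim (P \<inter> side p j) = 1}"
    and ab: "\<And>j. j \<in> J \<Longrightarrow> a j < b j"
      "\<And>j. j \<in> J \<Longrightarrow> P \<inter> side p j = side_map j (real p) ` axis_segment (real (a j)) (real (b j))"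
  shows "allowed_boundary p P
    = (\<Union>j\<in>J. side_map j 1 ` ({real (a j) / real p<..<real (b j) / real p} \<times> {0}))"
proof -
  have "side p = (\<lambda>j. {x \<in> dilate (real p) std_triangle. snd (side_map j (real p) x) = 0})"
    by (rule ext) (simp only: side_def)
  then have sides: "closed_sides p = side p ` {..<3}" by (simp only: closed_sides_eq)
  have ri: "rel_interior (dilate (1 / real p) (P \<inter> side p j))
      = side_map j 1 ` ({real (a j) / real p<..<real (b j) / real p} \<times> {0})" if j: "j \<in> J" for j
  proof -
    let ?a = "real (a j) / real p" and ?b = "real (b j) / real p"
    have ab': "?a < ?b" using ab(1)[OF j] p by (simp add: divide_strict_right_mono)
    have "dilate (1 / real p) (P \<inter> side p j) = (\<lambda>x. side_map j 1 ((1 / real p) *\<^sub>R x)) ` axis_segment (real (a j)) (real (b j))"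
      using p by (simp add: ab(2)[OF j] image_image side_map_scaleR)
    also have "\<dots> = side_map j 1 ` dilate (1 / real p) (closed_segment (real (a j), 0) (real (b j), 0))"
      using ab(1)[OF j] by (simp add: axis_segment_eq image_image)
    also have "dilate (1 / real p) (closed_segment (real (a j), 0) (real (b j), 0)) = closed_segment (?a, 0) (?b, 0)"
      by (subst closed_segment_linear_image[symmetric]) (auto intro: linear_scaleR)
    also have "side_map j 1 ` closed_segment (?a, 0) (?b, 0) = closed_segment (side_map j 1 (?a, 0)) (side_map j 1 (?b, 0))"
      by (rule side_map_closed_segment)
    finally have "rel_interior (dilate (1 / real p) (P \<inter> side p j))
        = rel_interior (closed_segment (side_map j 1 (?a, 0)) (side_map j 1 (?b, 0)))" by simp
    also have "\<dots> = open_segment (side_map j 1 (?a, 0)) (side_map j 1 (?b, 0))"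
    proof -
      have "(?a, 0::real) \<noteq> (?b, 0)" using ab' by (auto simp only: prod.inject)
      then have "side_map j 1 (?a, 0) \<noteq> side_map j 1 (?b, 0)" by (simp only: inj_eq[OF inj_side_map] not_False_eq_True)
      then show ?thesis by (simp add: rel_interior_closed_segment)
    qed
    also have "\<dots> = side_map j 1 ` (closed_segment (?a, 0) (?b, 0) - {(?a, 0), (?b, 0)})"
      by (simp only: open_segment_def side_map_closed_segment[symmetric] image_set_diff[OF inj_side_map] image_insert image_empty)
    also have "closed_segment (?a, 0) (?b, 0) - {(?a, 0), (?b, 0)} = {?a<..<?b} \<times> {0::real}"
      by (rule axis_segment_interior[OF ab'])
    finally show ?thesis .
  qed
  have "{F \<in> closed_sides p. aff_dim (P \<inter> F) = 1} = side p ` J"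
    unfolding sides J by auto
  then show ?thesis unfolding allowed_boundary_def using ri by simp
qed

section \<open>Edge polynomials of the random polynomial\<close>

text \<open>In a complete measure space a function that agrees almost everywhere with a measurable
  one is measurable. This is how the tentacle count becomes a random variable.\<close>

lemma AE_eq_completion_integral:
  fixes g h :: "'a \<Rightarrow> real"
  assumes h: "h \<in> borel_measurable M" and ae: "AE x in M. g x = h x"
  shows "integral\<^sup>L (completion M) g = integral\<^sup>L M h"
proof -
  have h': "h \<in> borel_measurable (completion M)" using h by (rule measurable_completion)
  have ae': "AE x in completion M. g x = h x" using ae by (rule AE_completion)
  have "g \<in> borel_measurable (completion M)"
  proof (rule measurableI)
    fix S :: "real set" assume "S \<in> sets borel"
    then have m: "h -` S \<inter> space (completion M) \<in> sets (completion M)" by (rule measurable_sets[OF h'])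
    have "AE x in completion M. x \<in> h -` S \<inter> space (completion M) \<longleftrightarrow> x \<in> g -` S \<inter> space (completion M)"
      using ae' by (rule eventually_mono) (simp only: Int_iff vimage_eq)
    then show "g -` S \<inter> space (completion M) \<in> sets (completion M)"
      by (rule completion.in_sets_AE[OF _ m]) (rule Int_lower2)
  qed simp
  then have "integral\<^sup>L (completion M) g = integral\<^sup>L (completion M) h"
    using h' ae' by (rule integral_cong_AE)
  also have "\<dots> = integral\<^sup>L M h" using h by (rule integral_completion)
  finally show ?thesis .
qed

definition edge_exponent :: "nat \<Rightarrow> nat \<Rightarrow> nat \<Rightarrow> nat \<times> nat" where
  "edge_exponent j d i = (if j = 0 then (i, 0) else if j = 1 then (0, i) else (i, d - i))"

definition along_side :: "nat \<Rightarrow> nat \<times> nat \<Rightarrow> nat" where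
  "along_side j \<alpha> = (if j = 1 then snd \<alpha> else fst \<alpha>)"

text \<open>With \<open>along_side\<close>, this is \<open>side_map\<close> on exponents. The
  truncated subtraction is exact because exponents have sum at most \<open>d\<close>.\<close>

definition off_side :: "nat \<Rightarrow> nat \<Rightarrow> nat \<times> nat \<Rightarrow> nat" where
  "off_side j d \<alpha> = (if j = 0 then snd \<alpha> else if j = 1 then fst \<alpha> else d - (fst \<alpha> + snd \<alpha>))"

lemma exponents_le:
  assumes "d > 0" "Q \<subseteq> dilate (real d) std_triangle" "\<alpha> \<in> exponents Q"
  shows "fst \<alpha> + snd \<alpha> \<le> d"
proof -
  have "(real (fst \<alpha>), real (snd \<alpha>)) \<in> dilate (real d) std_triangle"
    using assms(2,3) by (auto simp: exponents_def)
  then have "real (fst \<alpha>) + real (snd \<alpha>) \<le> real d"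
    using assms(1) dilate_triangle[of "real d"] by simp
  then show ?thesis by linarith
qed

lemma finite_exponents:
  assumes "d > 0" "Q \<subseteq> dilate (real d) std_triangle"
  shows "finite (exponents Q)"
proof (rule finite_subset)
  show "exponents Q \<subseteq> {..d} \<times> {..d}"
    using exponents_le[OF assms] by (auto simp: mem_Times_iff) (meson add_leD1 add_leD2 le_trans)+
qed simp

lemma side_map_exponent:
  assumes "fst \<alpha> + snd \<alpha> \<le> d"
  shows "side_map j (real d) (real (fst \<alpha>), real (snd \<alpha>)) = (real (along_side j \<alpha>), real (off_side j d \<alpha>))"
  using assms by (auto simp: side_map_def along_side_def off_side_def of_nat_diff)

text \<open>For the diagonal side this is homogenization: multiplying by t^d, which is nonzero on
  the torus, clears the denominators and leaves \<open>t\<close> with the exponent d -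
  |\<alpha>|.\<close>

lemma random_poly_torus_map:
  assumes "d > 0" "Q \<subseteq> dilate (real d) std_triangle" and z: "z \<in> torus"
  shows "random_poly d Q c (torus_map j z) = 0 \<longleftrightarrow>
    (\<Sum>\<alpha>\<in>exponents Q. (c \<alpha> / of_real (monom_norm d \<alpha>)) * (fst z ^ along_side j \<alpha> * snd z ^ off_side j d \<alpha>)) = 0"
proof -
  obtain w t where wt: "z = (w, t)" by (cases z)
  have t: "t \<noteq> 0" using z by (auto simp: wt torus_def)
  define u where "u = (if j = 0 \<or> j = 1 then 1 else t ^ d)"
  have u: "u \<noteq> 0" using t by (simp add: u_def)
  have mono: "u * (fst (torus_map j z) ^ fst \<alpha> * snd (torus_map j z) ^ snd \<alpha>) = w ^ along_side j \<alpha> * t ^ off_side j d \<alpha>"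
    if "\<alpha> \<in> exponents Q" for \<alpha>
  proof (cases "j = 0 \<or> j = 1")
    case True
    then show ?thesis
      by (elim disjE) (simp_all add: u_def torus_map_def along_side_def off_side_def wt mult.commute[of "t ^ _"])
  next
    case False
    have cancel: "(Z * (X * Y)) * (W / X * (1 / Y)) = W * Z" if "X \<noteq> 0" "Y \<noteq> 0" for X Y Z W :: complex
      using that by simp
    have "d = (d - (fst \<alpha> + snd \<alpha>)) + (fst \<alpha> + snd \<alpha>)"
      using exponents_le[OF assms(1,2) that] by simp
    then have "t ^ d = t ^ (d - (fst \<alpha> + snd \<alpha>)) * (t ^ fst \<alpha> * t ^ snd \<alpha>)"
      by (metis power_add)
    then have "t ^ d * ((w / t) ^ fst \<alpha> * (1 / t) ^ snd \<alpha>) = w ^ fst \<alpha> * t ^ (d - (fst \<alpha> + snd \<alpha>))"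
      unfolding power_divide power_one using t by (simp only: cancel power_not_zero not_False_eq_True)
    moreover have "u = t ^ d" "torus_map j z = (w / t, 1 / t)" "along_side j \<alpha> = fst \<alpha>"
      "off_side j d \<alpha> = d - (fst \<alpha> + snd \<alpha>)"
      using False by (auto simp: u_def torus_map_def along_side_def off_side_def wt)
    ultimately show ?thesis by (simp only: fst_conv snd_conv)
  qed
  have "u * random_poly d Q c (torus_map j z)
      = (\<Sum>\<alpha>\<in>exponents Q. c \<alpha> / of_real (monom_norm d \<alpha>) * (u * (fst (torus_map j z) ^ fst \<alpha> * snd (torus_map j z) ^ snd \<alpha>)))"
    unfolding random_poly_def sum_distrib_left by (intro sum.cong refl) simp
  also have "\<dots> = (\<Sum>\<alpha>\<in>exponents Q. (c \<alpha> / of_real (monom_norm d \<alpha>)) * (fst z ^ along_side j \<alpha> * snd z ^ off_side j d \<alpha>))"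
    by (intro sum.cong refl) (simp only: mono, simp add: wt)
  finally show ?thesis using u by (metis mult_eq_0_iff)
qed

lemma edge_exponent_side_map:
  assumes "i \<le> d"
  shows "(real (fst (edge_exponent j d i)), real (snd (edge_exponent j d i))) = side_map j (real d) (real i, 0)"
  using assms by (auto simp: edge_exponent_def side_map_def of_nat_diff)

lemma along_side_edge_exponent: "along_side j (edge_exponent j d i) = i"
  by (simp add: along_side_def edge_exponent_def)

lemma inj_on_edge_exponent: "inj_on (\<lambda>k. edge_exponent j d (m + k)) A"
  by (rule inj_onI) (metis along_side_edge_exponent add_left_cancel)

text \<open>On a side one of the three factorials is 0! = 1. The other two and (d + 2)! combine to a
  binomial coefficient times (d + 1) (d + 2), the same on all three sides.\<close>

lemma monom_norm_edge_exponent: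
  assumes "i \<le> d"
  shows "1 / monom_norm d (edge_exponent j d i) = edge_weight d i"
proof -
  have "monom_norm d (edge_exponent j d i) = sqrt (fact (d - i) * fact i / fact (d + 2))"
    using assms by (auto simp: monom_norm_def edge_exponent_def mult.commute)
  also have "fact (d - i) * fact i / fact (d + 2) = 1 / (real (d choose i) * (real d + 1) * (real d + 2))"
  proof -
    have f: "fact d = fact (d - i) * fact i * real (d choose i)"
      using binomial_fact_lemma[OF assms] by (metis mult.commute of_nat_fact of_nat_mult)
    have "fact (d + 2) = (real d + 2) * ((real d + 1) * fact d)"
      by (simp add: numeral_2_eq_2 algebra_simps)
    then show ?thesis unfolding f by simp
  qed
  finally show ?thesis using assms by (simp add: edge_weight_def real_sqrt_divide)
qed

lemma exponents_on_side:
  assumes d: "d > 0" "Q \<subseteq> dilate (real d) std_triangle"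
    and side: "Q \<inter> side d j = side_map j (real d) ` axis_segment (real m) (real (m + n))" and "m + n \<le> d"
  shows "{\<alpha> \<in> exponents Q. off_side j d \<alpha> = 0} = (\<lambda>k. edge_exponent j d (m + k)) ` {..n}"
proof (intro set_eqI iffI)
  fix \<alpha> assume \<alpha>: "\<alpha> \<in> {\<alpha> \<in> exponents Q. off_side j d \<alpha> = 0}"
  let ?x = "(real (fst \<alpha>), real (snd \<alpha>))"
  have le: "fst \<alpha> + snd \<alpha> \<le> d" using exponents_le[OF d] \<alpha> by blast
  have sm: "side_map j (real d) ?x = (real (along_side j \<alpha>), 0)"
    using side_map_exponent[OF le, of j] \<alpha> by simp
  then have "?x \<in> Q \<inter> side d j" using \<alpha> d(2) by (auto simp: exponents_def side_def)
  then have "side_map j (real d) ?x \<in> axis_segment (real m) (real (m + n))"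
    unfolding side image_side_map_iff .
  then have rng: "m \<le> along_side j \<alpha>" "along_side j \<alpha> \<le> m + n"
    unfolding sm axis_segment_def by (simp_all del: of_nat_add)
  have "?x = side_map j (real d) (real (along_side j \<alpha>), 0)"
    using sm side_map_involution[of j "real d" ?x] by simp
  also have "\<dots> = (real (fst (edge_exponent j d (along_side j \<alpha>))), real (snd (edge_exponent j d (along_side j \<alpha>))))"
    using rng assms(4) by (intro edge_exponent_side_map[symmetric]) simp
  finally have "\<alpha> = edge_exponent j d (along_side j \<alpha>)" by (simp add: prod_eq_iff)
  then have "\<alpha> = edge_exponent j d (m + (along_side j \<alpha> - m))" using rng by simp
  moreover have "along_side j \<alpha> - m \<in> {..n}" using rng by simp
  ultimately show "\<alpha> \<in> (\<lambda>k. edge_exponent j d (m + k)) ` {..n}" by (rule image_eqI)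
next
  fix \<alpha> assume "\<alpha> \<in> (\<lambda>k. edge_exponent j d (m + k)) ` {..n}"
  then obtain k where k: "k \<le> n" "\<alpha> = edge_exponent j d (m + k)" by blast
  let ?x = "(real (fst \<alpha>), real (snd \<alpha>))"
  have x: "?x = side_map j (real d) (real (m + k), 0)"
    unfolding k(2) using k(1) assms(4) by (intro edge_exponent_side_map) simp
  then have "?x \<in> Q \<inter> side d j"
    unfolding side image_side_map_iff using k(1) by (simp add: axis_segment_def)
  then have \<alpha>: "\<alpha> \<in> exponents Q" by (simp add: exponents_def)
  have "real (off_side j d \<alpha>) = snd (side_map j (real d) ?x)"
    using side_map_exponent[OF exponents_le[OF d \<alpha>], of j] by simp
  also have "\<dots> = 0" unfolding x by simp
  finally show "\<alpha> \<in> {\<alpha> \<in> exponents Q. off_side j d \<alpha> = 0}" using \<alpha> by simp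
qed

section \<open>From tentacles to roots of edge polynomials\<close>

lemma side_dilate:
  assumes "N > 0" "p > 0"
  shows "dilate (real N) P \<inter> side (N * p) j = dilate (real N) (P \<inter> side p j)"
proof -
  have inj: "inj (\<lambda>x :: real \<times> real. real N *\<^sub>R x)" using assms by (intro injI) simp
  have "side (N * p) j = dilate (real N) (side p j)"
  proof (intro set_eqI iffI)
    fix x assume x: "x \<in> side (N * p) j"
    then obtain y where y: "y \<in> std_triangle" "x = real (N * p) *\<^sub>R y" by (auto simp: side_def)
    have eq: "side_map j (real (N * p)) x = real N *\<^sub>R side_map j (real p) (real p *\<^sub>R y)"
      by (simp add: side_map_scaleR y(2))
    have "real N * snd (side_map j (real p) (real p *\<^sub>R y)) = 0"
      using x eq by (simp add: side_def)
    then have "real p *\<^sub>R y \<in> side p j" using y(1) assms by (simp add: side_def)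
    moreover have "x = real N *\<^sub>R (real p *\<^sub>R y)" by (simp add: y(2))
    ultimately show "x \<in> dilate (real N) (side p j)" by (rule rev_image_eqI)
  next
    fix x assume "x \<in> dilate (real N) (side p j)"
    then obtain y where y: "y \<in> std_triangle" "snd (side_map j (real p) (real p *\<^sub>R y)) = 0" "x = real (N * p) *\<^sub>R y"
      by (auto simp: side_def)
    have "side_map j (real (N * p)) x = real N *\<^sub>R side_map j (real p) (real p *\<^sub>R y)"
      by (simp add: side_map_scaleR y(3))
    then have "snd (side_map j (real (N * p)) x) = 0" using y(2) by simp
    moreover have "x \<in> dilate (real (N * p)) std_triangle" unfolding y(3) using y(1) by (rule imageI)
    ultimately show "x \<in> side (N * p) j" unfolding side_def by blast
  qed
  then show ?thesis using inj by (simp add: image_Int)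
qed

text \<open>A tentacle ending in an open side is automatically free: its direction is the outer
  normal of that side, and any lattice segment of the Newton polytope on the side is a witness. So
  only isolated end points remain to be counted.\<close>

lemma nu_AT_eqI:
  assumes finJ: "J \<subseteq> {..<3}"
    and allowed: "allowed_boundary p P \<subseteq> (\<Union>j\<in>J. open_side j)"
    and fin: "\<And>j. j \<in> J \<Longrightarrow> finite (compact_amoeba B \<inter> open_side j)"
    and seg: "\<And>j. j \<in> J \<Longrightarrow> \<exists>s \<in> lattice_segments (ext_boundary (N * p) (dilate (real N) P)). s \<subseteq> side (N * p) j"
    and d: "N * p > 0"
  shows "nu_AT p P N B = card (compact_amoeba B \<inter> allowed_boundary p P)"
proof -
  let ?A = "compact_amoeba B"
  define D where "D = ?A \<inter> frontier std_triangle"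
  define E where "E = ?A \<inter> allowed_boundary p P"
  have os: "open_side j \<subseteq> frontier std_triangle" if "j \<in> J" for j
    using finJ that by (intro open_side_frontier) auto
  have ED: "E \<subseteq> D" using allowed os unfolding E_def D_def by blast
  have fJ: "finite J" using finJ by (rule finite_subset) simp
  have "E \<subseteq> (\<Union>j\<in>J. ?A \<inter> open_side j)" using allowed unfolding E_def by blast
  then have finE: "finite E" by (rule finite_subset) (intro finite_UN_I fJ fin)
  have iso: "\<exists>\<eta>>0. \<forall>y\<in>D. y \<noteq> e \<longrightarrow> \<eta> \<le> dist e y" if e: "e \<in> E" for e
  proof -
    obtain j where j: "j \<in> J" "e \<in> open_side j" using e allowed unfolding E_def by blast
    \<comment> \<open>The possible neighbours of \<open>e\<close>: the finitely many other amoeba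
      points on its open side, and the closed rest of the frontier.\<close>
    let ?K = "((?A \<inter> open_side j) - {e}) \<union> (frontier std_triangle - open_side j)"
    have "closed ?K"
      using fin[OF j(1)] j(1) finJ
      by (intro closed_Un finite_imp_closed frontier_minus_open_side_closed) auto
    moreover have "e \<notin> ?K" using j(2) by blast
    ultimately obtain \<eta> where "\<eta> > 0" "ball e \<eta> \<subseteq> - ?K"
      by (metis ComplI open_Compl open_contains_ball)
    moreover have "y \<in> ?K" if "y \<in> D" "y \<noteq> e" for y using that unfolding D_def by blast
    ultimately show ?thesis by (intro exI[of _ \<eta>]) (force simp: subset_iff not_less[symmetric])
  qed
  have tent: "{T \<in> tentacles B \<epsilon>. free_tentacle (N * p) (dilate (real N) P) B T \<and> ends_allowed p P T}
      = {T \<in> components {x \<in> ?A. \<exists>y\<in>D. dist x y < \<epsilon>}. \<exists>e. T \<inter> D = {e} \<and> e \<in> E}"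
    if \<epsilon>: "\<epsilon> > 0" for \<epsilon>
  proof -
    have tc: "tentacles B \<epsilon> = components {x \<in> ?A. \<exists>y\<in>D. dist x y < \<epsilon>}"
      by (simp add: tentacles_def Let_def D_def)
    have "(free_tentacle (N * p) (dilate (real N) P) B T \<and> ends_allowed p P T) \<longleftrightarrow> (\<exists>e. T \<inter> D = {e} \<and> e \<in> E)"
      if T: "T \<in> tentacles B \<epsilon>" for T
    proof -
      have TA: "T \<subseteq> ?A" using in_components_subset T unfolding tc by blast
      then have TD: "T \<inter> frontier std_triangle = T \<inter> D" unfolding D_def by blast
      have ends: "ends_allowed p P T \<longleftrightarrow> (\<exists>e. T \<inter> D = {e} \<and> e \<in> E)"
        unfolding ends_allowed_def TD E_def using TA by blast
      have "free_tentacle (N * p) (dilate (real N) P) B T" if e: "T \<inter> D = {e}" "e \<in> E" for e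
      proof -
        obtain j where j: "j \<in> J" "e \<in> open_side j" using e(2) allowed unfolding E_def by blast
        have j3: "j < 3" using j(1) finJ by auto
        obtain s where s: "s \<in> lattice_segments (ext_boundary (N * p) (dilate (real N) P))" "s \<subseteq> side (N * p) j"
          using seg[OF j(1)] by blast
        have "outer_normal (dilate (real (N * p)) std_triangle) s (side_normal j)"
          using s(2) d by (intro outer_normal_side j3) (auto simp: side_def subset_iff)
        moreover have "asymptotic_direction B T (side_normal j)"
          using e(1) by (intro tentacle_asymptotic_direction[OF T \<epsilon> _ j(2) j3]) (simp only: TD)
        ultimately show ?thesis using s(1) unfolding free_tentacle_def by blast
      qed
      with ends show ?thesis by blast
    qed
    then show ?thesis unfolding tc by blast
  qed
  have DA: "D \<subseteq> ?A" unfolding D_def by blast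
  have comps: "\<forall>\<^sub>F \<epsilon> in at_right 0.
      card {T \<in> components {x \<in> ?A. \<exists>y\<in>D. dist x y < \<epsilon>}. \<exists>e. T \<inter> D = {e} \<and> e \<in> E} = card E"
    by (rule card_components_at_isolated_points[OF DA ED finE]) (rule iso)
  have ev: "\<forall>\<^sub>F \<epsilon> in at_right 0. card {T \<in> tentacles B \<epsilon>.
      free_tentacle (N * p) (dilate (real N) P) B T \<and> ends_allowed p P T} = card E"
    using comps eventually_at_right_less[of "0::real"] by eventually_elim (simp only: tent)
  show ?thesis unfolding nu_AT_def
  proof (rule the_equality)
    show "\<forall>\<^sub>F \<epsilon> in at_right 0. card {T \<in> tentacles B \<epsilon>.
      free_tentacle (N * p) (dilate (real N) P) B T \<and> ends_allowed p P T} = card (?A \<inter> allowed_boundary p P)"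
      using ev unfolding E_def .
  next
    fix n assume "\<forall>\<^sub>F \<epsilon> in at_right 0. card {T \<in> tentacles B \<epsilon>.
      free_tentacle (N * p) (dilate (real N) P) B T \<and> ends_allowed p P T} = n"
    with ev have "\<forall>\<^sub>F \<epsilon> in at_right (0::real). card E = n" by eventually_elim simp
    \<comment> \<open>The filter \<open>at_right 0\<close> is nontrivial, so two eventual values
      coincide.\<close>
    then have "card E = n"
      using eventually_const[of "at_right (0::real)" "card E = n"] trivial_limit_at_right_real[of 0] by blast
    then show "n = card (?A \<inter> allowed_boundary p P)" unfolding E_def by (rule sym)
  qed
qed

text \<open>In the coordinates adapted to side \<open>j\<close>, the terms with
  \<open>off_side\<close> equal to 0 form \<open>g\<close>. It is nonzero since the coefficient at
  one end of the edge is.\<close>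

lemma amoeba_open_side:
  fixes c :: "nat \<times> nat \<Rightarrow> complex"
  assumes d: "N * p > 0" "dilate (real N) P \<subseteq> dilate (real (N * p)) std_triangle"
    and ab: "a < b" "b \<le> p"
      "dilate (real N) P \<inter> side (N * p) j = side_map j (real (N * p)) ` axis_segment (real (N * a)) (real (N * b))"
    and nz: "c (edge_exponent j (N * p) (N * a)) \<noteq> 0"
  defines "A \<equiv> compact_amoeba (Log_map ` torus_zeros (random_poly (N * p) (dilate (real N) P) c))"
    and "g \<equiv> monom 1 (N * a) * edge_poly N p a b (\<lambda>k. edge_exponent j (N * p) (N * a + k)) c"
  shows "g \<noteq> 0" and "A \<inter> open_side j = side_map j 1 ` ((root_positions g \<inter> {0<..<1}) \<times> {0})"
proof -
  let ?d = "N * p" and ?Q = "dilate (real N) P" and ?n = "N * (b - a)"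
  let ?idx = "\<lambda>k. edge_exponent j ?d (N * a + k)"
  let ?C = "\<lambda>\<alpha>. c \<alpha> / complex_of_real (monom_norm ?d \<alpha>)"
  let ?Z = "torus_zeros (\<lambda>z. \<Sum>\<alpha>\<in>exponents ?Q. ?C \<alpha> * (fst z ^ along_side j \<alpha> * snd z ^ off_side j ?d \<alpha>))"
  have le: "N * a + k \<le> ?d" if "k \<le> ?n" for k
  proof -
    have "N * a + N * (b - a) = N * b" using ab by (simp flip: add_mult_distrib2)
    moreover have "N * b \<le> N * p" using ab by simp
    ultimately show ?thesis using that by linarith
  qed
  have nb: "N * a + ?n = N * b" using ab by (simp flip: add_mult_distrib2)
  have exps: "{\<alpha> \<in> exponents ?Q. off_side j ?d \<alpha> = 0} = ?idx ` {..?n}"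
    using exponents_on_side[OF d, of j "N * a" ?n] ab(3) le[of ?n] by (simp only: nb order_refl)
  have C: "?C (?idx k) = c (?idx k) * of_real (edge_weight ?d (N * a + k))" if "k \<le> ?n" for k
    using monom_norm_edge_exponent[OF le[OF that], of j] by (metis divide_inverse inverse_eq_divide of_real_inverse)
  have sum: "(\<Sum>\<alpha> | \<alpha> \<in> exponents ?Q \<and> off_side j ?d \<alpha> = 0. monom (?C \<alpha>) (along_side j \<alpha>)) = g"
  proof -
    have "(\<Sum>\<alpha> | \<alpha> \<in> exponents ?Q \<and> off_side j ?d \<alpha> = 0. monom (?C \<alpha>) (along_side j \<alpha>))
        = (\<Sum>k\<le>?n. monom (?C (?idx k)) (along_side j (?idx k)))"
      unfolding exps by (subst sum.reindex[OF inj_on_edge_exponent]) (simp only: o_def)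
    also have "\<dots> = (\<Sum>k\<le>?n. monom 1 (N * a) * monom (c (?idx k) * of_real (edge_weight ?d (N * a + k))) k)"
      by (intro sum.cong refl) (simp only: along_side_edge_exponent atMost_iff C mult_monom mult_1)
    also have "\<dots> = g" unfolding g_def edge_poly_def sampled_poly_def sum_distrib_left ..
    finally show ?thesis .
  qed
  have "coeff (edge_poly N p a b ?idx c) 0 \<noteq> 0"
    using nz edge_weight_pos[of ?d "N * a"] by (simp add: edge_poly_def sampled_poly_coeff)
  then show g: "g \<noteq> 0" unfolding g_def by auto
  have zeros: "torus_zeros (\<lambda>z. random_poly ?d ?Q c (torus_map j z))
      = ?Z"
    unfolding torus_zeros_def using random_poly_torus_map[OF d] by blast
  have A: "A = side_map j 1 ` closure (moment_map ` ?Z)"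
  proof -
    have "moment_map ` torus_zeros (random_poly ?d ?Q c)
        = side_map j 1 ` moment_map ` torus_zeros (\<lambda>z. random_poly ?d ?Q c (torus_map j z))"
      by (rule moment_map_zeros_side)
    then show ?thesis unfolding A_def compact_amoeba_torus_zeros by (simp only: zeros closure_side_map)
  qed
  have pt: "side_map j 1 (x, 0) \<in> A \<longleftrightarrow> x \<in> root_positions g" if "0 < x" "x < 1" for x
  proof -
    have "side_map j 1 (x, 0) \<in> A \<longleftrightarrow> (x, 0) \<in> closure (moment_map ` ?Z)"
      unfolding A image_side_map_iff by simp
    also have "\<dots> \<longleftrightarrow> (\<exists>w. poly g w = 0 \<and> x = (cmod w)\<^sup>2 / (1 + (cmod w)\<^sup>2))"
      using boundary_point_iff_root[where l = "off_side j ?d" and C = "?C" and m = "along_side j" and x = x, OF finite_exponents[OF d]] g that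
      unfolding sum by blast
    also have "\<dots> \<longleftrightarrow> x \<in> root_positions g" unfolding root_positions_def by blast
    finally show ?thesis .
  qed
  show "A \<inter> open_side j = side_map j 1 ` ((root_positions g \<inter> {0<..<1}) \<times> {0})"
    unfolding open_side_def using pt by auto
qed

text \<open>A deterministic identity: both sides count positions, that is, distinct moduli. The
  almost sure distinctness of moduli enters only when the expected number of positions is compared
  with the degree.\<close>

lemma nu_AT_random_poly:
  fixes c :: "nat \<times> nat \<Rightarrow> complex"
  assumes p: "p > 0" "P \<subseteq> dilate (real p) std_triangle" and N: "N > 0"
    and J: "J = {j. j < 3 \<and> aff_dim (P \<inter> side p j) = 1}"
    and ab: "\<And>j. j \<in> J \<Longrightarrow> a j < b j" "\<And>j. j \<in> J \<Longrightarrow> b j \<le> p"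
      "\<And>j. j \<in> J \<Longrightarrow> P \<inter> side p j = side_map j (real p) ` axis_segment (real (a j)) (real (b j))"
    and nz: "\<And>j. j \<in> J \<Longrightarrow> c (edge_exponent j (N * p) (N * a j)) \<noteq> 0"
  shows "nu_AT p P N (Log_map ` torus_zeros (random_poly (N * p) (dilate (real N) P) c))
    = (\<Sum>j\<in>J. allowed_count N p (a j) (b j) (\<lambda>k. edge_exponent j (N * p) (N * a j + k)) c)"
proof -
  let ?d = "N * p" and ?Q = "dilate (real N) P"
  let ?B = "Log_map ` torus_zeros (random_poly ?d ?Q c)"
  let ?A = "compact_amoeba ?B"
  let ?R = "\<lambda>j. {real (a j) / real p<..<real (b j) / real p}"
  define G where "G = (\<lambda>j. edge_poly N p (a j) (b j) (\<lambda>k. edge_exponent j ?d (N * a j + k)) c)"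
  define g where "g = (\<lambda>j. monom 1 (N * a j) * G j)"
  define X where "X = (\<lambda>j. root_positions (G j) \<inter> ?R j)"
  have d: "?d > 0" using p N by simp
  have Q: "?Q \<subseteq> dilate (real ?d) std_triangle"
    using image_mono[OF p(2), of "\<lambda>x. real N *\<^sub>R x"] by (simp add: image_image)
  have J3: "J \<subseteq> {..<3}" unfolding J by auto
  have side: "?Q \<inter> side ?d j = side_map j (real ?d) ` axis_segment (real (N * a j)) (real (N * b j))" if "j \<in> J" for j
  proof -
    have "a j \<le> b j" using ab(1)[OF that] by simp
    then have "real (a j) \<le> real (b j)" "real (N * a j) \<le> real (N * b j)"
      unfolding of_nat_le_iff by (auto intro: mult_le_mono2)
    moreover have "dilate (real N) (closed_segment u v) = closed_segment (real N *\<^sub>R u) (real N *\<^sub>R v)" for u v :: "real \<times> real"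
      by (rule closed_segment_linear_image[symmetric]) (rule linear_scaleR)
    ultimately have "dilate (real N) (axis_segment (real (a j)) (real (b j))) = axis_segment (real (N * a j)) (real (N * b j))"
      by (simp add: axis_segment_eq)
    then show ?thesis
      unfolding side_dilate[OF N p(1)] ab(3)[OF that]
      by (simp add: image_image side_map_scaleR) (metis image_image)
  qed
  have g0: "g j \<noteq> 0" and Aside: "?A \<inter> open_side j = side_map j 1 ` ((root_positions (g j) \<inter> {0<..<1}) \<times> {0})" if "j \<in> J" for j
    unfolding g_def G_def
    by (rule amoeba_open_side[where j = j and a = "a j" and b = "b j" and c = c and N = N and p = p and P = P,
          OF d Q ab(1)[OF that] ab(2)[OF that] side[OF that] nz[OF that]])+
  have bounds: "0 \<le> real (a j) / real p" "real (b j) / real p \<le> 1" if "j \<in> J" for j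
    using ab(2)[OF that] p by (auto simp: divide_le_eq_1)
  have interval: "?R j \<subseteq> {0<..<1}" if "j \<in> J" for j
  proof
    fix x assume "x \<in> ?R j"
    then have "real (a j) / real p < x" "x < real (b j) / real p" by (simp_all only: greaterThanLessThan_iff)
    then have "0 < x" "x < 1"
      using le_less_trans[OF bounds(1)[OF that]] less_le_trans[OF _ bounds(2)[OF that]] by blast+
    then show "x \<in> {0<..<1}" by simp
  qed
  \<comment> \<open>The monomial factor can add only the root 0, whose position is 0.\<close>
  have gG: "x \<in> root_positions (g j) \<longleftrightarrow> x \<in> root_positions (G j)" if "x > 0" for x j
    using that unfolding root_positions_def g_def
    by (auto simp: poly_monom) 
  have allowed: "allowed_boundary p P = (\<Union>j\<in>J. side_map j 1 ` (?R j \<times> {0}))"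
    by (rule allowed_boundary_eq[OF p(1) J ab(1,3)])
  have sub: "side_map j 1 ` (?R j \<times> {0}) \<subseteq> open_side j" if "j \<in> J" for j
    unfolding open_side_def using interval[OF that] by (intro image_mono Sigma_mono) blast+
  have inter: "?A \<inter> side_map j 1 ` (?R j \<times> {0}) = side_map j 1 ` (X j \<times> {0})"
    if j: "j \<in> J" for j
  proof -
    have "?A \<inter> side_map j 1 ` (?R j \<times> {0})
        = (?A \<inter> open_side j) \<inter> side_map j 1 ` (?R j \<times> {0})"
      using sub[OF j] by blast
    also have "\<dots> = side_map j 1 ` (((root_positions (g j) \<inter> {0<..<1}) \<times> {0}) \<inter> (?R j \<times> {0}))"
      unfolding Aside[OF j] by (rule image_Int[OF inj_side_map, symmetric])
    also have "((root_positions (g j) \<inter> {0<..<1}) \<times> {0::real}) \<inter> (?R j \<times> {0}) = X j \<times> {0}"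
      unfolding X_def using interval[OF j] gG[of _ j]
      by (intro set_eqI) (simp only: Int_iff mem_Times_iff subset_iff greaterThanLessThan_iff, blast)
    finally show ?thesis .
  qed
  have "nu_AT p P N ?B = card (?A \<inter> allowed_boundary p P)"
  proof (rule nu_AT_eqI[OF J3 _ _ _ d])
    show "allowed_boundary p P \<subseteq> (\<Union>j\<in>J. open_side j)" unfolding allowed using sub by blast
    show "finite (?A \<inter> open_side j)" if "j \<in> J" for j
      unfolding Aside[OF that] using finite_root_positions[OF g0[OF that]] by simp
    show "\<exists>s\<in>lattice_segments (ext_boundary ?d ?Q). s \<subseteq> side ?d j" if j: "j \<in> J" for j
    proof -
      have "N * a j < N * b j" using ab(1)[OF j] N by simp
      then have "side_map j (real ?d) ` axis_segment (real (N * a j)) (real (Suc (N * a j))) \<in> lattice_segments (?Q \<inter> side ?d j)"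
        unfolding side[OF j] lattice_segments_side_map lattice_segments_axis by (intro imageI) simp
      moreover from this have "side_map j (real ?d) ` axis_segment (real (N * a j)) (real (Suc (N * a j))) \<subseteq> side ?d j"
        unfolding lattice_segments_def by blast
      ultimately show ?thesis
        unfolding lattice_segments_ext_boundary[OF d Q] using j J3 by blast
    qed
  qed
  also have "?A \<inter> allowed_boundary p P = (\<Union>j\<in>J. side_map j 1 ` (X j \<times> {0}))"
    unfolding allowed using inter by blast
  also have "card \<dots> = (\<Sum>j\<in>J. card (side_map j 1 ` (X j \<times> {0})))"
  proof (rule card_UN_disjoint)
    show "finite J" using J3 by (rule finite_subset) simp
    have "finite (side_map j 1 ` (X j \<times> {0}))" if "j \<in> J" for j
    proof (rule finite_subset)
      show "side_map j 1 ` (X j \<times> {0}) \<subseteq> ?A \<inter> open_side j" using inter[OF that] sub[OF that] by blast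
      show "finite (?A \<inter> open_side j)"
        unfolding Aside[OF that] using finite_root_positions[OF g0[OF that]] by simp
    qed
    then show "\<forall>j\<in>J. finite (side_map j 1 ` (X j \<times> {0}))" by blast
    have "side_map i 1 ` (X i \<times> {0}) \<inter> side_map j 1 ` (X j \<times> {0}) = {}" if "i \<in> J" "j \<in> J" "i \<noteq> j" for i j
    proof -
      have "open_side i \<inter> open_side j = {}" using that J3 by (intro open_side_disjoint) auto
      then show ?thesis using inter[OF that(1)] inter[OF that(2)] sub[OF that(1)] sub[OF that(2)] by blast
    qed
    then show "\<forall>i\<in>J. \<forall>j\<in>J. i \<noteq> j \<longrightarrow> side_map i 1 ` (X i \<times> {0}) \<inter> side_map j 1 ` (X j \<times> {0}) = {}" by blast
  qed
  also have "\<dots> = (\<Sum>j\<in>J. card (X j))"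
    by (intro sum.cong refl) (simp add: card_image[OF inj_on_subset[OF inj_side_map subset_UNIV]] card_cartesian_product)
  finally show ?thesis by (simp only: X_def G_def allowed_count_def)
qed

theorem corollary5p6:
  fixes P :: "(real \<times> real) set" and p :: nat
  assumes "p > 0"
    and "convex_integral_polytope P"
    and "P \<subseteq> dilate (real p) std_triangle"
  shows "(\<lambda>N. 1 / real N *
            poly_expectation (N * p) (dilate (real N) P)
              (\<lambda>f. real (nu_AT p P N (Log_map ` torus_zeros f))))
         \<longlonglongrightarrow> real (lattice_length (ext_boundary p P))"
proof -
  let ?V = "\<lambda>N. poly_expectation (N * p) (dilate (real N) P)
    (\<lambda>f. real (nu_AT p P N (Log_map ` torus_zeros f)))"
  let ?nu = "\<lambda>N c. nu_AT p P N (Log_map ` torus_zeros (random_poly (N * p) (dilate (real N) P) c))"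
  \<comment> \<open>Sides that \<open>P\<close> meets in at most one point contribute to neither
    side of the limit: they carry no lattice segment and no allowed boundary.\<close>
  define J where "J = {j. j < 3 \<and> aff_dim (P \<inter> side p j) = 1}"
  have "\<forall>j\<in>J. \<exists>a b. a < b \<and> b \<le> p \<and> P \<inter> side p j = side_map j (real p) ` axis_segment (real a) (real b)"
    unfolding J_def using polytope_side[OF assms] by blast
  then obtain a b where ab: "\<And>j. j \<in> J \<Longrightarrow> a j < b j" "\<And>j. j \<in> J \<Longrightarrow> b j \<le> p"
      "\<And>j. j \<in> J \<Longrightarrow> P \<inter> side p j = side_map j (real p) ` axis_segment (real (a j)) (real (b j))"
    by metis
  have finJ: "finite J" by (rule finite_subset[of _ "{..<3}"]) (auto simp: J_def)
  define idx where "idx = (\<lambda>j N k. edge_exponent j (N * p) (N * a j + k))"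
  let ?I = "\<lambda>N. exponents (dilate (real N) P)"
  let ?E = "\<lambda>j N. \<integral>c. real (allowed_count N p (a j) (b j) (idx j N) c) \<partial>gaussian_family (?I N)"
  have Q: "dilate (real N) P \<subseteq> dilate (real (N * p)) std_triangle" for N
    using image_mono[OF assms(3), of "\<lambda>x. real N *\<^sub>R x"] by (simp add: image_image)
  have finI: "finite (?I N)" if "N > 0" for N
    using that assms(1) Q by (intro finite_exponents[of "N * p"]) auto
  have idx: "idx j N k \<in> ?I N" if "j \<in> J" "N > 0" "k \<le> N * (b j - a j)" for j N k
  proof -
    have "N * a j + k \<le> N * b j"
    proof -
      have "N * a j + N * (b j - a j) = N * b j" using ab(1)[OF that(1)] by (simp flip: add_mult_distrib2)
      then show ?thesis using that(3) by linarith
    qed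
    moreover have "N * b j \<le> N * p" using ab(2)[OF that(1)] by simp
    ultimately have le: "N * a j + k \<le> N * p" "N * a j + k \<le> N * b j" by linarith+
    let ?y = "(real (N * a j + k) / real N, 0 :: real)"
    have "?y \<in> axis_segment (real (a j)) (real (b j))"
      using le(2) that(2) by (simp add: axis_segment_def pos_le_divide_eq pos_divide_le_eq mult.commute flip: of_nat_mult of_nat_add)
    then have "side_map j (real p) ?y \<in> P" using ab(3)[OF that(1)] by blast
    then have "real N *\<^sub>R side_map j (real p) ?y \<in> dilate (real N) P" by (rule imageI)
    also have "real N *\<^sub>R side_map j (real p) ?y = side_map j (real (N * p)) (real (N * a j + k), 0)"
      using that(2) by (simp add: side_map_scaleR)
    finally show ?thesis
      unfolding exponents_def idx_def mem_Collect_eq edge_exponent_side_map[OF le(1)] .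
  qed
  have expect: "?V N = (\<Sum>j\<in>J. ?E j N)" if N: "N > 0" for N
  proof -
    let ?M = "gaussian_family (?I N)"
    let ?Y = "\<lambda>j c. real (allowed_count N p (a j) (b j) (idx j N) c)"
    have int: "integrable ?M (?Y j)" if "j \<in> J" for j
    \<comment> \<open>Only integrability is taken from the estimate here, so any admissible
      constants serve.\<close>
    proof (rule allowed_count_expectation(1)[where \<eta> = 1 and \<delta> = 1 and \<gamma> = 1, OF N ab(1,2)[OF that] finI[OF N]])
      show "idx j N k \<in> ?I N" if "k \<le> N * (b j - a j)" for k using idx[OF \<open>j \<in> J\<close> N that] .
      show "inj_on (idx j N) {..N * (b j - a j)}" unfolding idx_def by (rule inj_on_edge_exponent)
    qed simp_all
    have "AE c in ?M. \<forall>j\<in>J. c (idx j N 0) \<noteq> 0"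
    proof (rule AE_finite_allI[OF finJ])
      fix j assume "j \<in> J"
      then show "AE c in ?M. c (idx j N 0) \<noteq> 0"
        using idx[of j N 0] N by (intro AE_gaussian_family_component[where P = "\<lambda>z. z \<noteq> 0"] AE_lborel_singleton) simp
    qed
    then have ae: "AE c in ?M. real (?nu N c) = (\<Sum>j\<in>J. ?Y j c)"
    proof (rule eventually_mono)
      fix c :: "nat \<times> nat \<Rightarrow> complex" assume "\<forall>j\<in>J. c (idx j N 0) \<noteq> 0"
      then have "?nu N c = (\<Sum>j\<in>J. allowed_count N p (a j) (b j) (idx j N) c)"
        unfolding idx_def by (intro nu_AT_random_poly[OF assms(1,3) N J_def ab]) simp_all
      then show "real (?nu N c) = (\<Sum>j\<in>J. ?Y j c)" by simp
    qed
    have "(\<lambda>c. \<Sum>j\<in>J. ?Y j c) \<in> borel_measurable ?M"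
      using int by (intro borel_measurable_sum borel_measurable_integrable)
    from AE_eq_completion_integral[OF this ae]
    have "?V N = (\<integral>c. (\<Sum>j\<in>J. ?Y j c) \<partial>?M)" unfolding poly_expectation_def .
    also have "\<dots> = (\<Sum>j\<in>J. ?E j N)" using int by (rule Bochner_Integration.integral_sum)
    finally show ?thesis .
  qed
  have "(\<lambda>N. \<Sum>j\<in>J. ?E j N / real N) \<longlonglongrightarrow> (\<Sum>j\<in>J. real (b j - a j))"
  proof (rule tendsto_sum)
    fix j assume j: "j \<in> J"
    show "(\<lambda>N. ?E j N / real N) \<longlonglongrightarrow> real (b j - a j)"
    proof (rule allowed_count_limit[OF ab(1,2)[OF j] finI])
      show "idx j N k \<in> ?I N" if "N > 0" "k \<le> N * (b j - a j)" for N k using idx[OF j that] .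
      show "inj_on (idx j N) {..N * (b j - a j)}" for N unfolding idx_def by (rule inj_on_edge_exponent)
    qed
  qed
  moreover have "\<forall>\<^sub>F N in sequentially. (\<Sum>j\<in>J. ?E j N / real N) = 1 / real N * ?V N"
    using eventually_gt_at_top[of 0]
    by (rule eventually_mono) (simp add: expect sum_divide_distrib)
  ultimately have "(\<lambda>N. 1 / real N * ?V N) \<longlonglongrightarrow> (\<Sum>j\<in>J. real (b j - a j))"
    by (rule Lim_transform_eventually)
  then show ?thesis
    using lattice_length_ext_boundary[OF assms(1,3) J_def ab(3)] by simp
qed

end
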